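(* Let $E$ be an elliptic curve over $\mathbb Q$ with conductor $35$. Then the weight-2 cusp form $f(\tau)=\sum_{n\ge1}a_E(n)q^n\in S_2(\Gamma_0(35))$ attached to $E$ by the Modularity Theorem (where $L(E,s)=\sum_{n\ge1}a_E(n)n^{-s}$) satisfies $$f(\tau)=\eta(\tau)^2\eta(35\tau)^2+\eta(5\tau)^2\eta(7\tau)^2.$$
   Context: $\eta(\tau)=q^{1/24}\prod_{n\ge1}(1-q^n)$, $q=e^{2\pi i\tau}$. $S_2(\Gamma_0(35))$ is the space of weight 2 cusp forms on $\Gamma_0(35)$. *)

theory Defs
  imports
    "HOL-Computational_Algebra.Computational_Algebra"
    "HOL-Complex_Analysis.Complex_Analysis"
    "HOL-Algebra.Ideal_Product"
begin

section \<open>Weierstrass equations\<close>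

text \<open>The equation $y^2 + a_1 x y + a_3 y = x^3 + a_2 x^2 + a_4 x + a_6$.\<close>

datatype 'a weierstrass =
  Weierstrass (wa1: 'a) (wa2: 'a) (wa3: 'a) (wa4: 'a) (wa6: 'a)

definition weier_disc :: "'a::comm_ring_1 weierstrass \<Rightarrow> 'a" where
  "weier_disc W =
     (let a1 = wa1 W; a2 = wa2 W; a3 = wa3 W; a4 = wa4 W; a6 = wa6 W;
          b2 = a1^2 + 4 * a2;
          b4 = 2 * a4 + a1 * a3;
          b6 = a3^2 + 4 * a6;
          b8 = a1^2 * a6 + 4 * a2 * a6 - a1 * a3 * a4 + a2 * a3^2 - a4^2
      in - (b2^2 * b8) - 8 * b4^3 - 27 * b6^2 + 9 * b2 * b4 * b6)"

definition elliptic_curve :: "'a::field weierstrass \<Rightarrow> bool" where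
  "elliptic_curve W \<longleftrightarrow> weier_disc W \<noteq> 0"

definition weier_eq :: "'a::comm_ring_1 weierstrass \<Rightarrow> 'a \<Rightarrow> 'a \<Rightarrow> 'a" where
  "weier_eq W x y =
     y^2 + wa1 W * x * y + wa3 W * y - (x^3 + wa2 W * x^2 + wa4 W * x + wa6 W)"

definition weier_eq_dx :: "'a::comm_ring_1 weierstrass \<Rightarrow> 'a \<Rightarrow> 'a \<Rightarrow> 'a" where
  "weier_eq_dx W x y = wa1 W * y - (3 * x^2 + 2 * wa2 W * x + wa4 W)"

definition weier_eq_dy :: "'a::comm_ring_1 weierstrass \<Rightarrow> 'a \<Rightarrow> 'a \<Rightarrow> 'a" where
  "weier_eq_dy W x y = 2 * y + wa1 W * x + wa3 W"

text \<open>Isomorphism over the base field: the substitution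
  $x = u^2 x' + r$, $y = u^3 y' + s u^2 x' + t$ turns \<open>W\<close> into \<open>W'\<close>.\<close>

definition weier_iso :: "'a::field weierstrass \<Rightarrow> 'a weierstrass \<Rightarrow> bool" where
  "weier_iso W W' \<longleftrightarrow>
     (\<exists>u r s t. u \<noteq> 0 \<and>
        u * wa1 W' = wa1 W + 2 * s \<and>
        u^2 * wa2 W' = wa2 W - s * wa1 W + 3 * r - s^2 \<and>
        u^3 * wa3 W' = wa3 W + r * wa1 W + 2 * t \<and>
        u^4 * wa4 W' = wa4 W - s * wa3 W + 2 * r * wa2 W - (t + r * s) * wa1 W
                         + 3 * r^2 - 2 * s * t \<and>
        u^6 * wa6 W' = wa6 W + r * wa4 W + r^2 * wa2 W + r^3
                         - t * wa3 W - t^2 - r * t * wa1 W)"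


section \<open>Reduction modulo a prime of curves over the rationals\<close>

definition rat_val :: "nat \<Rightarrow> rat \<Rightarrow> int" where
  "rat_val p x = int (multiplicity (int p) (fst (quotient_of x)))
                 - int (multiplicity (int p) (snd (quotient_of x)))"

definition p_integral :: "nat \<Rightarrow> rat \<Rightarrow> bool" where
  "p_integral p x \<longleftrightarrow> \<not> int p dvd snd (quotient_of x)"

text \<open>For $p$-integral \<open>x\<close>: the residue class of \<open>x\<close> in $\mathbb{Z}_{(p)}/p = \mathbb{F}_p$
  vanishes.  Elements of $\mathbb{F}_p$ are represented by the integers in \<open>{0..<p}\<close>.\<close>

definition res_zero :: "nat \<Rightarrow> rat \<Rightarrow> bool" where
  "res_zero p x \<longleftrightarrow> int p dvd fst (quotient_of x)"

definition p_integral_model :: "nat \<Rightarrow> rat weierstrass \<Rightarrow> bool" where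
  "p_integral_model p W \<longleftrightarrow> (\<forall>a \<in> set_weierstrass W. p_integral p a)"

definition minimal_at :: "nat \<Rightarrow> rat weierstrass \<Rightarrow> bool" where
  "minimal_at p W \<longleftrightarrow> p_integral_model p W \<and>
     (\<forall>W'. weier_iso W W' \<and> p_integral_model p W' \<longrightarrow>
        rat_val p (weier_disc W) \<le> rat_val p (weier_disc W'))"

definition minimal_model :: "nat \<Rightarrow> rat weierstrass \<Rightarrow> rat weierstrass" where
  "minimal_model p E = (SOME W. weier_iso E W \<and> minimal_at p W)"

definition good_reduction :: "nat \<Rightarrow> rat weierstrass \<Rightarrow> bool" where
  "good_reduction p E \<longleftrightarrow> \<not> res_zero p (weier_disc (minimal_model p E))"

definition res_points :: "nat \<Rightarrow> rat weierstrass \<Rightarrow> (int \<times> int) set" where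
  "res_points p W = {(x, y). x \<in> {0..<int p} \<and> y \<in> {0..<int p} \<and>
                       res_zero p (weier_eq W (of_int x) (of_int y))}"

definition res_singular :: "nat \<Rightarrow> rat weierstrass \<Rightarrow> (int \<times> int) set" where
  "res_singular p W = {(x, y) \<in> res_points p W.
                         res_zero p (weier_eq_dx W (of_int x) (of_int y)) \<and>
                         res_zero p (weier_eq_dy W (of_int x) (of_int y))}"

text \<open>At a singular point $(x_0, y_0)$ of the reduced curve the tangent cone is
  $Y^2 + a_1 X Y - (3 x_0 + a_2) X^2$, so the tangent slopes are the roots of
  $T^2 + a_1 T - (3 x_0 + a_2)$.  The point is a node iff these are distinct, and the reduction
  is split iff they moreover lie in $\mathbb{F}_p$.\<close>

definition multiplicative_reduction :: "nat \<Rightarrow> rat weierstrass \<Rightarrow> bool" where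
  "multiplicative_reduction p E \<longleftrightarrow>
     (let W = minimal_model p E in
      \<exists>(x, y) \<in> res_singular p W. \<not> res_zero p (wa1 W ^ 2 + 4 * (3 * of_int x + wa2 W)))"

definition split_multiplicative_reduction :: "nat \<Rightarrow> rat weierstrass \<Rightarrow> bool" where
  "split_multiplicative_reduction p E \<longleftrightarrow>
     (let W = minimal_model p E in
      \<exists>(x, y) \<in> res_singular p W. \<not> res_zero p (wa1 W ^ 2 + 4 * (3 * of_int x + wa2 W)) \<and>
        (\<exists>t::int. res_zero p (of_int t ^ 2 + wa1 W * of_int t - (3 * of_int x + wa2 W))))"


section \<open>The L-series\<close>

definition frob_trace :: "nat \<Rightarrow> rat weierstrass \<Rightarrow> int" where
  "frob_trace p E =
     (if good_reduction p E then int p + 1 - int (card (res_points p (minimal_model p E)) + 1)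
      else if split_multiplicative_reduction p E then 1
      else if multiplicative_reduction p E then - 1
      else 0)"

text \<open>The polynomial $L_p(T)$ with $L(E,s) = \prod_p L_p(p^{-s})^{-1}$.\<close>

definition euler_factor :: "nat \<Rightarrow> rat weierstrass \<Rightarrow> complex fps" where
  "euler_factor p E =
     1 - fps_const (of_int (frob_trace p E)) * fps_X
       + (if good_reduction p E then fps_const (of_nat p) * fps_X ^ 2 else 0)"

text \<open>The coefficient of $n^{-s}$ after multiplying out the Euler product, each factor
  $L_p(p^{-s})^{-1}$ being expanded as a power series in $p^{-s}$.\<close>

definition L_coeff :: "rat weierstrass \<Rightarrow> nat \<Rightarrow> complex" where
  "L_coeff E n = (\<Prod>p\<in>prime_factors n. fps_nth (inverse (euler_factor p E)) (multiplicity p n))"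


section \<open>Torsion points and ramification groups\<close>

text \<open>The affine points of a curve over $\mathbb{C}$, together with the point \<open>None\<close> at infinity.\<close>

type_synonym cpoint = "(complex \<times> complex) option"

definition cpoints :: "complex weierstrass \<Rightarrow> cpoint set" where
  "cpoints W = insert None (Some ` {(x, y). weier_eq W x y = 0})"

fun point_add :: "complex weierstrass \<Rightarrow> cpoint \<Rightarrow> cpoint \<Rightarrow> cpoint" where
  "point_add W None Q = Q"
| "point_add W (Some P) None = Some P"
| "point_add W (Some (x1, y1)) (Some (x2, y2)) =
     (if x1 = x2 \<and> y1 + y2 + wa1 W * x2 + wa3 W = 0 then None
      else let m = (if x1 = x2
                    then (3 * x1^2 + 2 * wa2 W * x1 + wa4 W - wa1 W * y1)
                           / (2 * y1 + wa1 W * x1 + wa3 W)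
                    else (y2 - y1) / (x2 - x1));
               x3 = m^2 + wa1 W * m - wa2 W - x1 - x2
           in Some (x3, - (m + wa1 W) * x3 - (y1 - m * x1) - wa3 W))"

definition torsion_points :: "nat \<Rightarrow> rat weierstrass \<Rightarrow> cpoint set" where
  "torsion_points l E =
     (let W = map_weierstrass of_rat E in {P \<in> cpoints W. (point_add W P ^^ l) None = None})"

definition complex_subfield :: "complex set \<Rightarrow> bool" where
  "complex_subfield K \<longleftrightarrow> 1 \<in> K \<and>
     (\<forall>x\<in>K. \<forall>y\<in>K. x - y \<in> K \<and> x * y \<in> K) \<and> (\<forall>x\<in>K. inverse x \<in> K)"

text \<open>The field $\mathbb{Q}(E[l])$.\<close>

definition torsion_field :: "nat \<Rightarrow> rat weierstrass \<Rightarrow> complex set" where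
  "torsion_field l E =
     \<Inter> {K. complex_subfield K \<and> (\<forall>x y. Some (x, y) \<in> torsion_points l E \<longrightarrow> x \<in> K \<and> y \<in> K)}"

text \<open>Automorphisms are taken extensional so that each is represented by exactly one function;
  they fix $\mathbb{Q}$ automatically.\<close>

definition field_auts :: "complex set \<Rightarrow> (complex \<Rightarrow> complex) set" where
  "field_auts K = {\<sigma> \<in> extensional K. bij_betw \<sigma> K K \<and>
     (\<forall>x\<in>K. \<forall>y\<in>K. \<sigma> (x + y) = \<sigma> x + \<sigma> y \<and> \<sigma> (x * y) = \<sigma> x * \<sigma> y)}"

definition integer_ring :: "complex set \<Rightarrow> complex ring" where
  "integer_ring K = \<lparr>carrier = {x \<in> K. algebraic_int x}, mult = (*), one = 1, zero = 0, add = (+)\<rparr>"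

text \<open>A prime of \<open>K\<close> above \<open>p\<close>; for Galois \<open>K\<close> any two choices are conjugate.\<close>

definition prime_above :: "nat \<Rightarrow> complex set \<Rightarrow> complex set" where
  "prime_above p K = (SOME P. primeideal P (integer_ring K) \<and> of_nat p \<in> P)"

text \<open>The ramification group $G_i$ (lower numbering) of $K/\mathbb{Q}$ at the chosen prime
  $\mathfrak{P}$ above \<open>p\<close>, i.e. the automorphisms acting trivially on
  $\mathcal{O}_K/\mathfrak{P}^{i+1}$.  It is canonically the $i$-th ramification group of the
  completion $K_{\mathfrak{P}}/\mathbb{Q}_p$.\<close>

definition ramification_group :: "nat \<Rightarrow> complex set \<Rightarrow> nat \<Rightarrow> (complex \<Rightarrow> complex) set" where
  "ramification_group p K i =
     (let R = integer_ring K in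
      {\<sigma> \<in> field_auts K. \<forall>x \<in> carrier R.
         \<sigma> x - x \<in> (ideal_prod R (prime_above p K) ^^ Suc i) (carrier R)})"

definition fixed_torsion ::
    "nat \<Rightarrow> rat weierstrass \<Rightarrow> (complex \<Rightarrow> complex) set \<Rightarrow> cpoint set" where
  "fixed_torsion l E G =
     {P \<in> torsion_points l E. \<forall>\<sigma>\<in>G. map_option (map_prod \<sigma> \<sigma>) P = P}"


section \<open>The conductor\<close>

text \<open>The wild part of the conductor exponent,
  $\delta_p = \sum_{i \ge 1} \frac{|G_i|}{|G_0|} \dim_{\mathbb{F}_l} (E[l] / E[l]^{G_i})$, where
  $G_i$ are the ramification groups of $\mathbb{Q}(E[l])/\mathbb{Q}$ at \<open>p\<close> and $l \neq p$ is
  a prime.  The value does not depend on $l$; we take the least one.  The dimension is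
  the base-$l$ logarithm of the cardinality of the quotient.\<close>

definition wild_exponent :: "nat \<Rightarrow> rat weierstrass \<Rightarrow> real" where
  "wild_exponent p E =
     (let l = (if p = 2 then 3 else 2);
          G = ramification_group p (torsion_field l E)
      in \<Sum>\<^sub>\<infinity>i\<in>{1..}. real (card (G i)) / real (card (G 0)) *
           log (real l) (real (card (torsion_points l E)) / real (card (fixed_torsion l E (G i)))))"

text \<open>The floor only converts the type: \<open>wild_exponent p E\<close> is a non-negative integer.\<close>

definition conductor_exponent :: "nat \<Rightarrow> rat weierstrass \<Rightarrow> nat" where
  "conductor_exponent p E =
     (if good_reduction p E then 0
      else if multiplicative_reduction p E then 1
      else 2 + nat \<lfloor>wild_exponent p E\<rfloor>)"

definition conductor :: "rat weierstrass \<Rightarrow> nat" where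
  "conductor E = (\<Prod>p | prime p \<and> \<not> good_reduction p E. p ^ conductor_exponent p E)"


section \<open>Modular forms\<close>

definition upper_half_plane :: "complex set" where
  "upper_half_plane = {\<tau>. Im \<tau> > 0}"

definition nome :: "complex \<Rightarrow> complex" where
  "nome \<tau> = exp (2 * of_real pi * \<i> * \<tau>)"

definition dedekind_eta :: "complex \<Rightarrow> complex" where
  "dedekind_eta \<tau> = exp (2 * of_real pi * \<i> * \<tau> / 24) * (\<Prod>n. 1 - nome \<tau> ^ Suc n)"

text \<open>The weight-$k$ action of the matrix with rows $(a, b)$ and $(c, d)$.\<close>

definition slash :: "nat \<Rightarrow> (complex \<Rightarrow> complex) \<Rightarrow> int \<Rightarrow> int \<Rightarrow> int \<Rightarrow> int \<Rightarrow> complex \<Rightarrow> complex" where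
  "slash k f a b c d \<tau> =
     f ((of_int a * \<tau> + of_int b) / (of_int c * \<tau> + of_int d)) / (of_int c * \<tau> + of_int d) ^ k"

text \<open>The space $S_k(\Gamma_0(N))$.  Every cusp is the image of $\infty$ under some element of
  $SL_2(\mathbb{Z})$, so the last condition is vanishing at all cusps.  Values outside the
  upper half plane are irrelevant.\<close>

definition cusp_forms :: "nat \<Rightarrow> nat \<Rightarrow> (complex \<Rightarrow> complex) set" where
  "cusp_forms k N = {f. f holomorphic_on upper_half_plane \<and>
     (\<forall>a b c d. a * d - b * c = 1 \<and> int N dvd c \<longrightarrow>
        (\<forall>\<tau>\<in>upper_half_plane. slash k f a b c d \<tau> = f \<tau>)) \<and>
     (\<forall>a b c d. a * d - b * c = 1 \<longrightarrow>
        (slash k f a b c d \<longlongrightarrow> 0) (filtercomap Im at_top))}"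

end

theory Submission
  imports Defs "HOL-Library.Periodic_Fun" "HOL-Number_Theory.Cong"
begin

text \<open>Write $A = \eta(\tau)^2\eta(35\tau)^2$ and $B = \eta(5\tau)^2\eta(7\tau)^2$. Since the curve has
  multiplicative reduction at 5 and 7, $f$ is an eigenform of $U_5$ and $U_7$ with eigenvalues
  $\pm 1$; as there are no cusp forms of weight 2 and level 5 or 7, the trace to these levels
  vanishes, so that $f$ is an eigenform of all Atkin-Lehner involutions, while these fix or swap $A$
  and $B$ up to sign. All four cusps being conjugate, a quotient of homogeneous polynomials of the
  same even degree in $f, A, B$, symmetric in $A, B$ and even in $f$, is constant as soon as it is
  bounded at infinity. With $X = f^2 - A^2 - B^2 - cAB$ and a suitable $c$, this applies to
  $(X^2 - 4a_2^2AB(A^2 + B^2))/(AB)^2$. Comparing the first coefficients, where $a_1, \dots, a_6$ are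
  determined by $a_2, a_3, a_5$ and these are small integers, leaves only $a_2 = 0$, $a_3 = 1$ and
  $X = 0$, that is, $f^2 = (A + B)^2$.

  The behaviour of $\eta^2$ under $\tau \mapsto -1/\tau$ is read off from the theta product
  $\prod (1 - q^n w)(1 - q^{n+1}/w)$: its transform has the same zeros and quasi-periods, so by
  Liouville's theorem the quotient is a constant $K$; the behaviour at 0 expresses $K$ by $\eta$, and
  the three points of order two show that $K^3$ is elementary.\<close>

section \<open>The q-Pochhammer symbol\<close>

text \<open>Modularity enters as the hypotheses that \<open>f\<close> is a cusp form and that its
  q-expansion is the L-series. The shape of the quotient is dictated by orders at infinity. There AB
  = q^4 + ..., but X = 2 a_2 q^3 + ..., so X/(AB) has a simple pole unless a_2 = 0. Its square has a
  double pole, and so has (A^2 + B^2)/(AB) = A/B + B/A. The factor 4 a_2^2 makes the leading terms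
  cancel. Changing c shifts X/(AB) by a constant, which changes the simple pole of its square, and c
  is chosen to remove what is left of it. Symmetry in A and B is forced by the involutions that
  exchange them, evenness in f by the unknown signs of a_5 and a_7. The quotient being a constant k,
  the coefficients of q^8, q^9 and q^10 yield two integer equations once k is eliminated. They are
  solved by enumeration: a_p is p minus the number of affine points over F_p, hence lies between p -
  p^2 and p. In the end f = A + B rather than -(A + B) because a_1 = 1.\<close>

definition qpoch :: "complex \<Rightarrow> complex \<Rightarrow> complex" where
  "qpoch x q = (\<Prod>n. 1 - x * q ^ n)"

lemma convergent_qpoch:
  fixes x q :: complex
  assumes "norm q < 1"
  shows "convergent_prod (\<lambda>n. 1 - x * q ^ n)"
proof -
  have "summable (\<lambda>n. norm x * norm q ^ n)"
    using assms by (intro summable_mult summable_geometric) auto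
  then have "summable (\<lambda>n. norm (1 - x * q ^ n - 1))"
    by (simp add: norm_mult norm_power)
  then have "abs_convergent_prod (\<lambda>n. 1 - x * q ^ n)"
    by (simp only: abs_convergent_prod_conv_summable)
  then show ?thesis by (rule abs_convergent_prod_imp_convergent_prod)
qed

lemma qpoch_LIMSEQ:
  assumes "norm q < 1"
  shows "(\<lambda>n. \<Prod>i<n. 1 - x * q ^ i) \<longlonglongrightarrow> qpoch x q"
proof -
  have "(\<lambda>n. \<Prod>i\<le>n. 1 - x * q ^ i) \<longlonglongrightarrow> qpoch x q"
    unfolding qpoch_def by (rule convergent_prod_LIMSEQ[OF convergent_qpoch[OF assms]])
  then show ?thesis by (subst (asm) LIMSEQ_lessThan_iff_atMost[symmetric])
qed

lemma qpoch_rec: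
  assumes "norm q < 1"
  shows "qpoch x q = (1 - x) * qpoch (x * q) q"
proof (rule LIMSEQ_unique)
  show "(\<lambda>n. \<Prod>i<Suc n. 1 - x * q ^ i) \<longlonglongrightarrow> qpoch x q"
    using qpoch_LIMSEQ[OF assms] LIMSEQ_Suc by blast
  have "(\<lambda>n. (1 - x) * (\<Prod>i<n. 1 - (x * q) * q ^ i)) \<longlonglongrightarrow> (1 - x) * qpoch (x * q) q"
    by (intro tendsto_intros qpoch_LIMSEQ assms)
  then show "(\<lambda>n. \<Prod>i<Suc n. 1 - x * q ^ i) \<longlonglongrightarrow> (1 - x) * qpoch (x * q) q"
    by (simp add: prod.lessThan_Suc_shift mult_ac del: prod.lessThan_Suc)
qed

lemma qpoch_eq_0_iff:
  assumes "norm q < 1"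
  shows "qpoch x q = 0 \<longleftrightarrow> (\<exists>n. x * q ^ n = 1)"
  using has_prod_eq_0_iff[OF convergent_prod_has_prod[OF convergent_qpoch[OF assms]], of x]
  unfolding qpoch_def by auto

lemma qpoch_0_left [simp]: "qpoch 0 q = 1"
  by (simp add: qpoch_def)

lemma qpoch_self_nonzero:
  assumes "norm q < 1"
  shows "qpoch q q \<noteq> 0"
proof -
  have "q * q ^ n \<noteq> 1" for n
  proof
    assume "q * q ^ n = 1"
    then have "norm q ^ Suc n = 1" by (metis norm_one norm_power power_Suc)
    moreover have "norm q ^ Suc n < 1"
      using assms power_Suc_less_one[of "norm q" n] by (cases "q = 0") auto
    ultimately show False by simp
  qed
  then show ?thesis using qpoch_eq_0_iff[OF assms] by blast
qed

text \<open>On a closed ball compactness gives a common bound r < 1 for the norm of \<open>g\<close>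
  and a bound C for that of \<open>f\<close>, so the series of C r^n dominates. Both arguments vary
  with z so that the lemma covers theta products as functions of z as well as eta as a function of
  \<tau>.\<close>

lemma holomorphic_on_qpoch:
  assumes f: "f holomorphic_on A" and g: "g holomorphic_on A" and A: "open A"
    and less: "\<And>z. z \<in> A \<Longrightarrow> norm (g z) < 1"
  shows "(\<lambda>z. qpoch (f z) (g z)) holomorphic_on A"
proof (rule holomorphic_uniform_sequence[OF A])
  show "(\<lambda>z. \<Prod>i<n. 1 - f z * g z ^ i) holomorphic_on A" for n
    by (intro holomorphic_intros f g)
next
  fix z assume z: "z \<in> A"
  then obtain d where d: "d > 0" "cball z d \<subseteq> A"
    using A open_contains_cball by blast
  have "continuous_on (cball z d) f" "continuous_on (cball z d) g"
    using f g d(2) holomorphic_on_imp_continuous_on holomorphic_on_subset by blast+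
  note cont = this
  have "\<exists>C. \<forall>w\<in>cball z d. norm (f w) \<le> C"
    using compact_imp_bounded[OF compact_continuous_image[OF cont(1) compact_cball]]
    by (auto simp: bounded_iff)
  then obtain C where C: "\<And>w. w \<in> cball z d \<Longrightarrow> norm (f w) \<le> C" by blast
  have "\<exists>w\<in>cball z d. \<forall>v\<in>cball z d. norm (g v) \<le> norm (g w)"
    using d(1) by (intro continuous_attains_sup continuous_on_norm cont) auto
  then obtain r where r: "r < 1" "\<And>w. w \<in> cball z d \<Longrightarrow> norm (g w) \<le> r"
    using less d(2) by (meson subset_iff)
  have r0: "r \<ge> 0" using r(2)[of z] d(1) norm_ge_zero order_trans
    by (metis centre_in_cball less_imp_le)
  have C0: "C \<ge> 0" using C[of z] d(1) norm_ge_zero order_trans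
    by (metis centre_in_cball less_imp_le)
  have "uniformly_convergent_on (cball z d) (\<lambda>N w. \<Prod>i<N. 1 - f w * g w ^ i)"
  proof (rule uniformly_convergent_on_prod')
    show "continuous_on (cball z d) (\<lambda>w. 1 - f w * g w ^ n)" for n
      by (intro continuous_intros cont)
    show "compact (cball z d)" by simp
    show "uniformly_convergent_on (cball z d)
            (\<lambda>N w. \<Sum>n<N. norm (1 - f w * g w ^ n - 1))"
    proof (rule Weierstrass_m_test'[where M = "\<lambda>n. C * r ^ n"])
      show "norm (norm (1 - f w * g w ^ n - 1)) \<le> C * r ^ n" if "w \<in> cball z d" for n w
        using C[OF that] r(2)[OF that] r0 C0
        by (simp add: norm_mult norm_power mult_mono power_mono)
      show "summable (\<lambda>n. C * r ^ n)"
        using r(1) r0 by (intro summable_mult summable_geometric) auto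
    qed
  qed
  then obtain L where L: "uniform_limit (cball z d) (\<lambda>N w. \<Prod>i<N. 1 - f w * g w ^ i) L sequentially"
    by (auto simp: uniformly_convergent_on_def)
  have "L w = qpoch (f w) (g w)" if "w \<in> cball z d" for w
    using tendsto_uniform_limitI[OF L that] qpoch_LIMSEQ[of "g w" "f w"] less[of w] that d(2)
    by (meson LIMSEQ_unique subset_iff)
  then have "uniform_limit (cball z d) (\<lambda>N w. \<Prod>i<N. 1 - f w * g w ^ i)
      (\<lambda>w. qpoch (f w) (g w)) sequentially"
    using uniform_limit_cong'[of "cball z d"] L by (metis (no_types, lifting))
  then show "\<exists>d>0. cball z d \<subseteq> A \<and> uniform_limit (cball z d)
      (\<lambda>N w. \<Prod>i<N. 1 - f w * g w ^ i) (\<lambda>w. qpoch (f w) (g w)) sequentially"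
    using d by blast
qed

lemma qpoch_plus_minus:
  assumes "norm q < 1" and "r\<^sup>2 = q"
  shows "qpoch r q * qpoch (- r) q = qpoch q (q\<^sup>2)"
proof (rule LIMSEQ_unique)
  have q2: "norm (q\<^sup>2) < 1" using assms(1) by (simp add: norm_power power_less_one_iff)
  show "(\<lambda>n. \<Prod>i<n. 1 - q * (q\<^sup>2) ^ i) \<longlonglongrightarrow> qpoch q (q\<^sup>2)"
    by (rule qpoch_LIMSEQ[OF q2])
  have "(\<lambda>n. (\<Prod>i<n. 1 - r * q ^ i) * (\<Prod>i<n. 1 - (-r) * q ^ i)) \<longlonglongrightarrow> qpoch r q * qpoch (- r) q"
    by (intro tendsto_intros qpoch_LIMSEQ assms)
  moreover have "(1 - r * q ^ i) * (1 - (-r) * q ^ i) = 1 - q * (q\<^sup>2) ^ i" for i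
    using assms(2) by (auto simp: algebra_simps power2_eq_square power_mult_distrib)
  ultimately show "(\<lambda>n. \<Prod>i<n. 1 - q * (q\<^sup>2) ^ i) \<longlonglongrightarrow> qpoch r q * qpoch (- r) q"
    by (simp add: prod.distrib[symmetric])
qed

lemma prod_lessThan_double:
  fixes f :: "nat \<Rightarrow> 'a::comm_monoid_mult"
  shows "(\<Prod>i<2*n. f i) = (\<Prod>i<n. f (2*i)) * (\<Prod>i<n. f (2*i+1))"
  by (induction n) (simp_all add: mult_ac)

lemma qpoch_even_odd:
  assumes "norm q < 1"
  shows "qpoch x q = qpoch x (q\<^sup>2) * qpoch (x * q) (q\<^sup>2)"
proof (rule LIMSEQ_unique)
  have q2: "norm (q\<^sup>2) < 1" using assms(1) by (simp add: norm_power power_less_one_iff)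
  show "(\<lambda>n. \<Prod>i<2*n. 1 - x * q ^ i) \<longlonglongrightarrow> qpoch x q"
    using LIMSEQ_subseq_LIMSEQ[OF qpoch_LIMSEQ[OF assms], of "\<lambda>n. 2*n" x]
    by (simp add: strict_mono_def o_def)
  have "(\<lambda>n. (\<Prod>i<n. 1 - x * (q\<^sup>2) ^ i) * (\<Prod>i<n. 1 - (x * q) * (q\<^sup>2) ^ i))
      \<longlonglongrightarrow> qpoch x (q\<^sup>2) * qpoch (x * q) (q\<^sup>2)"
    by (intro tendsto_intros qpoch_LIMSEQ q2)
  then show "(\<lambda>n. \<Prod>i<2*n. 1 - x * q ^ i) \<longlonglongrightarrow> qpoch x (q\<^sup>2) * qpoch (x * q) (q\<^sup>2)"
    by (simp add: prod_lessThan_double power_mult mult.assoc)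
qed

text \<open>Euler's identity: the product of all (1 + q^n)(1 - q^(2n-1)) is 1, with the odd factors
  split further over the two square roots of q. Up to powers of q and constants the three symbols
  are Weber's functions, the theta values at the points of order two.\<close>

lemma qpoch_triple:
  assumes q: "norm q < 1" and r: "r\<^sup>2 = q"
  shows "qpoch (- q) q * qpoch r q * qpoch (- r) q = 1"
proof -
  have q2: "norm (q\<^sup>2) < 1" using q by (simp add: norm_power power_less_one_iff)
  have "qpoch q q * qpoch (- q) q = qpoch (q\<^sup>2) (q\<^sup>2)"
  proof (rule LIMSEQ_unique)
    show "(\<lambda>n. \<Prod>i<n. 1 - q\<^sup>2 * (q\<^sup>2) ^ i) \<longlonglongrightarrow> qpoch (q\<^sup>2) (q\<^sup>2)"
      by (rule qpoch_LIMSEQ[OF q2])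
    have "(\<lambda>n. (\<Prod>i<n. 1 - q * q ^ i) * (\<Prod>i<n. 1 - (-q) * q ^ i)) \<longlonglongrightarrow> qpoch q q * qpoch (- q) q"
      by (intro tendsto_intros qpoch_LIMSEQ q)
    moreover have "(1 - q * q ^ i) * (1 - (-q) * q ^ i) = 1 - q\<^sup>2 * (q\<^sup>2) ^ i" for i
      by (simp add: algebra_simps power2_eq_square power_mult_distrib)
    ultimately show "(\<lambda>n. \<Prod>i<n. 1 - q\<^sup>2 * (q\<^sup>2) ^ i) \<longlonglongrightarrow> qpoch q q * qpoch (- q) q"
      by (simp add: prod.distrib[symmetric])
  qed
  moreover have "qpoch q q = qpoch q (q\<^sup>2) * qpoch (q\<^sup>2) (q\<^sup>2)"
    using qpoch_even_odd[OF q, of q] by (simp add: power2_eq_square)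
  ultimately have "qpoch (q\<^sup>2) (q\<^sup>2) * (qpoch q (q\<^sup>2) * qpoch (- q) q) = qpoch (q\<^sup>2) (q\<^sup>2)"
    by (simp add: mult_ac)
  then have "qpoch q (q\<^sup>2) * qpoch (- q) q = 1"
    using qpoch_self_nonzero[OF q2] by (metis mult_cancel_left2)
  then show ?thesis using qpoch_plus_minus[OF q r] by (metis mult.assoc mult.commute)
qed

section \<open>Jacobi theta products\<close>

text \<open>Jacobi's triple product without the factor (q;q), which depends on q alone and affects
  neither zeros nor quasi-periods in w.\<close>

definition jtheta :: "complex \<Rightarrow> complex \<Rightarrow> complex" where
  "jtheta w q = qpoch w q * qpoch (q / w) q"

lemma jtheta_shift:
  assumes "norm q < 1" "q \<noteq> 0" "w \<noteq> 0"
  shows "jtheta (w * q) q = - jtheta w q / w"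
proof -
  have "jtheta w q = (1 - w) * qpoch (w * q) q * qpoch (q / w) q"
    using qpoch_rec[OF assms(1), of w] by (simp add: jtheta_def)
  moreover have "jtheta (w * q) q = qpoch (w * q) q * ((1 - 1 / w) * qpoch (q / w) q)"
    using qpoch_rec[OF assms(1), of "1 / w"] assms(2) by (simp add: jtheta_def)
  ultimately show ?thesis
    using assms(3) by (simp add: divide_simps) (simp add: algebra_simps)
qed

lemma jtheta_eq_0_iff:
  assumes "norm q < 1" "q \<noteq> 0" "w \<noteq> 0"
  shows "jtheta w q = 0 \<longleftrightarrow> (\<exists>n::int. w = q powi n)"
proof
  assume "jtheta w q = 0"
  then consider n where "w * q ^ n = 1" | n where "q / w * q ^ n = 1"
    unfolding jtheta_def using qpoch_eq_0_iff[OF assms(1)] by auto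
  then show "\<exists>n::int. w = q powi n"
  proof cases
    case 1
    then have "w = q powi (- int n)"
      using assms by (simp add: power_int_minus field_simps)
    then show ?thesis by blast
  next
    case 2
    then have "w = q powi (int (Suc n))"
      using assms by (simp add: field_simps del: of_nat_Suc)
    then show ?thesis by blast
  qed
next
  assume "\<exists>n::int. w = q powi n"
  then obtain n :: int where n: "w = q powi n" by blast
  show "jtheta w q = 0"
  proof (cases "n \<le> 0")
    case True
    then have "w * q ^ nat (- n) = 1"
      using n assms by (simp add: power_int_def field_simps)
    then show ?thesis using qpoch_eq_0_iff[OF assms(1)] by (auto simp: jtheta_def)
  next
    case False
    then obtain m where m: "n = int (Suc m)"
      by (metis not_le zero_less_imp_eq_int gr0_conv_Suc)
    have "q / w * q ^ m = 1"
      using n m assms by (simp add: field_simps del: of_nat_Suc)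
    then show ?thesis using qpoch_eq_0_iff[OF assms(1)] by (auto simp: jtheta_def)
  qed
qed

section \<open>The nome as an exponential map\<close>

lemma nome_add: "nome (x + y) = nome x * nome y"
  by (simp add: nome_def algebra_simps exp_add)

lemma nome_minus: "nome (- x) = inverse (nome x)"
  by (simp add: nome_def exp_minus)

lemma nome_diff: "nome (x - y) = nome x / nome y"
  by (simp add: nome_def algebra_simps exp_diff)

lemma nome_nonzero [simp]: "nome x \<noteq> 0"
  by (simp add: nome_def)

lemma nome_0 [simp]: "nome 0 = 1"
  by (simp add: nome_def)

lemma norm_nome: "norm (nome x) = exp (- 2 * pi * Im x)"
  by (simp add: nome_def)

lemma norm_nome_less_1: "Im x > 0 \<Longrightarrow> norm (nome x) < 1"
  by (simp add: norm_nome)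

lemma nome_of_nat_mult: "nome (of_nat n * x) = nome x ^ n"
  by (simp add: nome_def flip: exp_of_nat_mult) (simp add: algebra_simps)

lemma nome_of_int_mult: "nome (of_int n * x) = nome x powi n"
  by (cases n rule: int_cases2)
    (simp_all add: nome_of_nat_mult nome_minus power_int_minus)

lemma nome_eq_1_iff: "nome x = 1 \<longleftrightarrow> (\<exists>n::int. x = of_int n)"
proof -
  have "nome x = 1 \<longleftrightarrow> Re (2 * of_real pi * \<i> * x) = 0 \<and>
      (\<exists>n::int. Im (2 * of_real pi * \<i> * x) = of_int (2 * n) * pi)"
    unfolding nome_def by (rule exp_eq_1)
  also have "\<dots> \<longleftrightarrow> (\<exists>n::int. x = of_int n)"
    by (auto simp: complex_eq_iff)
  finally show ?thesis .
qed

lemma nome_of_int [simp]: "nome (of_int n) = 1"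
  using nome_eq_1_iff by blast

lemma nome_1 [simp]: "nome 1 = 1"
  using nome_of_int[of 1] by simp

lemma nome_eq_iff: "nome x = nome y \<longleftrightarrow> (\<exists>n::int. x = y + of_int n)"
proof -
  have "nome x = nome y \<longleftrightarrow> nome (x - y) = 1" by (simp add: nome_diff)
  also have "\<dots> \<longleftrightarrow> (\<exists>n::int. x = y + of_int n)"
    by (auto simp: nome_eq_1_iff algebra_simps)
  finally show ?thesis .
qed

lemma nome_half: "nome (1/2) = -1"
  by (simp add: nome_def)

lemma holomorphic_on_nome [holomorphic_intros]:
  "f holomorphic_on A \<Longrightarrow> (\<lambda>z. nome (f z)) holomorphic_on A"
  unfolding nome_def by (intro holomorphic_intros)

lemma holomorphic_jtheta_nome:
  assumes "norm q < 1"
  shows "(\<lambda>z. jtheta (nome z) q) holomorphic_on UNIV"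
  unfolding jtheta_def
  by (intro holomorphic_on_mult holomorphic_on_qpoch holomorphic_intros) (use assms in auto)

text \<open>The factor 1 - w carries the simple zero at w = 1, so the derivative is that of this
  factor times the cofactor (q;q)^2. Through this value eta enters the comparison of the two theta
  products.\<close>

lemma has_field_derivative_jtheta_nome_0:
  assumes "norm q < 1"
  shows "((\<lambda>z. jtheta (nome z) q) has_field_derivative (- 2 * of_real pi * \<i> * (qpoch q q)\<^sup>2)) (at 0)"
proof -
  define g where "g = (\<lambda>z. qpoch (nome z * q) q * qpoch (q / nome z) q)"
  have "g holomorphic_on UNIV"
    unfolding g_def
    by (intro holomorphic_on_mult holomorphic_on_qpoch holomorphic_intros) (use assms in auto)
  then obtain g' where g': "(g has_field_derivative g') (at 0)"
    using holomorphic_derivI[of g UNIV 0] by blast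
  have "((\<lambda>z. (1 - nome z) * g z) has_field_derivative (- 2 * of_real pi * \<i> * (qpoch q q)\<^sup>2)) (at 0)"
    unfolding nome_def
    by (rule derivative_eq_intros refl g' | simp)+ (simp add: g_def power2_eq_square)
  moreover have "(1 - nome z) * g z = jtheta (nome z) q" for z
    using qpoch_rec[OF assms, of "nome z"] by (simp add: g_def jtheta_def)
  ultimately show ?thesis by simp
qed

section \<open>The inversion formula for the eta function\<close>

context
  fixes \<tau> :: complex
  assumes \<tau>: "Im \<tau> > 0"
begin

private lemma nz: "\<tau> \<noteq> 0" using \<tau> by auto

private lemma Im_inv: "Im (- 1 / \<tau>) > 0"
proof -
  have "Im (- 1 / \<tau>) = Im \<tau> / (norm \<tau>)\<^sup>2"
    by (simp add: Im_divide cmod_power2)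
  then show ?thesis using \<tau> nz by simp
qed

private definition "q = nome \<tau>"
private definition "q' = nome (- 1 / \<tau>)"
private definition "f1 z = jtheta (nome z) q"
private definition "f2 z = jtheta (nome (z / \<tau>)) q'"
text \<open>\<open>f1\<close> has period 1 and picks up a factor under \<tau>, while
  \<open>f2\<close> has period \<tau> and picks up a factor under 1. The quadratic exponent
  exchanges the two roles, so that \<open>F2\<close> has the quasi-periods of
  \<open>f1\<close>.\<close>

private definition "Q z = - (of_real pi * \<i> / \<tau>) * z\<^sup>2 + (of_real pi * \<i> - of_real pi * \<i> / \<tau>) * z"
private definition "F2 z = exp (Q z) * f2 z"
private definition "R z = F2 z / f1 z"
text \<open>The ratio of the derivatives of \<open>F2\<close> and \<open>f1\<close> at 0; an
  exponential factor apart it is the eta quotient to be determined.\<close>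

private definition "K = (qpoch q' q')\<^sup>2 / (\<tau> * (qpoch q q)\<^sup>2)"

private lemma nq: "norm q < 1" "norm q' < 1" "q \<noteq> 0" "q' \<noteq> 0"
  using norm_nome_less_1[OF \<tau>] norm_nome_less_1[OF Im_inv] by (simp_all add: q_def q'_def)

private lemma f1_1: "f1 (z + 1) = f1 z"
  by (simp add: f1_def nome_add)

private lemma f1_tau: "f1 (z + \<tau>) = - f1 z / nome z"
  using jtheta_shift[OF nq(1) nq(3), of "nome z"] by (simp add: f1_def nome_add q_def)

private lemma F2_tau: "F2 (z + \<tau>) = - F2 z / nome z"
proof -
  have "f2 (z + \<tau>) = f2 z"
    using nz by (simp add: f2_def add_divide_distrib nome_add)
  moreover have "Q (z + \<tau>) = Q z - (2 * of_real pi * \<i> * z + of_real pi * \<i>)"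
    using nz by (simp add: Q_def field_simps power2_eq_square)
  then have "exp (Q (z + \<tau>)) = - exp (Q z) / nome z"
    by (simp add: exp_diff exp_add nome_def)
  ultimately show ?thesis by (simp add: F2_def)
qed

private lemma F2_1: "F2 (z + 1) = F2 z"
proof -
  have "nome (z / \<tau>) = nome ((z + 1) / \<tau>) * q'"
    unfolding q'_def nome_add[symmetric] using nz by (simp add: field_simps)
  then have "f2 z = - f2 (z + 1) / nome ((z + 1) / \<tau>)"
    using jtheta_shift[OF nq(2) nq(4), of "nome ((z + 1) / \<tau>)"] by (simp add: f2_def)
  then have 1: "f2 (z + 1) = - f2 z * nome ((z + 1) / \<tau>)"
    by (simp add: field_simps)
  have "Q (z + 1) = Q z + (of_real pi * \<i> - 2 * of_real pi * \<i> * ((z + 1) / \<tau>))"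
    using nz by (simp add: Q_def field_simps power2_eq_square)
  then have "exp (Q (z + 1)) = - exp (Q z) / nome ((z + 1) / \<tau>)"
    by (simp only: exp_diff exp_add nome_def) simp
  with 1 show ?thesis by (simp add: F2_def)
qed

private lemma f1_zero: "f1 z = 0 \<longleftrightarrow> (\<exists>m n::int. z = of_int m + of_int n * \<tau>)"
proof -
  have "f1 z = 0 \<longleftrightarrow> (\<exists>n::int. nome z = nome (of_int n * \<tau>))"
    unfolding f1_def using jtheta_eq_0_iff[OF nq(1) nq(3)] by (simp add: q_def nome_of_int_mult)
  also have "\<dots> \<longleftrightarrow> (\<exists>m n::int. z = of_int m + of_int n * \<tau>)"
    unfolding nome_eq_iff by (metis add.commute)
  finally show ?thesis .
qed

private lemma hol: "f1 holomorphic_on UNIV" "F2 holomorphic_on UNIV"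
proof -
  show "f1 holomorphic_on UNIV"
    using holomorphic_jtheta_nome[OF nq(1)] unfolding f1_def .
  have "(\<lambda>z. jtheta (nome z) q') \<circ> (\<lambda>z. z / \<tau>) holomorphic_on UNIV"
    using holomorphic_jtheta_nome[OF nq(2)] nz
    by (intro holomorphic_on_compose holomorphic_intros) (auto intro: holomorphic_on_subset)
  then have "f2 holomorphic_on UNIV" by (simp add: f2_def[abs_def] o_def)
  then show "F2 holomorphic_on UNIV"
    unfolding F2_def[abs_def] Q_def by (intro holomorphic_intros) (use nz in auto)
qed

private lemma R_lattice: "R (z + (of_int m + of_int n * \<tau>)) = R z"
proof -
  interpret p1: periodic_fun_simple' R
    by standard (simp add: R_def f1_1 F2_1)
  interpret p2: periodic_fun_simple R \<tau>
    by standard (simp add: R_def f1_tau F2_tau)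
  show ?thesis
    using p2.plus_of_int[of "z + of_int m" n] p1.plus_of_int[of z m] by (simp add: add_ac)
qed

private lemma R_tendsto_0: "R \<midarrow>0\<rightarrow> K"
proof -
  have d1: "(f1 has_field_derivative (- 2 * of_real pi * \<i> * (qpoch q q)\<^sup>2)) (at 0)"
    using has_field_derivative_jtheta_nome_0[OF nq(1)] unfolding f1_def .
  have "(((\<lambda>z. jtheta (nome z) q') \<circ> (\<lambda>z. z / \<tau>)) has_field_derivative
      (- 2 * of_real pi * \<i> * (qpoch q' q')\<^sup>2) * (1 / \<tau>)) (at 0)"
    by (rule DERIV_chain) (use has_field_derivative_jtheta_nome_0[OF nq(2)] in
        \<open>auto intro!: derivative_eq_intros simp: nz\<close>)
  then have d2: "(f2 has_field_derivative (- 2 * of_real pi * \<i> * (qpoch q' q')\<^sup>2) * (1 / \<tau>)) (at 0)"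
    by (simp add: f2_def[abs_def] o_def)
  have dQ: "((\<lambda>z. exp (Q z)) has_field_derivative (of_real pi * \<i> - of_real pi * \<i> / \<tau>)) (at 0)"
    unfolding Q_def by (rule derivative_eq_intros refl | simp)+
  have f2_0: "f2 0 = 0" "f1 0 = 0"
    using jtheta_eq_0_iff[OF nq(2) nq(4), of 1] jtheta_eq_0_iff[OF nq(1) nq(3), of 1]
    by (auto simp: f2_def f1_def intro!: exI[of _ 0])
  have "((\<lambda>z. exp (Q z) * f2 z) has_field_derivative
      (of_real pi * \<i> - of_real pi * \<i> / \<tau>) * f2 0
      + (- 2 * of_real pi * \<i> * (qpoch q' q')\<^sup>2) * (1 / \<tau>) * exp (Q 0)) (at 0)"
    by (rule DERIV_mult[OF dQ d2])
  then have d3: "(F2 has_field_derivative (- 2 * of_real pi * \<i> * (qpoch q' q')\<^sup>2) * (1 / \<tau>)) (at 0)"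
    using f2_0 by (simp add: F2_def[abs_def] Q_def)
  have "(\<lambda>z. F2 z / f1 z) \<midarrow>0\<rightarrow> ((- 2 * of_real pi * \<i> * (qpoch q' q')\<^sup>2) * (1 / \<tau>))
      / (- 2 * of_real pi * \<i> * (qpoch q q)\<^sup>2)"
    by (rule lhopital_complex_simple[OF d3 d1])
      (use f2_0 qpoch_self_nonzero[OF nq(1)] in \<open>auto simp: F2_def\<close>)
  moreover have "((- 2 * of_real pi * \<i> * (qpoch q' q')\<^sup>2) * (1 / \<tau>))
      / (- 2 * of_real pi * \<i> * (qpoch q q)\<^sup>2) = K"
    unfolding K_def using nz qpoch_self_nonzero[OF nq(1)] by (simp add: field_simps)
  ultimately show ?thesis by (simp add: R_def[abs_def])
qed

private lemma R_eq_K: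
  assumes "f1 z \<noteq> 0"
  shows "F2 z = K * f1 z"
proof -
  define RR where "RR = remove_sings R"
  have per: "RR (z + (of_int m + of_int n * \<tau>)) = RR z" for z m n
  proof -
    have "R ((z + (of_int m + of_int n * \<tau>)) + w) = R (z + w)" for w
      using R_lattice[of "z + w" m n] by (simp only: ac_simps)
    then show ?thesis
      unfolding RR_def
      using remove_sings_shift_0[of R "z + (of_int m + of_int n * \<tau>)"] remove_sings_shift_0[of R z]
      by simp
  qed
  have an: "RR analytic_on {z}" for z
  proof (cases "f1 z = 0")
    case False
    have "R analytic_on {z}"
      unfolding R_def[abs_def] using False
      by (intro analytic_on_divide holomorphic_on_imp_analytic_at[OF hol(1)]
          holomorphic_on_imp_analytic_at[OF hol(2)]) auto
    then show ?thesis unfolding RR_def by (rule remove_sings_analytic_on)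
  next
    case True
    \<comment> \<open>The limit at 0, carried over by periodicity, makes the singularity at any
      lattice point removable.\<close>
    then obtain m n :: int where mn: "z = of_int m + of_int n * \<tau>" by (auto simp: f1_zero)
    have "(\<lambda>h. R (z + h)) \<midarrow>0\<rightarrow> K"
      using R_tendsto_0 R_lattice[of _ m n] by (simp add: mn add.commute)
    then have "R \<midarrow>z\<rightarrow> K" by (rule LIM_offset_zero_cancel)
    moreover have "R meromorphic_on {z}"
      unfolding R_def[abs_def]
      by (intro meromorphic_on_divide analytic_on_imp_meromorphic_on
          holomorphic_on_imp_analytic_at[OF hol(1)] holomorphic_on_imp_analytic_at[OF hol(2)]) auto
    then have "isolated_singularity_at R z"
      by (meson meromorphic_on_isolated_singularity singletonI)
    ultimately show ?thesis unfolding RR_def by (intro remove_sings_analytic_at)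
  qed
  have holRR: "RR holomorphic_on UNIV"
    using an by (metis analytic_imp_holomorphic analytic_on_analytic_at)
  \<comment> \<open>The closed period parallelogram: by periodicity \<open>RR\<close> takes all its
    values on this compact set.\<close>
  define D where "D = (\<lambda>(x::real, y::real). of_real x + of_real y * \<tau>) ` ({0..1} \<times> {0..1})"
  have "compact D"
    unfolding D_def case_prod_beta
    by (intro compact_continuous_image continuous_intros compact_Times compact_Icc)
  then have "bounded (RR ` D)"
    by (intro compact_imp_bounded compact_continuous_image
        holomorphic_on_imp_continuous_on[OF holomorphic_on_subset[OF holRR]]) auto
  moreover have "RR w \<in> RR ` D" for w
  proof -
    define y where "y = Im w / Im \<tau>"
    define x where "x = Re w - y * Re \<tau>"
    have w: "w = of_real x + of_real y * \<tau>"
      using \<tau> by (simp add: complex_eq_iff x_def y_def)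
    have "RR w = RR (of_real (frac x) + of_real (frac y) * \<tau>)"
      using per[of "of_real (frac x) + of_real (frac y) * \<tau>" "\<lfloor>x\<rfloor>" "\<lfloor>y\<rfloor>"] w
      by (simp add: frac_def algebra_simps)
    moreover have "of_real (frac x) + of_real (frac y) * \<tau> \<in> D"
      unfolding D_def using frac_ge_0 frac_lt_1 by (force intro: less_imp_le)
    ultimately show ?thesis by blast
  qed
  ultimately have "bounded (range RR)" by (metis (no_types, lifting) bounded_subset image_subsetI)
  then obtain c where c: "\<And>w. RR w = c"
    using Liouville_theorem[OF holRR] by (auto simp: constant_on_def)
  have "RR 0 = K" unfolding RR_def using R_tendsto_0 by (rule remove_sings_eqI)
  moreover have "R analytic_on {z}"
      unfolding R_def[abs_def] using assms
      by (intro analytic_on_divide holomorphic_on_imp_analytic_at[OF hol(1)]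
          holomorphic_on_imp_analytic_at[OF hol(2)]) auto
  then have "RR z = R z" unfolding RR_def by simp
  ultimately have "R z = K" using c by metis
  then show ?thesis using assms by (simp add: R_def field_simps)
qed

private lemma jtheta_minus_1: "norm p < 1 \<Longrightarrow> jtheta (- 1) p = 2 * (qpoch (- p) p)\<^sup>2"
  using qpoch_rec[of p "-1"] by (simp add: jtheta_def power2_eq_square)

private lemma jtheta_sqrt: "r\<^sup>2 = p \<Longrightarrow> r \<noteq> 0 \<Longrightarrow> jtheta r p = (qpoch r p)\<^sup>2"
  by (auto simp: jtheta_def power2_eq_square)

private lemma jtheta_inverse_sqrt:
  assumes "r\<^sup>2 = p" "r \<noteq> 0" "norm p < 1"
  shows "jtheta (1 / r) p = - (qpoch r p)\<^sup>2 / r"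
proof -
  have "jtheta (1 / r * p) p = - jtheta (1 / r) p / (1 / r)"
    by (rule jtheta_shift) (use assms in auto)
  moreover have "1 / r * p = r" using assms by (auto simp: power2_eq_square)
  ultimately show ?thesis using assms jtheta_sqrt[OF assms(1,2)] by (simp add: field_simps)
qed

text \<open>At each of the half periods 1/2, \<tau>/2 and (1 + \<tau>)/2 the relation between
  \<open>F2\<close> and \<open>f1\<close> involves a theta constant that is not elementary, but the
  product of the three is, by \<open>qpoch_triple\<close> for q and for q'. Multiplying three
  relations costs the third power of \<open>K\<close>.\<close>

private lemma K_cubed: "K ^ 3 = \<i> * exp (of_real pi * \<i> / 2 * (\<tau> + 1 / \<tau>))"
proof -
  define s s' where "s = nome (\<tau> / 2)" and "s' = nome (- 1 / (2 * \<tau>))"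
  have s: "s\<^sup>2 = q" "s \<noteq> 0" "s'\<^sup>2 = q'" "s' \<noteq> 0"
    using nz by (simp_all add: s_def s'_def q_def q'_def power2_eq_square flip: nome_add)
  have "f1 (1/2) = 2 * (qpoch (- q) q)\<^sup>2"
    unfolding f1_def nome_half using jtheta_minus_1[OF nq(1)] .
  moreover have "f1 (\<tau>/2) = (qpoch s q)\<^sup>2"
    unfolding f1_def s_def[symmetric] by (rule jtheta_sqrt) (use s in auto)
  moreover have "f1 (1/2 + \<tau>/2) = (qpoch (- s) q)\<^sup>2"
    unfolding f1_def nome_add nome_half s_def[symmetric] using jtheta_sqrt[of "- s" q] s by simp
  ultimately have f1: "f1 (1/2) * f1 (\<tau>/2) * f1 (1/2 + \<tau>/2) = 2"
    using qpoch_triple[OF nq(1) s(1)] by (simp add: power_mult_distrib[symmetric] mult.assoc)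
  then have nz3: "f1 (1/2) \<noteq> 0" "f1 (\<tau>/2) \<noteq> 0" "f1 (1/2 + \<tau>/2) \<noteq> 0" by auto
  have inv: "nome (1 / (2 * \<tau>)) = 1 / s'"
    unfolding s'_def using nome_minus[of "1 / (2 * \<tau>)"] by (simp add: field_simps)
  have "f2 (1/2) = - (qpoch s' q')\<^sup>2 / s'"
    using jtheta_inverse_sqrt[OF s(3,4) nq(2)] inv by (simp add: f2_def)
  moreover have "f2 (\<tau>/2) = 2 * (qpoch (- q') q')\<^sup>2"
    using jtheta_minus_1[OF nq(2)] nome_half nz by (simp add: f2_def)
  moreover have "f2 (1/2 + \<tau>/2) = (qpoch (- s') q')\<^sup>2 / s'"
  proof -
    have "nome ((1/2 + \<tau>/2) / \<tau>) = 1 / (- s')"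
    proof -
      have "(1/2 + \<tau>/2) / \<tau> = 1/2 + 1 / (2 * \<tau>)" using nz by (simp add: field_simps)
      then show ?thesis by (simp only: nome_add nome_half inv) simp
    qed
    then show ?thesis
      using jtheta_inverse_sqrt[of "- s'" q'] s nq by (simp add: f2_def)
  qed
  ultimately have "f2 (1/2) * f2 (\<tau>/2) * f2 (1/2 + \<tau>/2)
      = - 2 * (qpoch (- q') q' * qpoch s' q' * qpoch (- s') q')\<^sup>2 / s'\<^sup>2"
    by (simp add: power_mult_distrib power2_eq_square mult_ac)
  then have f2: "f2 (1/2) * f2 (\<tau>/2) * f2 (1/2 + \<tau>/2) = - 2 / q'"
    using qpoch_triple[OF nq(2) s(3)] s by simp
  have "F2 (1/2) * F2 (\<tau>/2) * F2 (1/2 + \<tau>/2) = K ^ 3 * (f1 (1/2) * f1 (\<tau>/2) * f1 (1/2 + \<tau>/2))"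
    using R_eq_K[OF nz3(1)] R_eq_K[OF nz3(2)] R_eq_K[OF nz3(3)] by (simp add: power3_eq_cube mult_ac)
  then have "2 * K ^ 3 = exp (Q (1/2) + Q (\<tau>/2) + Q (1/2 + \<tau>/2)) * (f2 (1/2) * f2 (\<tau>/2) * f2 (1/2 + \<tau>/2))"
    unfolding f1 by (simp add: F2_def exp_add mult_ac)
  also have "\<dots> = - 2 * exp (Q (1/2) + Q (\<tau>/2) + Q (1/2 + \<tau>/2)) / q'"
    by (simp add: f2)
  also have "\<dots> = - 2 * exp (Q (1/2) + Q (\<tau>/2) + Q (1/2 + \<tau>/2) + 2 * of_real pi * \<i> / \<tau>)"
    by (simp add: q'_def nome_def exp_add exp_minus field_simps)
  also have "Q (1/2) + Q (\<tau>/2) + Q (1/2 + \<tau>/2) + 2 * of_real pi * \<i> / \<tau>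
      = of_real pi * \<i> / 2 * (\<tau> + 1 / \<tau>) - of_real pi / 2 * \<i>"
    using nz by (simp add: Q_def field_simps power2_eq_square)
  also have "- 2 * exp (of_real pi * \<i> / 2 * (\<tau> + 1 / \<tau>) - of_real pi / 2 * \<i>)
      = 2 * (\<i> * exp (of_real pi * \<i> / 2 * (\<tau> + 1 / \<tau>)))"
  proof -
    have "exp (of_real pi / 2 * \<i>) = \<i>"
      using cis_conv_exp[of "pi / 2"] by (simp add: mult.commute)
    then show ?thesis by (simp add: exp_diff)
  qed
  finally show ?thesis by simp
qed

lemma dedekind_eta_inversion_cubed:
  "(dedekind_eta (- 1 / \<tau>) ^ 2 / (\<tau> * dedekind_eta \<tau> ^ 2)) ^ 3 = \<i>"
proof -
  have eta: "dedekind_eta z ^ 2 = exp (2 * of_real pi * \<i> * z / 12) * (qpoch (nome z) (nome z))\<^sup>2" for z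
    by (simp add: dedekind_eta_def qpoch_def power_mult_distrib flip: exp_of_nat_mult)
  have "dedekind_eta (- 1 / \<tau>) ^ 2 / (\<tau> * dedekind_eta \<tau> ^ 2)
      = exp (2 * of_real pi * \<i> * (- 1 / \<tau>) / 12 - 2 * of_real pi * \<i> * \<tau> / 12) * K"
    unfolding eta K_def q_def q'_def exp_diff by (simp add: field_simps)
  also have "\<dots> ^ 3 = exp (3 * (2 * of_real pi * \<i> * (- 1 / \<tau>) / 12 - 2 * of_real pi * \<i> * \<tau> / 12)) *
      (\<i> * exp (of_real pi * \<i> / 2 * (\<tau> + 1 / \<tau>)))"
    by (simp add: power_mult_distrib K_cubed flip: exp_of_nat_mult)
  also have "\<dots> = \<i> * exp (3 * (2 * of_real pi * \<i> * (- 1 / \<tau>) / 12 - 2 * of_real pi * \<i> * \<tau> / 12)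
      + of_real pi * \<i> / 2 * (\<tau> + 1 / \<tau>))"
    by (simp add: exp_add)
  also have "3 * (2 * of_real pi * \<i> * (- 1 / \<tau>) / 12 - 2 * of_real pi * \<i> * \<tau> / 12)
      + of_real pi * \<i> / 2 * (\<tau> + 1 / \<tau>) = 0"
    using nz by (simp add: field_simps)
  finally show ?thesis by simp
qed

end

lemma dedekind_eta_eq: "dedekind_eta \<tau> = exp (2 * of_real pi * \<i> * \<tau> / 24) * qpoch (nome \<tau>) (nome \<tau>)"
  by (simp add: dedekind_eta_def qpoch_def)

lemma dedekind_eta_nonzero: "Im \<tau> > 0 \<Longrightarrow> dedekind_eta \<tau> \<noteq> 0"
  by (simp add: dedekind_eta_eq qpoch_self_nonzero norm_nome_less_1)

lemma open_upper_half_plane: "open upper_half_plane"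
  by (simp add: upper_half_plane_def open_halfspace_Im_gt)

lemma connected_upper_half_plane: "connected upper_half_plane"
  by (simp add: upper_half_plane_def convex_connected convex_halfspace_Im_gt)

lemma holomorphic_dedekind_eta:
  assumes "f holomorphic_on A" "open A" "\<And>z. z \<in> A \<Longrightarrow> Im (f z) > 0"
  shows "(\<lambda>z. dedekind_eta (f z)) holomorphic_on A"
  unfolding dedekind_eta_eq
  by (intro holomorphic_on_mult holomorphic_on_qpoch holomorphic_intros assms norm_nome_less_1) auto

lemma Im_neg_inverse_pos: "Im \<tau> > 0 \<Longrightarrow> Im (- 1 / \<tau>) > 0"
  by (auto simp: Im_divide intro!: divide_pos_pos sum_power2_gt_zero_iff[THEN iffD2])

text \<open>The cube leaves a third root of unity open. A continuous function on a connected set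
  with values among the three cube roots of \<i> is constant, and at the fixed point \<i> of the
  inversion its value is 1/\<i>.\<close>

lemma dedekind_eta_sq_inversion:
  assumes "Im \<tau> > 0"
  shows "dedekind_eta (- 1 / \<tau>) ^ 2 = - \<i> * \<tau> * dedekind_eta \<tau> ^ 2"
proof -
  define h where "h = (\<lambda>\<tau>. dedekind_eta (- 1 / \<tau>) ^ 2 / (\<tau> * dedekind_eta \<tau> ^ 2))"
  have "h holomorphic_on upper_half_plane"
    unfolding h_def
    by (intro holomorphic_intros holomorphic_dedekind_eta open_upper_half_plane)
      (use Im_neg_inverse_pos dedekind_eta_nonzero in \<open>force simp: upper_half_plane_def\<close>)+
  then have "continuous_on upper_half_plane h" by (rule holomorphic_on_imp_continuous_on)
  moreover have "h ` upper_half_plane \<subseteq> {z. z ^ 3 = \<i>}"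
    using dedekind_eta_inversion_cubed by (auto simp: h_def upper_half_plane_def)
  then have "finite (h ` upper_half_plane)"
    by (rule finite_subset) (use finite_nth_roots[of 3 \<i>] in auto)
  ultimately have "h constant_on upper_half_plane"
    using continuous_finite_range_constant[OF connected_upper_half_plane] by blast
  then have "h \<tau> = h \<i>"
    using assms by (auto simp: constant_on_def upper_half_plane_def)
  also have "\<dots> = - \<i>" using dedekind_eta_nonzero[of \<i>] by (simp add: h_def)
  finally have "h \<tau> * (\<tau> * dedekind_eta \<tau> ^ 2) = - \<i> * (\<tau> * dedekind_eta \<tau> ^ 2)" by simp
  moreover have "\<tau> * dedekind_eta \<tau> ^ 2 \<noteq> 0" using assms dedekind_eta_nonzero[OF assms] by auto
  ultimately show ?thesis by (simp add: h_def mult.assoc)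
qed

section \<open>The square of the eta function under the modular group\<close>

text \<open>The steps are right multiplication by T and S. Powers of T reduce d modulo c, then S
  moves the remainder into the lower left corner: the Euclidean algorithm, terminating in |c|. T is
  an equivalence because quotients of either sign occur.\<close>

lemma SL2Z_induct:
  fixes P :: "int \<Rightarrow> int \<Rightarrow> int \<Rightarrow> int \<Rightarrow> bool"
  assumes det: "a * d - b * c = 1"
    and id: "P 1 0 0 1"
    and T: "\<And>a b c d. a * d - b * c = 1 \<Longrightarrow> P a (a + b) c (c + d) \<longleftrightarrow> P a b c d"
    and S: "\<And>a b c d. a * d - b * c = 1 \<Longrightarrow> P b (- a) d (- c) \<Longrightarrow> P a b c d"
  shows "P a b c d"
proof -
  have Tpow: "P a (b + a * int n) c (d + c * int n) \<longleftrightarrow> P a b c d" if "a * d - b * c = 1" for a b c d n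
    using that
  proof (induction n)
    case (Suc n)
    then show ?case
      using T[of a "d + c * int n" "b + a * int n" c] by (simp add: algebra_simps)
  qed simp
  have Tint: "P a (b + a * k) c (d + c * k) \<longleftrightarrow> P a b c d" if "a * d - b * c = 1" for a b c d k
  proof (cases "k \<ge> 0")
    case True
    then show ?thesis using Tpow[OF that, of "nat k"] by simp
  next
    case False
    then show ?thesis
      using Tpow[of a "d + c * k" "b + a * k" c "nat (- k)"] that by (simp add: algebra_simps)
  qed
  show ?thesis using det
  proof (induction "nat \<bar>c\<bar>" arbitrary: a b c d rule: less_induct)
    case less
    show ?case
    proof (cases "c = 0")
      case False
      define k where "k = - (d div c)"
      define d' b' where "d' = d + c * k" and "b' = b + a * k"
      have d': "d' = d mod c" by (simp add: d'_def k_def minus_div_mult_eq_mod algebra_simps)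
      have det': "a * d' - b' * c = 1"
        using less.prems by (simp add: d'_def b'_def algebra_simps)
      have "\<bar>d'\<bar> < \<bar>c\<bar>" unfolding d' using False abs_mod_less by blast
      then have "P b' (- a) d' (- c)"
        using det' by (intro less.hyps) (simp_all add: algebra_simps)
      then have "P a b' c d'" using S[OF det'] by blast
      then show ?thesis using Tint[OF less.prems, of k] by (simp add: b'_def d'_def)
    next
      case True
      then have "a * d = 1" using less.prems by simp
      then have ad: "a = 1 \<and> d = 1 \<or> a = - 1 \<and> d = - 1"
        using zmult_eq_1_iff by blast
      \<comment> \<open>The matrix -1 is the square of S, so two steps lead back to the
        identity.\<close>
      have m1: "P (- 1) 0 0 (- 1)"
      proof (rule S)
        show "P 0 (- (- 1)) (- 1) (- 0)"
        proof (rule S)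
          show "P (- (- 1)) (- 0) (- 0) (- (- 1))" using id by simp
        qed simp
      qed simp
      show ?thesis
        using ad
      proof
        assume "a = 1 \<and> d = 1"
        then show ?thesis using True Tint[of 1 1 0 0 b] id by simp
      next
        assume "a = - 1 \<and> d = - 1"
        then show ?thesis using True Tint[of "-1" "-1" 0 0 "-b"] m1 by simp
      qed
    qed
  qed
qed

text \<open>The exponent of the multiplier system of $\eta^2$, i.e. Petersson's formula for the multiplier
  of $\eta$ with the Jacobi symbol squared away.\<close>

definition eta_exponent :: "int \<Rightarrow> int \<Rightarrow> int \<Rightarrow> int \<Rightarrow> int" where
  "eta_exponent a b c d = (a + d) * c - b * d * (c\<^sup>2 - 1)
     + (if even c then 3 * d - 3 - 3 * c * d else - 3 * c)"

lemma twelve_dvdI: "3 dvd x \<Longrightarrow> 4 dvd x \<Longrightarrow> 12 dvd (x::int)"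
  by presburger

lemma three_dvd_cube_diff: "3 dvd ((c::int)\<^sup>2 - 1) * c"
proof -
  have "3 dvd c \<or> 3 dvd c - 1 \<or> 3 dvd c + 1" by presburger
  moreover have "(c\<^sup>2 - 1) * c = (c - 1) * (c + 1) * c" by (simp add: algebra_simps power2_eq_square)
  ultimately show ?thesis by (metis dvd_mult dvd_mult2)
qed

text \<open>Right multiplication by T must add 1, as the square of eta gains the twelfth root of
  unity \<open>nome (1/12)\<close> under \<tau> + 1. Modulo 3 the difference is a multiple of c^3 -
  c; modulo 4 the parity of c decides.\<close>

lemma eta_exponent_T:
  assumes "a * d - b * c = 1"
  shows "12 dvd eta_exponent a (a + b) c (c + d) - eta_exponent a b c d - 1"
proof -
  let ?E = "eta_exponent a (a + b) c (c + d) - eta_exponent a b c d - 1"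
  have ad: "a * d = 1 + b * c" using assms by simp
  have "?E = c\<^sup>2 - (a * c + a * d + b * c) * (c\<^sup>2 - 1) - 1
      + (if even c then 3 * c - 3 * c\<^sup>2 else 0)"
    by (auto simp: eta_exponent_def algebra_simps power2_eq_square)
  also have "\<dots> = - ((c\<^sup>2 - 1) * c) * (a + 2 * b) + (if even c then 3 * c - 3 * c\<^sup>2 else 0)"
    unfolding ad by (simp add: algebra_simps power2_eq_square)
  finally have E: "?E = - ((c\<^sup>2 - 1) * c) * (a + 2 * b) + (if even c then 3 * c - 3 * c\<^sup>2 else 0)" .
  show ?thesis
  proof (rule twelve_dvdI)
    show "3 dvd ?E" unfolding E
      using three_dvd_cube_diff[of c] by (intro dvd_add dvd_mult2) (auto intro: dvd_diff)
    show "4 dvd ?E"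
    proof (cases "even c")
      case True
      then obtain e where e: "c = 2 * e" by blast
      from True assms have "odd a" by (metis dvd_diff even_mult_iff odd_one)
      then obtain f where f: "a = 2 * f + 1" by (blast elim: oddE)
      have "?E = 4 * (- (4 * e\<^sup>2 - 1) * e * (f + b) - 2 * e ^ 3 + 2 * e - 3 * e\<^sup>2)"
        unfolding E using True by (simp add: e f algebra_simps power2_eq_square power3_eq_cube)
      then show ?thesis by simp
    next
      case False
      then obtain e where e: "c = 2 * e + 1" by (blast elim: oddE)
      have "?E = 4 * (- (e\<^sup>2 + e) * c * (a + 2 * b))"
        unfolding E using False by (simp add: e algebra_simps power2_eq_square)
      then show ?thesis by simp
    qed
  qed
qed

text \<open>The inversion formula contributes -\<i>\<tau>, and the automorphy factor at -1/\<tau>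
  becomes -(c\<tau> + d)/\<tau>. Together this is \<i>(c\<tau> + d), and \<i> is
  \<open>nome (3/12)\<close>.\<close>

lemma eta_exponent_S:
  assumes "a * d - b * c = 1"
  shows "12 dvd eta_exponent b (- a) d (- c) - eta_exponent a b c d + 3"
proof -
  let ?E = "eta_exponent b (- a) d (- c) - eta_exponent a b c d + 3"
  have "?E = - 2 * c * d - c * d * (a * d - b * c)
      + (if even d then - 3 * c - 3 + 3 * c * d else - 3 * d)
      - (if even c then 3 * d - 3 - 3 * c * d else - 3 * c) + 3"
    unfolding eta_exponent_def by (simp only: algebra_simps power2_eq_square mult_minus_left mult_minus_right minus_minus) simp
  then have E: "?E = - 3 * c * d + (if even d then - 3 * c - 3 + 3 * c * d else - 3 * d)
      - (if even c then 3 * d - 3 - 3 * c * d else - 3 * c) + 3"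
    unfolding assms by simp
  have "odd c \<or> odd d" using assms by (metis dvd_diff even_mult_iff odd_one)
  then consider "odd c" "odd d" | "odd c" "even d" | "even c" "odd d" by blast
  then show ?thesis
  proof cases
    case 1
    then obtain e f where "c = 2 * e + 1" "d = 2 * f + 1" by (blast elim: oddE)
    then have "?E = 12 * (- (e + 1) * f)" unfolding E by (simp add: algebra_simps)
    then show ?thesis by simp
  next
    case 2
    then show ?thesis unfolding E by simp
  next
    case 3
    then obtain f where "d = 2 * f + 1" by (blast elim: oddE)
    then have "?E = 12 * (- f)" unfolding E using 3 by (simp add: algebra_simps)
    then show ?thesis by simp
  qed
qed

lemma denom_nonzero:
  fixes c d :: int
  assumes "Im \<tau> > 0" "c \<noteq> 0 \<or> d \<noteq> 0"
  shows "of_int c * \<tau> + of_int d \<noteq> 0"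
  using assms by (auto simp: complex_eq_iff)

lemma Im_moebius:
  fixes a b c d :: int
  shows "Im ((of_int a * \<tau> + of_int b) / (of_int c * \<tau> + of_int d))
       = of_int (a * d - b * c) * Im \<tau> / (norm (of_int c * \<tau> + of_int d))\<^sup>2"
  by (simp add: Im_divide cmod_power2 algebra_simps)

lemma Im_moebius_pos:
  fixes a b c d :: int
  assumes "Im \<tau> > 0" "a * d - b * c > 0"
  shows "Im ((of_int a * \<tau> + of_int b) / (of_int c * \<tau> + of_int d)) > 0"
proof -
  have "of_int c * \<tau> + of_int d \<noteq> 0"
    using assms by (intro denom_nonzero) auto
  moreover have "of_int (a * d - b * c) * Im \<tau> > 0"
    using assms by (metis mult_pos_pos of_int_0_less_iff)
  ultimately show ?thesis unfolding Im_moebius by simp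
qed

lemma nome_12_cong:
  assumes "12 dvd m - n"
  shows "nome (of_int m / 12) = nome (of_int n / 12)"
proof -
  obtain k where "m - n = 12 * k" using assms by blast
  then have "m = n + 12 * k" by simp
  then have "of_int m / 12 = (of_int n / 12 :: complex) + of_int k" by simp
  then show ?thesis unfolding nome_eq_iff by blast
qed

lemma dedekind_eta_sq_plus1: "dedekind_eta (\<tau> + 1) ^ 2 = nome (1/12) * dedekind_eta \<tau> ^ 2"
proof -
  have "nome (\<tau> + 1) = nome \<tau>" by (simp add: nome_add)
  moreover have "exp (2 * of_real pi * \<i> * (\<tau> + 1) / 24) ^ 2
      = nome (1/12) * exp (2 * of_real pi * \<i> * \<tau> / 24) ^ 2"
    by (simp add: nome_def flip: exp_of_nat_mult exp_add) (simp add: algebra_simps add_divide_distrib)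
  ultimately show ?thesis by (simp add: dedekind_eta_eq power_mult_distrib mult_ac)
qed

theorem dedekind_eta_sq_SL2Z:
  fixes a b c d :: int
  assumes det: "a * d - b * c = 1" and "Im \<tau> > 0"
  shows "dedekind_eta ((of_int a * \<tau> + of_int b) / (of_int c * \<tau> + of_int d)) ^ 2
       = nome (of_int (eta_exponent a b c d) / 12) * (of_int c * \<tau> + of_int d) * dedekind_eta \<tau> ^ 2"
proof -
  define P where "P = (\<lambda>a b c d. \<forall>\<tau>. Im \<tau> > 0 \<longrightarrow>
      dedekind_eta ((of_int a * \<tau> + of_int b) / (of_int c * \<tau> + of_int d)) ^ 2
       = nome (of_int (eta_exponent a b c d) / 12) * (of_int c * \<tau> + of_int d) * dedekind_eta \<tau> ^ 2)"
  have "P a b c d"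
  proof (rule SL2Z_induct[where P = P, OF det])
    show "P 1 0 0 1" by (simp add: P_def eta_exponent_def)
  next
    fix a b c d :: int
    assume det: "a * d - b * c = 1"
    have "12 dvd eta_exponent a (a + b) c (c + d) - (eta_exponent a b c d + 1)"
      using eta_exponent_T[OF det] by (simp add: algebra_simps)
    then have e: "nome (of_int (eta_exponent a (a + b) c (c + d)) / 12)
        = nome (of_int (eta_exponent a b c d) / 12) * nome (1/12)"
      by (subst nome_12_cong) (auto simp: add_divide_distrib nome_add)
    show "P a (a + b) c (c + d) \<longleftrightarrow> P a b c d"
    proof
      assume *: "P a (a + b) c (c + d)"
      show "P a b c d" unfolding P_def
      proof (intro allI impI)
        fix \<tau> :: complex assume "Im \<tau> > 0"
        then have "dedekind_eta ((of_int a * (\<tau> - 1) + of_int (a + b)) / (of_int c * (\<tau> - 1) + of_int (c + d))) ^ 2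
          = nome (of_int (eta_exponent a (a + b) c (c + d)) / 12) * (of_int c * (\<tau> - 1) + of_int (c + d))
            * dedekind_eta (\<tau> - 1) ^ 2"
          using * unfolding P_def by simp
        then show "dedekind_eta ((of_int a * \<tau> + of_int b) / (of_int c * \<tau> + of_int d)) ^ 2
         = nome (of_int (eta_exponent a b c d) / 12) * (of_int c * \<tau> + of_int d) * dedekind_eta \<tau> ^ 2"
          using e dedekind_eta_sq_plus1[of "\<tau> - 1"] by (simp add: algebra_simps)
      qed
    next
      assume *: "P a b c d"
      show "P a (a + b) c (c + d)" unfolding P_def
      proof (intro allI impI)
        fix \<tau> :: complex assume "Im \<tau> > 0"
        then have "dedekind_eta ((of_int a * (\<tau> + 1) + of_int b) / (of_int c * (\<tau> + 1) + of_int d)) ^ 2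
          = nome (of_int (eta_exponent a b c d) / 12) * (of_int c * (\<tau> + 1) + of_int d)
            * dedekind_eta (\<tau> + 1) ^ 2"
          using * unfolding P_def by simp
        then show "dedekind_eta ((of_int a * \<tau> + of_int (a + b)) / (of_int c * \<tau> + of_int (c + d))) ^ 2
         = nome (of_int (eta_exponent a (a + b) c (c + d)) / 12) * (of_int c * \<tau> + of_int (c + d)) * dedekind_eta \<tau> ^ 2"
          using e dedekind_eta_sq_plus1[of \<tau>] by (simp add: algebra_simps)
      qed
    qed
  next
    fix a b c d :: int
    assume det: "a * d - b * c = 1" and *: "P b (- a) d (- c)"
    have "12 dvd eta_exponent b (- a) d (- c) - (eta_exponent a b c d - 3)"
      using eta_exponent_S[OF det] by (simp add: algebra_simps)
    then have "nome (of_int (eta_exponent b (- a) d (- c)) / 12)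
        = nome (of_int (eta_exponent a b c d) / 12) / nome (1/4)"
      by (subst nome_12_cong) (auto simp: diff_divide_distrib nome_diff)
    moreover have "nome (1/4) = \<i>"
      using cis_conv_exp[of "pi / 2"] by (simp add: nome_def mult_ac)
    ultimately have e: "nome (of_int (eta_exponent a b c d) / 12)
        = \<i> * nome (of_int (eta_exponent b (- a) d (- c)) / 12)" by simp
    show "P a b c d" unfolding P_def
    proof (intro allI impI)
      fix \<tau> :: complex assume \<tau>: "Im \<tau> > 0"
      then have nz: "\<tau> \<noteq> 0" by auto
      have "(of_int b * (- 1 / \<tau>) + of_int (- a)) / (of_int d * (- 1 / \<tau>) + of_int (- c))
          = (- ((of_int a * \<tau> + of_int b) / \<tau>)) / (- ((of_int c * \<tau> + of_int d) / \<tau>))"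
        using nz by (simp add: add_divide_distrib minus_diff_commute)
      also have "\<dots> = (of_int a * \<tau> + of_int b) / (of_int c * \<tau> + of_int d)"
        using nz by (simp only: minus_divide_divide) simp
      finally have "dedekind_eta ((of_int a * \<tau> + of_int b) / (of_int c * \<tau> + of_int d)) ^ 2
          = nome (of_int (eta_exponent b (- a) d (- c)) / 12) * (of_int d * (- 1 / \<tau>) + of_int (- c))
            * dedekind_eta (- 1 / \<tau>) ^ 2"
        using *[unfolded P_def, rule_format, OF Im_neg_inverse_pos[OF \<tau>]] by simp
      also have "\<dots> = nome (of_int (eta_exponent b (- a) d (- c)) / 12) * (of_int d * (- 1 / \<tau>) + of_int (- c))
            * (- \<i> * \<tau> * dedekind_eta \<tau> ^ 2)"
        by (simp only: dedekind_eta_sq_inversion[OF \<tau>])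
      also have "\<dots> = nome (of_int (eta_exponent a b c d) / 12) * (of_int c * \<tau> + of_int d) * dedekind_eta \<tau> ^ 2"
        unfolding e using nz by (simp add: field_simps)
      finally show "dedekind_eta ((of_int a * \<tau> + of_int b) / (of_int c * \<tau> + of_int d)) ^ 2
         = nome (of_int (eta_exponent a b c d) / 12) * (of_int c * \<tau> + of_int d) * dedekind_eta \<tau> ^ 2" .
    qed
  qed
  then show ?thesis using assms(2) unfolding P_def by blast
qed

section \<open>Atkin-Lehner matrices and invariant functions\<close>

definition moebius :: "int \<Rightarrow> int \<Rightarrow> int \<Rightarrow> int \<Rightarrow> complex \<Rightarrow> complex" where
  "moebius a b c d \<tau> = (of_int a * \<tau> + of_int b) / (of_int c * \<tau> + of_int d)"

text \<open>For a positive divisor Q of N the determinant condition, divided by Q, forces Q and N/Q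
  to be coprime. The case Q = 1 is the group of level N itself.\<close>

definition atkin_lehner :: "int \<Rightarrow> int \<Rightarrow> int \<Rightarrow> int \<Rightarrow> int \<Rightarrow> int \<Rightarrow> bool" where
  "atkin_lehner N Q a b c d \<longleftrightarrow> Q dvd a \<and> Q dvd d \<and> N dvd c \<and> a * d - b * c = Q"

lemma moebius_denom_nonzero:
  assumes "Im \<tau> > 0" "a * d - b * c \<noteq> 0"
  shows "of_int c * \<tau> + of_int d \<noteq> 0"
  using assms by (intro denom_nonzero) auto

lemma moebius_in_upper_half_plane:
  "Im \<tau> > 0 \<Longrightarrow> a * d - b * c > 0 \<Longrightarrow> Im (moebius a b c d \<tau>) > 0"
  unfolding moebius_def by (rule Im_moebius_pos)

lemma denom_moebius:
  assumes "of_int c' * \<tau> + of_int d' \<noteq> 0"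
  shows "(of_int c * moebius a' b' c' d' \<tau> + of_int d) * (of_int c' * \<tau> + of_int d')
       = of_int (c * a' + d * c') * \<tau> + of_int (c * b' + d * d')"
  using assms by (simp add: moebius_def field_simps)

lemma moebius_moebius:
  assumes "of_int c' * \<tau> + of_int d' \<noteq> 0"
  shows "moebius a b c d (moebius a' b' c' d' \<tau>)
       = moebius (a * a' + b * c') (a * b' + b * d') (c * a' + d * c') (c * b' + d * d') \<tau>"
proof -
  let ?e = "of_int c' * \<tau> + of_int d'"
  have "moebius a b c d (moebius a' b' c' d' \<tau>)
      = ((of_int a * moebius a' b' c' d' \<tau> + of_int b) * ?e)
        / ((of_int c * moebius a' b' c' d' \<tau> + of_int d) * ?e)"
    using assms by (simp add: moebius_def[of a b c d])
  then show ?thesis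
    unfolding denom_moebius[OF assms] by (simp add: moebius_def[of "a * a' + b * c'"])
qed

lemma slash_eq_moebius: "slash k f a b c d \<tau> = f (moebius a b c d \<tau>) / (of_int c * \<tau> + of_int d) ^ k"
  by (simp add: slash_def moebius_def)

lemma slash_slash:
  assumes "Im \<tau> > 0" "a' * d' - b' * c' \<noteq> 0"
  shows "slash k (slash k f a b c d) a' b' c' d' \<tau>
       = slash k f (a * a' + b * c') (a * b' + b * d') (c * a' + d * c') (c * b' + d * d') \<tau>"
proof -
  have nz: "of_int c' * \<tau> + of_int d' \<noteq> 0" using moebius_denom_nonzero[OF assms] .
  show ?thesis
    unfolding slash_eq_moebius moebius_moebius[OF nz] denom_moebius[OF nz, symmetric] power_mult_distrib
    by simp
qed

lemma slash_scalar:
  assumes "n \<noteq> 0"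
  shows "slash k f (n * a) (n * b) (n * c) (n * d) \<tau> = slash k f a b c d \<tau> / of_int n ^ k"
proof -
  have "of_int (n * c) * \<tau> + of_int (n * d) = of_int n * (of_int c * \<tau> + of_int d)"
    by (simp add: algebra_simps)
  moreover have "moebius (n * a) (n * b) (n * c) (n * d) \<tau> = moebius a b c d \<tau>"
  proof -
    have "moebius (n * a) (n * b) (n * c) (n * d) \<tau>
        = (of_int n * (of_int a * \<tau> + of_int b)) / (of_int n * (of_int c * \<tau> + of_int d))"
      by (simp add: moebius_def algebra_simps)
    then show ?thesis using assms by (simp add: moebius_def)
  qed
  ultimately show ?thesis by (simp add: slash_eq_moebius power_mult_distrib)
qed

text \<open>The matrices for a fixed Q form a single coset of the group of level N, so the action of
  the involution on invariant forms does not depend on the matrix chosen.\<close>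

lemma atkin_lehner_coset:
  assumes V: "atkin_lehner N Q a b c d" and V0: "atkin_lehner N Q a0 b0 c0 d0"
    and "Q dvd N" "Q > 0"
  obtains a' b' c' d' where "a' * d' - b' * c' = 1" "N dvd c'"
    "a = a' * a0 + b' * c0" "b = a' * b0 + b' * d0" "c = c' * a0 + d' * c0" "d = c' * b0 + d' * d0"
proof -
  from V obtain x w z where x: "a = Q * x" "d = Q * w" "c = N * z" unfolding atkin_lehner_def by blast
  from V0 obtain x0 w0 z0 where x0: "a0 = Q * x0" "d0 = Q * w0" "c0 = N * z0"
    unfolding atkin_lehner_def by blast
  obtain M where M: "N = Q * M" using assms(3) by blast
  have "Q * (Q * x * w - b * M * z) = Q * 1"
    using V x M by (simp add: atkin_lehner_def algebra_simps)
  then have d1: "Q * x * w - b * M * z = 1" using assms(4) by simp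
  have "Q * (Q * x0 * w0 - b0 * M * z0) = Q * 1"
    using V0 x0 M by (simp add: atkin_lehner_def algebra_simps)
  then have d2: "Q * x0 * w0 - b0 * M * z0 = 1" using assms(4) by simp
  \<comment> \<open>The entries of the first matrix times the adjugate of the second, divided by
    Q.\<close>
  define a' b' c' d' where "a' = Q * x * w0 - b * M * z0" and "b' = - x * b0 + b * x0"
    and "c' = N * (z * w0 - w * z0)" and "d' = - M * z * b0 + Q * w * x0"
  show ?thesis
  proof
    have "a' * d' - b' * c' = (Q * x * w - b * M * z) * (Q * x0 * w0 - b0 * M * z0)"
      by (simp add: a'_def b'_def c'_def d'_def M algebra_simps)
    then show "a' * d' - b' * c' = 1" using d1 d2 by simp
    show "N dvd c'" by (simp add: c'_def)
    have "a' * a0 + b' * c0 = Q * x * (Q * x0 * w0 - b0 * M * z0)"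
      by (simp add: a'_def b'_def x0 M algebra_simps)
    then show "a = a' * a0 + b' * c0" using d2 x by simp
    have "a' * b0 + b' * d0 = b * (Q * x0 * w0 - b0 * M * z0)"
      by (simp add: a'_def b'_def x0 M algebra_simps)
    then show "b = a' * b0 + b' * d0" using d2 by simp
    have "c' * a0 + d' * c0 = N * z * (Q * x0 * w0 - b0 * M * z0)"
      by (simp add: c'_def d'_def x0 M algebra_simps)
    then show "c = c' * a0 + d' * c0" using d2 x by simp
    have "c' * b0 + d' * d0 = Q * w * (Q * x0 * w0 - b0 * M * z0)"
      by (simp add: c'_def d'_def x0 M algebra_simps)
    then show "d = c' * b0 + d' * d0" using d2 x by simp
  qed
qed

section \<open>Reduction of the upper half plane by Atkin-Lehner matrices\<close>

lemma exists_dvd_diff_mult: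
  fixes c d Q :: int
  assumes "coprime c Q"
  shows "\<exists>j. Q dvd d - c * j"
proof -
  obtain x where "[c * x = 1] (mod Q)"
    using cong_solve_coprime_int[OF assms] by blast
  then have "[c * (x * d) = d] (mod Q)"
    using cong_scalar_right[of "c * x" 1 Q d] by (simp add: mult.assoc)
  then have "Q dvd d - c * (x * d)"
    by (meson cong_iff_dvd_diff cong_sym)
  then show ?thesis by blast
qed

text \<open>An element of SL2(Z) is 1/Q times the matrix found here times the upper triangular
  matrix with rows (1, j) and (0, Q). Hence each cusp is the image of infinity under an Atkin-Lehner
  matrix. As N is squarefree, Q = N / gcd(c, N) is coprime to c, which makes the congruence for j
  solvable.\<close>

lemma SL2Z_atkin_lehner_decomp:
  fixes N :: int
  assumes "N > 0" "squarefree N" and det: "a * d - b * c = 1"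
  obtains Q j where "Q > 0" "Q dvd N" "atkin_lehner N Q (Q * a) (b - a * j) (Q * c) (d - c * j)"
proof -
  define g Q where "g = gcd c N" and "Q = N div g"
  have N: "N = g * Q" by (simp add: g_def Q_def)
  have g: "g > 0" using assms(1) by (simp add: g_def)
  have Q: "Q > 0" using assms(1) N g by (simp add: zero_less_mult_iff)
  have "coprime c Q"
  proof (rule coprimeI)
    fix l assume l: "l dvd c" "l dvd Q"
    then have "l dvd N" using N by simp
    then have "l dvd g" using l by (simp add: g_def)
    then have "l * l dvd N" using l N by (simp add: mult_dvd_mono)
    then have "l\<^sup>2 dvd N" by (simp add: power2_eq_square)
    then show "is_unit l" using assms(2) unfolding squarefree_def by blast
  qed
  then obtain j where j: "Q dvd d - c * j" using exists_dvd_diff_mult by blast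
  have "N dvd Q * c" unfolding N by (simp add: g_def mult.commute[of _ c] mult_dvd_mono)
  moreover have "Q * a * (d - c * j) - (b - a * j) * (Q * c) = Q * (a * d - b * c)"
    by (simp add: algebra_simps)
  ultimately have "atkin_lehner N Q (Q * a) (b - a * j) (Q * c) (d - c * j)"
    using j det by (simp add: atkin_lehner_def)
  moreover have "Q dvd N" using N by simp
  ultimately show ?thesis using that Q by blast
qed

lemma moebius_atkin_lehner_decomp:
  assumes "Q \<noteq> 0"
  shows "moebius (Q * a) (b - a * j) (Q * c) (d - c * j) ((\<tau> + of_int j) / of_int Q) = moebius a b c d \<tau>"
proof -
  have "of_int (Q * x) * ((\<tau> + of_int j) / of_int Q) = of_int x * \<tau> + of_int (x * j)" for x
    using assms by (simp add: field_simps)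
  then show ?thesis unfolding moebius_def by (simp only: of_int_diff) simp
qed

text \<open>Dirichlet approximation supplies a bottom row (k, -h). For y = Im \<tau> < 1 and n about
  1/sqrt y, the square of |k\<tau> - h| is at most 1/n^2 + k^2 y^2, hence at most y + 4y. This is
  the origin of 1/5.\<close>

lemma exists_SL2Z_Im_ge:
  assumes "Im \<tau> > 0"
  obtains a b c d :: int where "a * d - b * c = 1" "Im (moebius a b c d \<tau>) \<ge> 1 / 5"
proof (cases "Im \<tau> \<ge> 1")
  case True
  then show ?thesis by (intro that[of 1 1 0 0]) (auto simp: moebius_def)
next
  case False
  define y where "y = Im \<tau>"
  have y: "0 < y" "y < 1" using assms False by (auto simp: y_def)
  define n where "n = nat \<lceil>1 / sqrt y\<rceil>"
  have s: "0 < sqrt y" "sqrt y < 1" using y by auto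
  have n1: "real n \<ge> 1 / sqrt y" unfolding n_def by linarith
  have "1 / sqrt y > 0" using s by simp
  then have n0: "n > 0" using n1 by (metis gr0I of_nat_0 not_le)
  have "real n < 1 / sqrt y + 1" unfolding n_def using s
    by (metis \<open>0 < 1 / sqrt y\<close> ceiling_correct less_imp_le of_nat_nat zero_le_ceiling
        diff_less_eq less_trans neg_less_0_iff_less zero_less_one)
  also have "\<dots> \<le> 2 / sqrt y"
  proof -
    have "1 \<le> 1 / sqrt y" using s by (simp add: less_imp_le)
    then show ?thesis by (simp add: field_simps)
  qed
  finally have n2: "real n < 2 / sqrt y" .
  obtain h k where hk: "coprime h k" "0 < k" "k \<le> int n" "\<bar>of_int k * Re \<tau> - of_int h\<bar> < 1 / real n"
    using Dirichlet_approx_coprime[OF n0] by blast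
  obtain u v where uv: "u * h + v * k = 1"
    using bezout_int[of h k] hk(1) by auto
  let ?e = "of_int k * \<tau> + of_int (- h)"
  have "(norm ?e)\<^sup>2 = (of_int k * Re \<tau> - of_int h)\<^sup>2 + (of_int k * y)\<^sup>2"
    by (simp add: cmod_power2 y_def)
  also have "(of_int k * Re \<tau> - of_int h)\<^sup>2 \<le> (1 / real n)\<^sup>2"
    using hk(4) by (metis abs_le_square_iff abs_of_nonneg less_imp_le of_nat_0_le_iff zero_le_divide_1_iff)
  also have "(1 / real n)\<^sup>2 \<le> (sqrt y)\<^sup>2"
    using n1 n0 s by (intro power_mono) (auto simp: field_simps)
  also have "(of_int k * y)\<^sup>2 \<le> (2 / sqrt y * y)\<^sup>2"
  proof (intro power_mono mult_right_mono)
    have "real_of_int k \<le> real n" using hk(3) by linarith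
    then show "real_of_int k \<le> 2 / sqrt y" using n2 by linarith
  qed (use y hk(2) in auto)
  also have "(sqrt y)\<^sup>2 + (2 / sqrt y * y)\<^sup>2 = 5 * y"
    using y by (simp add: power_mult_distrib power_divide power2_eq_square)
  finally have le: "(norm ?e)\<^sup>2 \<le> 5 * y" by simp
  have "?e \<noteq> 0" using hk(2) assms by (intro denom_nonzero) auto
  then have "(norm ?e)\<^sup>2 > 0" by simp
  have det: "(- u) * (- h) - v * (- k) = 1" using uv by simp
  have "1 / 5 \<le> y / (norm ?e)\<^sup>2"
    using le \<open>(norm ?e)\<^sup>2 > 0\<close> by (simp add: field_simps)
  also have "\<dots> = Im (moebius (- u) (- v) k (- h) \<tau>)"
    unfolding moebius_def Im_moebius using uv by (simp add: y_def)
  finally show ?thesis using uv by (intro that[of "- u" "- h" "- v" k]) (simp_all add: algebra_simps)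
qed

section \<open>Periodic functions as functions of the nome\<close>

lemma periodic_of_int:
  fixes \<phi> :: "complex \<Rightarrow> 'a"
  assumes "\<And>\<tau>. Im \<tau> > 0 \<Longrightarrow> \<phi> (\<tau> + 1) = \<phi> \<tau>" "Im \<tau> > 0"
  shows "\<phi> (\<tau> + of_int n) = \<phi> \<tau>"
proof -
  have nat: "\<phi> (\<tau> + of_nat n) = \<phi> \<tau>" if "Im \<tau> > 0" for \<tau> n
  proof (induction n)
    case (Suc n)
    then show ?case using assms(1)[of "\<tau> + of_nat n"] that by (simp add: add_ac)
  qed simp
  show ?thesis
  proof (cases n rule: int_cases2)
    case (nonneg m)
    then show ?thesis using nat[of \<tau> m] assms(2) by simp
  next
    case (nonpos m)
    then show ?thesis using nat[of "\<tau> - of_nat m" m] assms(2) by simp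
  qed
qed

lemma nome_surj:
  assumes "q \<noteq> 0" "norm q < 1"
  obtains \<tau> where "Im \<tau> > 0" "nome \<tau> = q"
proof -
  define \<tau> where "\<tau> = Ln q / (2 * of_real pi * \<i>)"
  have n: "nome \<tau> = q" using assms by (simp add: nome_def \<tau>_def)
  have "exp (- 2 * pi * Im \<tau>) < 1"
    using assms(2) norm_nome[of \<tau>] n by simp
  then have "Im \<tau> > 0" by (simp add: zero_less_mult_iff)
  then show ?thesis using that n by blast
qed

text \<open>Local logarithms make the lift holomorphic on the punctured disc, where periodicity
  hides the choice of branch; boundedness high up in the half plane lets Riemann's theorem fill in
  the centre.\<close>

lemma nome_lift:
  assumes hol: "\<phi> holomorphic_on upper_half_plane"
    and per: "\<And>\<tau>. Im \<tau> > 0 \<Longrightarrow> \<phi> (\<tau> + 1) = \<phi> \<tau>"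
    and bdd: "eventually (\<lambda>\<tau>. norm (\<phi> \<tau>) \<le> B) (filtercomap Im at_top)"
  obtains \<Phi> where "\<Phi> holomorphic_on ball 0 1" "\<And>\<tau>. Im \<tau> > 0 \<Longrightarrow> \<phi> \<tau> = \<Phi> (nome \<tau>)"
proof -
  define L where "L = (\<lambda>q. Ln q / (2 * of_real pi * \<i>))"
  define \<Phi>0 where "\<Phi>0 = (\<lambda>q. \<phi> (L q))"
  have nL: "nome (L q) = q" if "q \<noteq> 0" for q
    using that by (simp add: nome_def L_def)
  have ImL: "Im (L q) > 0" if "q \<noteq> 0" "norm q < 1" for q
  proof -
    have "exp (- 2 * pi * Im (L q)) < 1"
      using that norm_nome[of "L q"] nL by simp
    then show ?thesis by (simp add: zero_less_mult_iff)
  qed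
  have eq: "\<phi> \<tau> = \<phi> \<tau>'" if "nome \<tau> = nome \<tau>'" "Im \<tau>' > 0" for \<tau> \<tau>'
  proof -
    from that(1) obtain n :: int where "\<tau> = \<tau>' + of_int n" by (auto simp: nome_eq_iff)
    then show ?thesis using periodic_of_int[where \<phi> = \<phi>, OF per that(2)] by simp
  qed
  have lift: "\<phi> \<tau> = \<Phi>0 (nome \<tau>)" if "Im \<tau> > 0" for \<tau>
    unfolding \<Phi>0_def using that by (intro eq) (auto simp: nL ImL norm_nome_less_1)
  have "\<Phi>0 holomorphic_on ball 0 1 - {0}"
  proof (rule analytic_imp_holomorphic, subst analytic_on_analytic_at, intro ballI)
    fix q0 :: complex assume q0: "q0 \<in> ball 0 1 - {0}"
    \<comment> \<open>A branch of the inverse of \<open>nome\<close> near q0 that avoids the cut of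
      \<open>Ln\<close>; it differs from \<open>L\<close> by integers only.\<close>
    define M where "M = (\<lambda>q. L q0 + Ln (q / q0) / (2 * of_real pi * \<i>))"
    define U where "U = {q. q / q0 \<in> - \<real>\<^sub>\<le>\<^sub>0} \<inter> (ball 0 1)"
    have "open ((\<lambda>q. q / q0) -` (- \<real>\<^sub>\<le>\<^sub>0))"
      by (intro continuous_open_vimage continuous_intros) (use q0 in auto)
    then have U: "open U" unfolding U_def vimage_def by auto
    have holM: "M holomorphic_on U"
      unfolding M_def using q0 by (intro holomorphic_intros) (auto simp: U_def)
    have nM: "nome (M q) = q" if "q \<in> U" for q
    proof -
      have "q \<noteq> 0" using that by (auto simp: U_def)
      then have "nome (Ln (q / q0) / (2 * of_real pi * \<i>)) = q / q0"
        using q0 by (simp add: nome_def)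
      then show ?thesis using q0 nL[of q0] by (simp add: M_def nome_add)
    qed
    have ImM: "Im (M q) > 0" if "q \<in> U" for q
    proof -
      have "exp (- 2 * pi * Im (M q)) < 1"
        using that norm_nome[of "M q"] nM[OF that] by (simp add: U_def)
      then show ?thesis by (simp add: zero_less_mult_iff)
    qed
    have "(\<phi> \<circ> M) holomorphic_on U"
      by (intro holomorphic_on_compose_gen[OF holM hol]) (auto simp: upper_half_plane_def ImM)
    moreover have "(\<phi> \<circ> M) q = \<Phi>0 q" if "q \<in> U" for q
      using lift[OF ImM[OF that]] nM[OF that] by simp
    ultimately have "\<Phi>0 holomorphic_on U" using holomorphic_transform by blast
    moreover have "q0 \<in> U" using q0 by (simp add: U_def)
    ultimately show "\<Phi>0 analytic_on {q0}" using U by (auto simp: analytic_at)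
  qed
  moreover have "\<exists>B. eventually (\<lambda>q. norm (\<Phi>0 q) \<le> B) (at 0)"
  proof -
    from bdd obtain y where y: "\<And>\<tau>. Im \<tau> \<ge> y \<Longrightarrow> norm (\<phi> \<tau>) \<le> B"
      by (auto simp: eventually_filtercomap eventually_at_top_linorder)
    have "norm (\<Phi>0 q) \<le> B" if "q \<in> ball 0 (exp (- 2 * pi * y))" "q \<noteq> 0" for q
    proof -
      have "exp (- 2 * pi * Im (L q)) < exp (- 2 * pi * y)"
        using norm_nome[of "L q"] nL[OF that(2)] that(1) by simp
      then have "Im (L q) \<ge> y" by (simp add: mult_less_cancel_left)
      then show ?thesis using y by (simp add: \<Phi>0_def)
    qed
    then have "eventually (\<lambda>q. norm (\<Phi>0 q) \<le> B) (at 0)"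
      by (intro eventually_at_in_open[where A = "ball 0 (exp (- 2 * pi * y))" and x = 0, THEN eventually_mono]) auto
    then show ?thesis by blast
  qed
  ultimately obtain \<Phi> where \<Phi>: "\<Phi> holomorphic_on ball 0 1" "\<forall>q\<in>ball 0 1 - {0}. \<Phi> q = \<Phi>0 q"
    using holomorphic_on_extend_bounded[of \<Phi>0 "ball 0 1" 0] by auto
  show ?thesis
    by (rule that[OF \<Phi>(1)]) (use \<Phi>(2) lift in \<open>simp add: norm_nome_less_1\<close>)
qed

text \<open>Each point is equivalent to one of imaginary part at least 1/(5N): the height 1/5
  reached with SL2(Z) is divided by some Q \<le> N. So the lift takes all values, except possibly
  the one at 0, on a closed disc of radius r < 1; its modulus has a maximum inside the unit disc,
  and the maximum principle applies.\<close>

theorem atkin_lehner_invariant_constant: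
  fixes N :: int
  assumes N: "N > 0" "squarefree N"
    and hol: "\<phi> holomorphic_on upper_half_plane"
    and inv: "\<And>Q a b c d \<tau>. \<lbrakk>Q > 0; Q dvd N; atkin_lehner N Q a b c d; Im \<tau> > 0\<rbrakk>
                \<Longrightarrow> \<phi> (moebius a b c d \<tau>) = \<phi> \<tau>"
    and bdd: "eventually (\<lambda>\<tau>. norm (\<phi> \<tau>) \<le> B) (filtercomap Im at_top)"
  obtains k where "\<And>\<tau>. Im \<tau> > 0 \<Longrightarrow> \<phi> \<tau> = k"
proof -
  have per: "\<phi> (\<tau> + 1) = \<phi> \<tau>" if "Im \<tau> > 0" for \<tau>
    using inv[of 1 1 1 0 1 \<tau>] that by (simp add: atkin_lehner_def moebius_def)
  obtain \<Phi> where \<Phi>: "\<Phi> holomorphic_on ball 0 1" "\<And>\<tau>. Im \<tau> > 0 \<Longrightarrow> \<phi> \<tau> = \<Phi> (nome \<tau>)"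
    using nome_lift[OF hol per bdd] by metis
  define r where "r = exp (- 2 * pi * (1 / (5 * of_int N)))"
  have r: "0 < r" "r < 1" using N(1) by (auto simp: r_def)
  have red: "\<exists>\<sigma>. Im \<sigma> > 0 \<and> norm (nome \<sigma>) \<le> r \<and> \<phi> \<tau> = \<phi> \<sigma>" if \<tau>: "Im \<tau> > 0" for \<tau>
  proof -
    obtain a b c d where det: "a * d - b * c = 1" and Im: "Im (moebius a b c d \<tau>) \<ge> 1 / 5"
      using exists_SL2Z_Im_ge[OF \<tau>] by metis
    define \<sigma> where "\<sigma> = moebius a b c d \<tau>"
    \<comment> \<open>The inverse matrix is decomposed, so that the Atkin-Lehner matrix leads from
      \<open>\<rho>\<close> back to \<open>\<tau>\<close>.\<close>
    have "d * a - (- b) * (- c) = 1" using det by (simp add: algebra_simps)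
    then obtain Q j where Q: "Q > 0" "Q dvd N"
      and AL: "atkin_lehner N Q (Q * d) (- b - d * j) (Q * (- c)) (a - (- c) * j)"
      using SL2Z_atkin_lehner_decomp[OF N] by metis
    define \<rho> where "\<rho> = (\<sigma> + of_int j) / of_int Q"
    have "Im \<rho> = Im \<sigma> / of_int Q" by (simp add: \<rho>_def)
    moreover have "of_int Q \<le> (of_int N :: real)" using Q N(1) zdvd_imp_le by (simp add: zdvd_imp_le)
    ultimately have Im\<rho>: "Im \<rho> \<ge> 1 / (5 * of_int N)"
      using Im Q(1) N(1) frac_le[of "Im \<sigma>" "1/5" "of_int Q" "of_int N"] by (simp add: \<sigma>_def frac_le)
    then have pos: "Im \<rho> > 0" using N(1) by (smt (verit) divide_pos_pos of_int_pos)
    have "moebius d (- b) (- c) a \<sigma> = \<tau>"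
    proof -
      have nz: "of_int c * \<tau> + of_int d \<noteq> 0"
        using moebius_denom_nonzero[OF \<tau>, of a d b c] det by simp
      have "moebius d (- b) (- c) a \<sigma> = moebius (a * d - b * c) 0 0 (a * d - b * c) \<tau>"
        unfolding \<sigma>_def moebius_moebius[OF nz] by (simp add: algebra_simps)
      then show ?thesis by (simp add: det moebius_def)
    qed
    then have "\<tau> = moebius (Q * d) (- b - d * j) (Q * (- c)) (a - (- c) * j) \<rho>"
      using moebius_atkin_lehner_decomp[of Q d "- b" j "- c" a \<sigma>] Q(1) by (simp add: \<rho>_def)
    then have "\<phi> \<tau> = \<phi> \<rho>" using inv[OF Q AL pos] by simp
    moreover have "norm (nome \<rho>) \<le> r"
      using mult_left_mono[OF Im\<rho>, of "2 * pi"] by (simp add: norm_nome r_def)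
    ultimately show ?thesis using pos by blast
  qed
  have "continuous_on (cball 0 r) (\<lambda>q. norm (\<Phi> q))"
    using r by (intro continuous_on_norm holomorphic_on_imp_continuous_on[OF holomorphic_on_subset[OF \<Phi>(1)]]) auto
  then have "\<exists>q0\<in>cball 0 r. \<forall>q\<in>cball 0 r. norm (\<Phi> q) \<le> norm (\<Phi> q0)"
    using r by (intro continuous_attains_sup) auto
  then obtain q0 where q0: "q0 \<in> cball 0 r" "\<And>q. q \<in> cball 0 r \<Longrightarrow> norm (\<Phi> q) \<le> norm (\<Phi> q0)"
    by blast
  have "norm (\<Phi> q) \<le> norm (\<Phi> q0)" if "q \<in> ball 0 1" for q
  proof (cases "q = 0")
    case True
    then show ?thesis using q0(2)[of 0] r by simp
  next
    case False
    moreover have "norm q < 1" using that by simp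
    ultimately obtain \<tau> where \<tau>: "Im \<tau> > 0" "nome \<tau> = q" using nome_surj by blast
    then obtain \<sigma> where "Im \<sigma> > 0" "norm (nome \<sigma>) \<le> r" "\<phi> \<tau> = \<phi> \<sigma>" using red by blast
    then show ?thesis using \<Phi>(2) \<tau> q0(2)[of "nome \<sigma>"] by (metis dist_0_norm mem_cball)
  qed
  then have "\<Phi> constant_on ball 0 1"
    using q0(1) r by (intro maximum_modulus_principle[OF \<Phi>(1) _ _ _ _ , of "ball 0 1" q0]) auto
  then obtain k where "\<And>q. q \<in> ball 0 1 \<Longrightarrow> \<Phi> q = k" by (auto simp: constant_on_def)
  then show ?thesis using \<Phi>(2) by (intro that[of k]) (simp add: norm_nome_less_1)
qed

section \<open>The weight two slash operator\<close>

text \<open>In weight 2 the determinant factor makes scalar matrices act trivially; only so do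
  Atkin-Lehner matrices act as involutions.\<close>

definition nslash :: "(complex \<Rightarrow> complex) \<Rightarrow> int \<Rightarrow> int \<Rightarrow> int \<Rightarrow> int \<Rightarrow> complex \<Rightarrow> complex" where
  "nslash f a b c d \<tau> = of_int (a * d - b * c) * slash 2 f a b c d \<tau>"

definition weight2_invariant :: "int \<Rightarrow> (complex \<Rightarrow> complex) \<Rightarrow> bool" where
  "weight2_invariant N f \<longleftrightarrow> (\<forall>a b c d. a * d - b * c = 1 \<and> N dvd c \<longrightarrow>
     (\<forall>\<tau>. Im \<tau> > 0 \<longrightarrow> slash 2 f a b c d \<tau> = f \<tau>))"

lemma weight2_invariantD:
  "\<lbrakk>weight2_invariant N f; a * d - b * c = 1; N dvd c; Im \<tau> > 0\<rbrakk> \<Longrightarrow> slash 2 f a b c d \<tau> = f \<tau>"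
  unfolding weight2_invariant_def by blast

lemma slash_cong:
  assumes "Im \<tau> > 0" "a * d - b * c > 0" "\<And>\<tau>. Im \<tau> > 0 \<Longrightarrow> f \<tau> = g \<tau>"
  shows "slash k f a b c d \<tau> = slash k g a b c d \<tau>"
  using assms moebius_in_upper_half_plane[OF assms(1,2)] by (simp add: slash_eq_moebius)

lemma slash_mult_left: "slash k (\<lambda>\<tau>. x * f \<tau>) a b c d \<tau> = x * slash k f a b c d \<tau>"
  by (simp add: slash_def)

lemma nslash_nslash:
  assumes "Im \<tau> > 0" "a' * d' - b' * c' \<noteq> 0"
  shows "nslash (nslash f a b c d) a' b' c' d' \<tau>
       = nslash f (a * a' + b * c') (a * b' + b * d') (c * a' + d * c') (c * b' + d * d') \<tau>"
proof -
  have "nslash f a b c d = (\<lambda>\<tau>. of_int (a * d - b * c) * slash 2 f a b c d \<tau>)"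
    by (rule ext) (simp add: nslash_def)
  then have "nslash (nslash f a b c d) a' b' c' d' \<tau> = of_int ((a' * d' - b' * c') * (a * d - b * c))
      * slash 2 (slash 2 f a b c d) a' b' c' d' \<tau>"
    by (simp only: nslash_def[of _ a' b' c' d'] slash_mult_left of_int_mult mult.assoc)
  moreover have "(a' * d' - b' * c') * (a * d - b * c)
      = (a * a' + b * c') * (c * b' + d * d') - (a * b' + b * d') * (c * a' + d * c')"
    by (simp add: algebra_simps)
  ultimately show ?thesis by (simp only: nslash_def slash_slash[OF assms])
qed

lemma nslash_invariant:
  "\<lbrakk>weight2_invariant N f; a * d - b * c = 1; N dvd c; Im \<tau> > 0\<rbrakk> \<Longrightarrow> nslash f a b c d \<tau> = f \<tau>"
  by (simp add: nslash_def weight2_invariantD)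

lemma nslash_cong:
  assumes "Im \<tau> > 0" "a * d - b * c > 0" "\<And>\<tau>. Im \<tau> > 0 \<Longrightarrow> f \<tau> = g \<tau>"
  shows "nslash f a b c d \<tau> = nslash g a b c d \<tau>"
  using slash_cong[OF assms] by (simp add: nslash_def)

lemma atkin_lehner_mult_Gamma0:
  assumes "atkin_lehner N Q a b c d" "a' * d' - b' * c' = 1" "N dvd c'" "Q dvd N"
  shows "atkin_lehner N Q (a * a' + b * c') (a * b' + b * d') (c * a' + d * c') (c * b' + d * d')"
proof -
  have "Q dvd c'" "Q dvd c" using assms dvd_trans unfolding atkin_lehner_def by blast+
  moreover have "(a * a' + b * c') * (c * b' + d * d') - (a * b' + b * d') * (c * a' + d * c')
      = (a * d - b * c) * (a' * d' - b' * c')" by (simp add: algebra_simps)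
  ultimately show ?thesis using assms unfolding atkin_lehner_def by auto
qed

lemma nslash_atkin_lehner:
  assumes f: "weight2_invariant N f" and V: "atkin_lehner N Q a b c d" and W: "atkin_lehner N Q a0 b0 c0 d0"
    and Q: "Q dvd N" "Q > 0" and \<tau>: "Im \<tau> > 0"
  shows "nslash f a b c d \<tau> = nslash f a0 b0 c0 d0 \<tau>"
proof -
  obtain a' b' c' d' where *: "a' * d' - b' * c' = 1" "N dvd c'"
    "a = a' * a0 + b' * c0" "b = a' * b0 + b' * d0" "c = c' * a0 + d' * c0" "d = c' * b0 + d' * d0"
    using atkin_lehner_coset[OF V W Q] .
  have det: "a0 * d0 - b0 * c0 > 0" using W Q unfolding atkin_lehner_def by simp
  have "nslash f a b c d \<tau> = nslash (nslash f a' b' c' d') a0 b0 c0 d0 \<tau>"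
    unfolding *(3-6) by (rule nslash_nslash[symmetric]) (use \<tau> det in auto)
  also have "\<dots> = nslash f a0 b0 c0 d0 \<tau>"
    by (rule nslash_cong[OF \<tau> det]) (rule nslash_invariant[OF f *(1,2)])
  finally show ?thesis .
qed

text \<open>The product of two such matrices for the same Q is Q times an element of the group of
  level N, and the scalar Q acts trivially.\<close>

lemma nslash_atkin_lehner_twice:
  assumes f: "weight2_invariant N f" and V: "atkin_lehner N Q a b c d" and W: "atkin_lehner N Q a0 b0 c0 d0"
    and Q: "Q dvd N" "Q > 0" and \<tau>: "Im \<tau> > 0"
  shows "nslash (nslash f a0 b0 c0 d0) a b c d \<tau> = f \<tau>"
proof -
  from V obtain x w z where x: "a = Q * x" "d = Q * w" "c = N * z" unfolding atkin_lehner_def by blast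
  from W obtain x0 w0 z0 where x0: "a0 = Q * x0" "d0 = Q * w0" "c0 = N * z0"
    unfolding atkin_lehner_def by blast
  obtain M where M: "N = Q * M" using Q by blast
  define a' b' c' d' where "a' = x0 * a + b0 * M * z" and "b' = x0 * b + b0 * w"
    and "c' = N * (z0 * x + w0 * z)" and "d' = M * z0 * b + w0 * d"
  have eqs: "a0 * a + b0 * c = Q * a'" "a0 * b + b0 * d = Q * b'"
    "c0 * a + d0 * c = Q * c'" "c0 * b + d0 * d = Q * d'"
    by (simp_all add: a'_def b'_def c'_def d'_def x x0 M algebra_simps)
  have "(Q * a') * (Q * d') - (Q * b') * (Q * c') = (a0 * d0 - b0 * c0) * (a * d - b * c)"
    unfolding eqs[symmetric] by (simp add: algebra_simps)
  also have "\<dots> = Q * Q" using V W unfolding atkin_lehner_def by simp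
  finally have "(Q * Q) * (a' * d' - b' * c') = (Q * Q) * 1" by (simp add: algebra_simps)
  then have det: "a' * d' - b' * c' = 1" using Q(2) by simp
  have "nslash (nslash f a0 b0 c0 d0) a b c d \<tau> = nslash f (Q * a') (Q * b') (Q * c') (Q * d') \<tau>"
    unfolding eqs[symmetric] using V Q by (intro nslash_nslash \<tau>) (simp add: atkin_lehner_def)
  also have "\<dots> = of_int (Q * Q) * of_int (a' * d' - b' * c') * slash 2 f (Q * a') (Q * b') (Q * c') (Q * d') \<tau>"
    unfolding nslash_def of_int_mult[symmetric] by (simp add: algebra_simps)
  also have "\<dots> = slash 2 f a' b' c' d' \<tau>"
    using Q(2) unfolding det by (simp add: slash_scalar power2_eq_square)
  also have "\<dots> = f \<tau>"
    by (rule weight2_invariantD[OF f det _ \<tau>]) (simp add: c'_def)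
  finally show ?thesis .
qed

lemma weight2_invariant_nslash:
  assumes f: "weight2_invariant N f" and W: "atkin_lehner N Q a0 b0 c0 d0"
    and Q: "Q dvd N" "Q > 0"
  shows "weight2_invariant N (nslash f a0 b0 c0 d0)"
  unfolding weight2_invariant_def
proof (intro allI impI, elim conjE)
  fix a b c d :: int and \<tau> :: complex
  assume *: "a * d - b * c = 1" "N dvd c" "Im \<tau> > 0"
  have "slash 2 (nslash f a0 b0 c0 d0) a b c d \<tau> = nslash (nslash f a0 b0 c0 d0) a b c d \<tau>"
    using * by (simp add: nslash_def[of _ a b c d])
  also have "\<dots> = nslash f (a0 * a + b0 * c) (a0 * b + b0 * d) (c0 * a + d0 * c) (c0 * b + d0 * d) \<tau>"
    using * by (intro nslash_nslash) auto
  also have "\<dots> = nslash f a0 b0 c0 d0 \<tau>"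
    by (rule nslash_atkin_lehner[OF f atkin_lehner_mult_Gamma0[OF W *(1,2) Q(1)] W Q *(3)])
  finally show "slash 2 (nslash f a0 b0 c0 d0) a b c d \<tau> = nslash f a0 b0 c0 d0 \<tau>" .
qed

lemma holomorphic_moebius:
  assumes "a * d - b * c > 0"
  shows "moebius a b c d holomorphic_on upper_half_plane"
  unfolding moebius_def[abs_def] upper_half_plane_def
  by (intro holomorphic_intros) (use moebius_denom_nonzero[of _ a d b c] assms in auto)

lemma holomorphic_moebius_compose:
  assumes "f holomorphic_on upper_half_plane" "a * d - b * c > 0"
  shows "(\<lambda>\<tau>. f (moebius a b c d \<tau>)) holomorphic_on upper_half_plane"
  using holomorphic_on_compose_gen[OF holomorphic_moebius[OF assms(2)] assms(1)]
    moebius_in_upper_half_plane[OF _ assms(2)]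
  by (auto simp: o_def upper_half_plane_def)

lemma holomorphic_nslash:
  assumes "f holomorphic_on upper_half_plane" "a * d - b * c > 0"
  shows "nslash f a b c d holomorphic_on upper_half_plane"
  unfolding nslash_def[abs_def] slash_eq_moebius
  by (intro holomorphic_intros holomorphic_moebius_compose assms)
    (use moebius_denom_nonzero[of _ a d b c] assms(2) in \<open>auto simp: upper_half_plane_def\<close>)

section \<open>Products of eta functions\<close>

lemma dedekind_eta_24_SL2Z:
  fixes a b c d :: int
  assumes "a * d - b * c = 1" "Im \<tau> > 0"
  shows "dedekind_eta (moebius a b c d \<tau>) ^ 24 = (of_int c * \<tau> + of_int d) ^ 12 * dedekind_eta \<tau> ^ 24"
proof -
  have "nome (of_int n / 12) ^ 12 = 1" for n
    using nome_of_nat_mult[of 12 "of_int n / 12"] by simp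
  then have "(dedekind_eta (moebius a b c d \<tau>) ^ 2) ^ 12
      = (of_int c * \<tau> + of_int d) ^ 12 * (dedekind_eta \<tau> ^ 2) ^ 12"
    using dedekind_eta_sq_SL2Z[OF assms] by (simp add: moebius_def power_mult_distrib)
  then show ?thesis by (simp flip: power_mult)
qed

text \<open>The product of the discriminant forms at \<tau> and M\<tau>: weight 24, free of roots of
  unity in its transformation, without zeros in the half plane, of order M + 1 at infinity, and with
  its two factors exchanged by the involution for M.\<close>

definition eta24_prod :: "int \<Rightarrow> complex \<Rightarrow> complex" where
  "eta24_prod M \<tau> = dedekind_eta \<tau> ^ 24 * dedekind_eta (of_int M * \<tau>) ^ 24"

lemma eta24_prod_nonzero: "M > 0 \<Longrightarrow> Im \<tau> > 0 \<Longrightarrow> eta24_prod M \<tau> \<noteq> 0"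
  by (simp add: eta24_prod_def dedekind_eta_nonzero)

lemma holomorphic_eta24_prod: "M > 0 \<Longrightarrow> eta24_prod M holomorphic_on upper_half_plane"
  unfolding eta24_prod_def[abs_def]
  by (intro holomorphic_intros holomorphic_dedekind_eta open_upper_half_plane)
    (auto simp: upper_half_plane_def)

lemma eta24_prod_atkin_lehner:
  assumes M: "M > 0" and Q: "Q = 1 \<or> Q = M" and V: "atkin_lehner M Q a b c d" and \<tau>: "Im \<tau> > 0"
  shows "eta24_prod M (moebius a b c d \<tau>) * of_int Q ^ 12
       = (of_int c * \<tau> + of_int d) ^ 24 * eta24_prod M \<tau>"
proof -
  have MT: "Im (of_int M * \<tau>) > 0" using M \<tau> by simp
  from V obtain z where z: "c = M * z" unfolding atkin_lehner_def by blast
  from Q show ?thesis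
  proof
    assume Q1: "Q = 1"
    then have det: "a * d - b * c = 1" using V by (simp add: atkin_lehner_def)
    then have det': "a * d - (M * b) * z = 1" by (simp add: z algebra_simps)
    have "of_int M * moebius a b c d \<tau> = moebius a (M * b) z d (of_int M * \<tau>)"
      by (simp add: moebius_def z algebra_simps)
    then show ?thesis
      using dedekind_eta_24_SL2Z[OF det \<tau>] dedekind_eta_24_SL2Z[OF det' MT] Q1
      by (simp add: eta24_prod_def z mult_ac flip: power_add)
  next
    assume QM: "Q = M"
    from V obtain x w where x: "a = M * x" "d = M * w" unfolding atkin_lehner_def QM by blast
    have "M * (x * (M * w) - b * z) = M * 1"
      using V by (simp add: atkin_lehner_def QM x z algebra_simps)
    then have det: "x * (M * w) - b * z = 1" using M by simp
    then have det': "(M * x) * w - b * z = 1" by (simp add: algebra_simps)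
    have eq1: "moebius a b c d \<tau> = moebius x b z (M * w) (of_int M * \<tau>)"
      by (simp add: moebius_def x z mult_ac)
    have nz: "of_int z * \<tau> + of_int w \<noteq> 0"
      using moebius_denom_nonzero[OF \<tau>, of "M * x" w b z] det' by simp
    have eq2: "of_int M * moebius a b c d \<tau> = moebius (M * x) b z w \<tau>"
    proof -
      have "of_int c * \<tau> + of_int d = of_int M * (of_int z * \<tau> + of_int w)"
        by (simp add: x z algebra_simps)
      then show ?thesis using M by (simp add: moebius_def x)
    qed
    have e1: "of_int z * (of_int M * \<tau>) + of_int (M * w) = of_int M * (of_int z * \<tau> + of_int w)"
      and e2: "of_int c * \<tau> + of_int d = of_int M * (of_int z * \<tau> + of_int w)"
      by (simp_all add: x z algebra_simps)
    show ?thesis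
      unfolding eta24_prod_def eq2 unfolding eq1
        dedekind_eta_24_SL2Z[OF det MT] dedekind_eta_24_SL2Z[OF det' \<tau>] e1 e2 QM power_mult_distrib
      by (simp flip: power_add)
  qed
qed

section \<open>Vanishing at prime level\<close>

lemma filterlim_nome: "filterlim nome (at 0) (filtercomap Im at_top)"
proof -
  have "filterlim (\<lambda>y. (- 2 * pi) * y) at_bot at_top"
    by (rule filterlim_tendsto_neg_mult_at_bot[OF tendsto_const _ filterlim_ident]) simp
  then have "((\<lambda>y. exp (- 2 * pi * y)) \<longlongrightarrow> 0) at_top"
    by (rule filterlim_compose[OF exp_at_bot])
  from filterlim_compose[OF this filterlim_filtercomap[of Im]]
  have "((\<lambda>\<tau>. norm (nome \<tau>)) \<longlongrightarrow> 0) (filtercomap Im at_top)"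
    unfolding norm_nome .
  then have "(nome \<longlongrightarrow> 0) (filtercomap Im at_top)"
    by (rule tendsto_norm_zero_cancel)
  then show ?thesis by (simp add: filterlim_at)
qed

lemma filtercomap_Im_neq_bot: "filtercomap Im at_top \<noteq> bot"
proof (rule filtercomap_neq_bot_surj)
  show "surj Im" by (rule surjI[of _ "\<lambda>y. Complex 0 y"]) simp
qed simp

lemma eventually_Im_pos: "eventually (\<lambda>\<tau>. Im \<tau> > 0) (filtercomap Im at_top)"
  by (rule eventually_filtercomapI) (rule eventually_gt_at_top)

lemma filterlim_Im_scale:
  assumes "Q > (0::int)"
  shows "filterlim (\<lambda>\<tau>. of_int Q * \<tau>) (filtercomap Im at_top) (filtercomap Im at_top)"
proof -
  have "filterlim (\<lambda>\<tau>. of_int Q * Im \<tau>) at_top (filtercomap Im at_top)"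
    by (rule filterlim_tendsto_pos_mult_at_top[OF tendsto_const]) (use assms in \<open>auto simp: filterlim_filtercomap\<close>)
  then show ?thesis by (simp add: filterlim_filtercomap_iff o_def)
qed

lemma tendsto_zero_constant:
  fixes k :: complex
  assumes "(\<phi> \<longlongrightarrow> 0) (filtercomap Im at_top)" "\<And>\<tau>. Im \<tau> > 0 \<Longrightarrow> \<phi> \<tau> = k"
  shows "k = 0"
proof (rule tendsto_unique[OF filtercomap_Im_neq_bot _ assms(1)])
  have "eventually (\<lambda>\<tau>. k = \<phi> \<tau>) (filtercomap Im at_top)"
    using eventually_Im_pos by eventually_elim (simp add: assms(2))
  then show "(\<phi> \<longlongrightarrow> k) (filtercomap Im at_top)"
    by (rule Lim_transform_eventually[OF tendsto_const])
qed

definition euler_fun :: "complex \<Rightarrow> complex" where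
  "euler_fun q = qpoch q q"

lemma euler_fun_0 [simp]: "euler_fun 0 = 1"
  by (simp add: euler_fun_def)

lemma euler_fun_nonzero: "norm q < 1 \<Longrightarrow> euler_fun q \<noteq> 0"
  by (simp add: euler_fun_def qpoch_self_nonzero)

lemma holomorphic_euler_fun [holomorphic_intros]:
  "f holomorphic_on A \<Longrightarrow> open A \<Longrightarrow> (\<And>z. z \<in> A \<Longrightarrow> norm (f z) < 1)
    \<Longrightarrow> (\<lambda>z. euler_fun (f z)) holomorphic_on A"
  unfolding euler_fun_def by (intro holomorphic_on_qpoch)

lemma eta24_prod_nome:
  assumes "M > 0"
  shows "eta24_prod (int M) \<tau> = nome \<tau> ^ (M + 1) * (euler_fun (nome \<tau>) * euler_fun (nome \<tau> ^ M)) ^ 24"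
proof -
  have "exp (2 * of_real pi * \<i> * z / 24) ^ 24 = nome z" for z
    unfolding nome_def exp_of_nat_mult[symmetric] by (simp add: mult_ac)
  then have "dedekind_eta z ^ 24 = nome z * euler_fun (nome z) ^ 24" for z
    unfolding dedekind_eta_eq euler_fun_def power_mult_distrib by metis
  then show ?thesis
    by (simp only: eta24_prod_def of_int_of_nat_eq nome_of_nat_mult) (simp add: power_mult_distrib mult_ac)
qed

text \<open>The numerator vanishes to order at least 12 in the nome, the denominator to order M + 1.
  For M < 11 a positive power, at least 11 - M, is left over.\<close>

lemma cusp_quotient_tendsto_0:
  fixes M :: nat
  assumes hol: "G holomorphic_on upper_half_plane" and per: "\<And>\<tau>. Im \<tau> > 0 \<Longrightarrow> G (\<tau> + 1) = G \<tau>"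
    and lim: "(G \<longlongrightarrow> 0) (filtercomap Im at_top)" and M: "0 < M" "M < 11"
  shows "((\<lambda>\<tau>. G \<tau> ^ 12 / eta24_prod (int M) \<tau>) \<longlongrightarrow> 0) (filtercomap Im at_top)"
proof -
  have "eventually (\<lambda>\<tau>. norm (G \<tau>) \<le> 1) (filtercomap Im at_top)"
    using tendstoD[OF lim zero_less_one] by eventually_elim simp
  then obtain \<Phi> where \<Phi>: "\<Phi> holomorphic_on ball 0 1" "\<And>\<tau>. Im \<tau> > 0 \<Longrightarrow> G \<tau> = \<Phi> (nome \<tau>)"
    using nome_lift[OF hol per] by blast
  have contball: "isCont g 0" if "g holomorphic_on ball 0 1" for g :: "complex \<Rightarrow> complex"
    using continuous_on_interior[OF holomorphic_on_imp_continuous_on[OF that], of 0] by simp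
  have "((\<lambda>\<tau>. \<Phi> (nome \<tau>)) \<longlongrightarrow> \<Phi> 0) (filtercomap Im at_top)"
    by (rule filterlim_compose[OF contball[OF \<Phi>(1), unfolded isCont_def] filterlim_nome])
  then have "(G \<longlongrightarrow> \<Phi> 0) (filtercomap Im at_top)"
    by (rule Lim_transform_eventually) (use eventually_Im_pos in eventually_elim, simp add: \<Phi>(2))
  then have \<Phi>0: "\<Phi> 0 = 0" using lim tendsto_unique[OF filtercomap_Im_neq_bot] by blast
  define h where "h = (\<lambda>q. if q = 0 then deriv \<Phi> 0 else \<Phi> q / q)"
  have "(\<lambda>q. if q = 0 then deriv \<Phi> 0 else (\<Phi> q - \<Phi> 0) / (q - 0)) holomorphic_on ball 0 1"
    by (rule pole_lemma[OF \<Phi>(1)]) simp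
  moreover have "(\<lambda>q. if q = 0 then deriv \<Phi> 0 else (\<Phi> q - \<Phi> 0) / (q - 0)) = h"
    by (rule ext) (simp add: h_def \<Phi>0)
  ultimately have h: "h holomorphic_on ball 0 1" by simp
  have \<Phi>h: "\<Phi> q = q * h q" for q by (simp add: h_def \<Phi>0)
  define g where "g = (\<lambda>q. q ^ (11 - M) * h q ^ 12 / (euler_fun q * euler_fun (q ^ M)) ^ 24)"
  have qM: "norm (q ^ M) < 1" if "norm q < 1" for q :: complex
    using that M by (simp add: norm_power power_less_one_iff)
  have "g holomorphic_on ball 0 1"
    unfolding g_def using M qM by (intro holomorphic_intros h) (auto simp: euler_fun_nonzero)
  then have "g \<midarrow>0\<rightarrow> g 0" using contball by (simp add: isCont_def)
  moreover have "g 0 = 0" using M by (simp add: g_def)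
  ultimately have "g \<midarrow>0\<rightarrow> 0" by simp
  then have "((\<lambda>\<tau>. g (nome \<tau>)) \<longlongrightarrow> 0) (filtercomap Im at_top)"
    by (rule filterlim_compose[OF _ filterlim_nome])
  moreover have "eventually (\<lambda>\<tau>. g (nome \<tau>) = G \<tau> ^ 12 / eta24_prod (int M) \<tau>) (filtercomap Im at_top)"
    using eventually_Im_pos
  proof eventually_elim
    case (elim \<tau>)
    have "nome \<tau> ^ 12 = nome \<tau> ^ (M + 1) * nome \<tau> ^ (11 - M)"
      unfolding power_add[symmetric] using M by simp
    then show ?case
      unfolding g_def eta24_prod_nome[OF M(1)] \<Phi>(2)[OF elim] \<Phi>h power_mult_distrib by simp
  qed
  ultimately show ?thesis by (rule Lim_transform_eventually)
qed

text \<open>\<open>G\<close> need not be an eigenform of the involution, which merely exchanges the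
  quotients formed from \<open>G\<close> and from its image \<open>H\<close>. Their sum and product
  are invariant and tend to 0 at infinity, hence vanish identically, and then so do both
  quotients.\<close>

theorem prime_level_vanishing:
  fixes M :: nat
  assumes M: "prime M" "M < 11"
    and hol: "G holomorphic_on upper_half_plane" and inv: "weight2_invariant (int M) G"
    and W: "atkin_lehner (int M) (int M) a0 b0 c0 d0"
    and lim: "(G \<longlongrightarrow> 0) (filtercomap Im at_top)"
    and lim': "(nslash G a0 b0 c0 d0 \<longlongrightarrow> 0) (filtercomap Im at_top)"
    and \<tau>: "Im \<tau> > 0"
  shows "G \<tau> = 0"
proof -
  define H where "H = nslash G a0 b0 c0 d0"
  have M0: "M > 0" using M(1) prime_gt_0_nat by blast
  have det0: "a0 * d0 - b0 * c0 > 0" using W M0 by (simp add: atkin_lehner_def)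
  have holH: "H holomorphic_on upper_half_plane"
    unfolding H_def by (rule holomorphic_nslash[OF hol det0])
  have invH: "weight2_invariant (int M) H"
    unfolding H_def using M0 by (intro weight2_invariant_nslash[OF inv W]) auto
  have per: "f (\<tau> + 1) = f \<tau>" if "weight2_invariant (int M) f" "Im \<tau> > 0" for f \<tau>
    using weight2_invariantD[OF that(1), of 1 1 1 0 \<tau>] that(2) by (simp add: slash_def)
  define \<psi> where "\<psi> = (\<lambda>f \<tau>. f \<tau> ^ 12 / eta24_prod (int M) \<tau>)"
  have lim1: "(\<psi> G \<longlongrightarrow> 0) (filtercomap Im at_top)"
    unfolding \<psi>_def by (rule cusp_quotient_tendsto_0[OF hol per[OF inv] lim M0 M(2)])
  have lim2: "(\<psi> H \<longlongrightarrow> 0) (filtercomap Im at_top)"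
    unfolding \<psi>_def by (rule cusp_quotient_tendsto_0[OF holH per[OF invH] lim'[folded H_def] M0 M(2)])
  have hol1: "\<psi> f holomorphic_on upper_half_plane" if "f holomorphic_on upper_half_plane" for f
    unfolding \<psi>_def using M0 that
    by (intro holomorphic_intros holomorphic_eta24_prod) (auto simp: upper_half_plane_def eta24_prod_nonzero)
  have trans: "\<psi> f (moebius a b c d \<tau>) = \<psi> g \<tau>"
    if "nslash f a b c d \<tau> = g \<tau>" "atkin_lehner (int M) Q a b c d" "Q = 1 \<or> Q = int M" "Im \<tau> > 0"
    for f g Q a b c d \<tau>
  proof -
    let ?e = "of_int c * \<tau> + of_int d"
    have det: "a * d - b * c = Q" using that(2) by (simp add: atkin_lehner_def)
    have Q0: "Q > 0" using that(3) M0 by auto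
    have nz: "?e \<noteq> 0" using moebius_denom_nonzero[OF that(4), of a d b c] det Q0 by simp
    have "of_int Q * f (moebius a b c d \<tau>) = ?e ^ 2 * g \<tau>"
      using that(1) nz by (simp add: nslash_def det slash_eq_moebius field_simps)
    then have "(of_int Q * f (moebius a b c d \<tau>)) ^ 12 = (?e ^ 2 * g \<tau>) ^ 12" by simp
    then have 1: "of_int Q ^ 12 * f (moebius a b c d \<tau>) ^ 12 = ?e ^ 24 * g \<tau> ^ 12"
      by (simp add: power_mult_distrib flip: power_mult)
    have 2: "eta24_prod (int M) (moebius a b c d \<tau>) * of_int Q ^ 12 = ?e ^ 24 * eta24_prod (int M) \<tau>"
      by (rule eta24_prod_atkin_lehner[OF _ that(3,2,4)]) (use M0 in simp)
    have "Im (moebius a b c d \<tau>) > 0"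
      using moebius_in_upper_half_plane[OF that(4)] det Q0 by simp
    then have nz': "eta24_prod (int M) (moebius a b c d \<tau>) \<noteq> 0" "eta24_prod (int M) \<tau> \<noteq> 0"
      using eta24_prod_nonzero M0 that(4) by auto
    have "\<psi> f (moebius a b c d \<tau>) = (of_int Q ^ 12 * f (moebius a b c d \<tau>) ^ 12) /
        (eta24_prod (int M) (moebius a b c d \<tau>) * of_int Q ^ 12)"
      using Q0 by (simp add: \<psi>_def)
    also have "\<dots> = \<psi> g \<tau>" unfolding 1 2 using nz by (simp add: \<psi>_def)
    finally show ?thesis .
  qed
  have swap: "(\<psi> G (moebius a b c d \<tau>) = \<psi> G \<tau> \<and> \<psi> H (moebius a b c d \<tau>) = \<psi> H \<tau>) \<or>
      (\<psi> G (moebius a b c d \<tau>) = \<psi> H \<tau> \<and> \<psi> H (moebius a b c d \<tau>) = \<psi> G \<tau>)"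
    if Q: "Q > 0" "Q dvd int M" and V: "atkin_lehner (int M) Q a b c d" and \<tau>: "Im \<tau> > 0" for Q a b c d \<tau>
  proof -
    have "nat Q dvd M" using Q by (simp add: nat_dvd_iff)
    then have "nat Q = 1 \<or> nat Q = M" using M(1) by (metis prime_nat_iff)
    then have Q': "Q = 1 \<or> Q = int M" using Q(1) by auto
    then show ?thesis
    proof
      assume "Q = 1"
      then have "nslash G a b c d \<tau> = G \<tau>" "nslash H a b c d \<tau> = H \<tau>"
        using V \<tau> nslash_invariant[OF inv, of a d b c \<tau>] nslash_invariant[OF invH, of a d b c \<tau>]
        by (simp_all add: atkin_lehner_def)
      from trans[where f = G and g = G, OF this(1) V Q' \<tau>] trans[where f = H and g = H, OF this(2) V Q' \<tau>] show ?thesis by simp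
    next
      assume QM: "Q = int M"
      have 1: "nslash G a b c d \<tau> = H \<tau>"
        unfolding H_def by (rule nslash_atkin_lehner[OF inv V[unfolded QM] W _ _ \<tau>]) (use M0 in simp_all)
      have 2: "nslash H a b c d \<tau> = G \<tau>"
        unfolding H_def by (rule nslash_atkin_lehner_twice[OF inv V[unfolded QM] W _ _ \<tau>]) (use M0 in simp_all)
      from trans[where f = G and g = H, OF 1 V Q' \<tau>] trans[where f = H and g = G, OF 2 V Q' \<tau>] show ?thesis by simp
    qed
  qed
  have sqf: "squarefree (int M)" using M(1) by (simp add: squarefree_prime)
  have zero: "\<phi> \<tau> = 0" if \<phi>: "\<phi> holomorphic_on upper_half_plane" "(\<phi> \<longlongrightarrow> 0) (filtercomap Im at_top)"
      "\<And>Q a b c d \<tau>. \<lbrakk>Q > 0; Q dvd int M; atkin_lehner (int M) Q a b c d; Im \<tau> > 0\<rbrakk>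
                \<Longrightarrow> \<phi> (moebius a b c d \<tau>) = \<phi> \<tau>" for \<phi>
  proof -
    have bdd: "eventually (\<lambda>\<tau>. norm (\<phi> \<tau>) \<le> 1) (filtercomap Im at_top)"
      using tendstoD[OF \<phi>(2) zero_less_one] by eventually_elim simp
    have "int M > 0" using M0 by simp
    have "\<exists>k. \<forall>\<tau>. Im \<tau> > 0 \<longrightarrow> \<phi> \<tau> = k"
      by (rule atkin_lehner_invariant_constant[OF \<open>int M > 0\<close> sqf \<phi>(1) \<phi>(3) bdd]) blast+
    then obtain k where k: "\<And>\<tau>. Im \<tau> > 0 \<Longrightarrow> \<phi> \<tau> = k" by blast
    then have "k = 0" using tendsto_zero_constant[OF \<phi>(2)] by blast
    then show ?thesis using k \<tau> by simp
  qed
  have "\<psi> G \<tau> + \<psi> H \<tau> = 0"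
  proof (rule zero[where \<phi> = "\<lambda>\<tau>. \<psi> G \<tau> + \<psi> H \<tau>"])
    show "((\<lambda>\<tau>. \<psi> G \<tau> + \<psi> H \<tau>) \<longlongrightarrow> 0) (filtercomap Im at_top)"
      using tendsto_add[OF lim1 lim2] by simp
    show "(\<lambda>\<tau>. \<psi> G \<tau> + \<psi> H \<tau>) holomorphic_on upper_half_plane"
      by (intro holomorphic_intros hol1 hol holH)
    fix Q a b c d :: int and \<tau> :: complex
    assume "Q > 0" "Q dvd int M" "atkin_lehner (int M) Q a b c d" "Im \<tau> > 0"
    from swap[OF this] show "\<psi> G (moebius a b c d \<tau>) + \<psi> H (moebius a b c d \<tau>) = \<psi> G \<tau> + \<psi> H \<tau>"
      by (elim disjE conjE) simp_all
  qed
  moreover have "\<psi> G \<tau> * \<psi> H \<tau> = 0"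
  proof (rule zero[where \<phi> = "\<lambda>\<tau>. \<psi> G \<tau> * \<psi> H \<tau>"])
    show "((\<lambda>\<tau>. \<psi> G \<tau> * \<psi> H \<tau>) \<longlongrightarrow> 0) (filtercomap Im at_top)"
      using tendsto_mult[OF lim1 lim2] by simp
    show "(\<lambda>\<tau>. \<psi> G \<tau> * \<psi> H \<tau>) holomorphic_on upper_half_plane"
      by (intro holomorphic_intros hol1 hol holH)
    fix Q a b c d :: int and \<tau> :: complex
    assume "Q > 0" "Q dvd int M" "atkin_lehner (int M) Q a b c d" "Im \<tau> > 0"
    from swap[OF this] show "\<psi> G (moebius a b c d \<tau>) * \<psi> H (moebius a b c d \<tau>) = \<psi> G \<tau> * \<psi> H \<tau>"
      by (elim disjE conjE) simp_all
  qed
  ultimately have "\<psi> G \<tau> = 0" by auto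
  then show ?thesis using eta24_prod_nonzero[of "int M" \<tau>] M0 \<tau> by (simp add: \<psi>_def)
qed

section \<open>The trace to lower level\<close>

text \<open>The cosets of $\Gamma_0(pM)$ in $\Gamma_0(M)$ are the points of the projective line over
  $\mathbb{F}_p$, read off from the lower row; the index \<open>k = p\<close> is the point at infinity.\<close>

definition row_class :: "nat \<Rightarrow> int \<Rightarrow> int \<Rightarrow> nat \<Rightarrow> bool" where
  "row_class p c d k \<longleftrightarrow>
     (k = p \<and> int p dvd c) \<or> (k < p \<and> \<not> int p dvd c \<and> int p dvd d - c * int k)"

lemma row_class_exists:
  assumes "prime p"
  shows "\<exists>k\<le>p. row_class p c d k"
proof (cases "int p dvd c")
  case True
  then show ?thesis by (auto simp: row_class_def)
next
  case False
  have p: "int p > 0" using assms prime_gt_0_nat by simp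
  have "coprime (int p) c" using False assms by (intro prime_imp_coprime) auto
  then obtain j where j: "int p dvd d - c * j"
    using exists_dvd_diff_mult[of c "int p" d] by (auto simp: coprime_commute)
  have "d - c * (j mod int p) = (d - c * j) + int p * (c * (j div int p))"
    by (simp add: algebra_simps flip: minus_mult_div_eq_mod)
  then have "int p dvd d - c * (j mod int p)"
    using dvd_add[OF j dvd_triv_left, of "c * (j div int p)"] by (simp only:)
  then have "int p dvd d - c * int (nat (j mod int p))" using p by simp
  moreover have "nat (j mod int p) < p" using p by (simp add: nat_less_iff)
  ultimately show ?thesis using False by (auto simp: row_class_def intro!: exI[of _ "nat (j mod int p)"])
qed

lemma row_class_imp_cross:
  assumes "row_class p c d k" "row_class p c' d' k"
  shows "int p dvd c * d' - d * c'"
  using assms unfolding row_class_def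
proof (elim disjE conjE)
  assume "int p dvd d - c * int k" "int p dvd d' - c' * int k"
  then have "int p dvd c * (d' - c' * int k) - c' * (d - c * int k)" by simp
  then show ?thesis by (simp add: algebra_simps)
qed auto

text \<open>A cross product divisible by p means that the two rows are the same point of the
  projective line; the last two assumptions say that each row is such a point at all.\<close>

lemma row_class_unique:
  assumes p: "prime p" and "row_class p c d k" "row_class p c' d' l"
    and cross: "int p dvd c * d' - d * c'"
    and nz: "\<not> (int p dvd c \<and> int p dvd d)" "\<not> (int p dvd c' \<and> int p dvd d')"
  shows "k = l"
  using assms(2,3) unfolding row_class_def
proof (elim disjE conjE)
  have pp: "prime (int p)" using p by simp
  { assume "int p dvd c" "\<not> int p dvd c'"
    then have "int p dvd d * c'" using cross by (metis dvd_diff_right_iff dvd_mult2)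
    then have False using pp nz \<open>int p dvd c\<close> \<open>\<not> int p dvd c'\<close> prime_dvd_mult_iff by blast }
  note 1 = this
  { assume "int p dvd c'" "\<not> int p dvd c"
    then have "int p dvd c * d'" using cross by (metis dvd_diff_left_iff dvd_mult)
    then have False using pp nz \<open>int p dvd c'\<close> \<open>\<not> int p dvd c\<close> prime_dvd_mult_iff by blast }
  note 2 = this
  { assume "k = p" "int p dvd c" "l < p" "\<not> int p dvd c'" then show ?thesis using 1 by blast }
  { assume "l = p" "int p dvd c'" "k < p" "\<not> int p dvd c" then show ?thesis using 2 by blast }
  { assume *: "k < p" "l < p" "\<not> int p dvd c" "\<not> int p dvd c'" "int p dvd d - c * int k" "int p dvd d' - c' * int l"
    have "int p dvd (c * d' - d * c') - c * (d' - c' * int l) + c' * (d - c * int k)"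
      by (intro dvd_add[OF dvd_diff[OF cross dvd_mult[OF *(6)]] dvd_mult[OF *(5)]])
    also have "(c * d' - d * c') - c * (d' - c' * int l) + c' * (d - c * int k) = c * (c' * (int l - int k))"
      by (simp add: algebra_simps)
    finally have "int p dvd int l - int k" using pp * prime_dvd_mult_iff by blast
    moreover have "\<bar>int l - int k\<bar> < int p" using *(1,2) by linarith
    ultimately have "int l - int k = 0" using dvd_imp_le_int[of "int l - int k" "int p"] by force
    then show ?thesis by simp }
qed auto

text \<open>The function is the trace to level M of the image F of \<open>f\<close> under the
  involution for p. The trivial coset contributes F. On any other coset the representative factors
  through an Atkin-Lehner matrix, which takes F back to \<open>f\<close>, and leaves the summand
  with (\<tau> + j)/p. The sum over j is the Hecke operator U_p.\<close>

lemma trace_invariant: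
  fixes p M :: nat
  assumes p: "prime p" and f: "weight2_invariant (int (p * M)) f"
    and W: "atkin_lehner (int (p * M)) (int p) a0 b0 c0 d0"
  shows "weight2_invariant (int M)
     (\<lambda>\<tau>. nslash f a0 b0 c0 d0 \<tau> + (\<Sum>j<p. f ((\<tau> + of_nat j) / of_nat p) / of_nat p))"
proof -
  define N where "N = int (p * M)"
  note f = f[folded N_def] and W = W[folded N_def]
  define F where "F = nslash f a0 b0 c0 d0"
  define g where "g = (\<lambda>k \<tau>. if k = p then F \<tau> else f ((\<tau> + of_nat k) / of_nat p) / of_nat p)"
  have p0: "int p > 0" using p prime_gt_0_nat by simp
  have pN: "int p dvd N" by (simp add: N_def)
  have invF: "weight2_invariant N F"
    unfolding F_def by (rule weight2_invariant_nslash[OF f W pN p0])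
  have "int p dvd a0" "int p dvd d0" "int p * int M dvd c0" using W by (auto simp: atkin_lehner_def N_def)
  then obtain x w z where x: "a0 = int p * x" "d0 = int p * w" "c0 = int p * int M * z" by blast
  have "int p * (x * (int p * w) - b0 * (int M * z)) = int p * 1"
    using W by (simp add: atkin_lehner_def x algebra_simps)
  then have det0: "x * (int p * w) - b0 * (int M * z) = 1" using p0 by simp
  have punit: "\<not> is_unit (int p)" using p by (simp add: prime_nat_iff)
  \<comment> \<open>The mere existence of the Atkin-Lehner matrix forces p to be prime to M.\<close>
  have pMz: "\<not> int p dvd int M * z"
  proof
    assume "int p dvd int M * z"
    then have "int p dvd x * (int p * w) - b0 * (int M * z)" by simp
    then show False using det0 punit by simp
  qed
  have coprime: "coprime (int p) (int M)"
    using pMz p by (intro prime_imp_coprime) auto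
  have F_row: "slash 2 F a b c d \<tau> = g k \<tau>"
    if det: "a * d - b * c = 1" and "int M dvd c" and k: "row_class p c d k" and \<tau>: "Im \<tau> > 0" for a b c d k \<tau>
  proof (cases "int p dvd c")
    case True
    have "N dvd c" using True that(2) coprime by (simp add: N_def divides_mult)
    then have "slash 2 F a b c d \<tau> = F \<tau>" using invF det \<tau> by (intro weight2_invariantD)
    then show ?thesis using k True by (auto simp: row_class_def g_def)
  next
    case False
    then have k: "k < p" "int p dvd d - c * int k" using k by (auto simp: row_class_def)
    define V where "V = (\<tau> + of_nat k) / of_nat p"
    have ImV: "Im V > 0" using \<tau> p0 by (simp add: V_def)
    have "int p * a * (d - c * int k) - (b - a * int k) * (int p * c) = int p * (a * d - b * c)"
      by (simp add: algebra_simps)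
    then have AL: "atkin_lehner N (int p) (int p * a) (b - a * int k) (int p * c) (d - c * int k)"
      using that(2) k(2) det by (simp add: atkin_lehner_def N_def)
    have e: "of_int (int p * c) * V + of_int (d - c * int k) = of_int c * \<tau> + of_int d"
      using p0 by (simp add: V_def field_simps)
    have m: "moebius (int p * a) (b - a * int k) (int p * c) (d - c * int k) V = moebius a b c d \<tau>"
      using moebius_atkin_lehner_decomp[of "int p" a b "int k" c d \<tau>] p0 by (simp add: V_def)
    have "nslash F (int p * a) (b - a * int k) (int p * c) (d - c * int k) V = f V"
      unfolding F_def by (rule nslash_atkin_lehner_twice[OF f AL W pN p0 ImV])
    moreover have "nslash F (int p * a) (b - a * int k) (int p * c) (d - c * int k) V
        = of_nat p * slash 2 F a b c d \<tau>"
      using AL unfolding nslash_def slash_eq_moebius e m by (simp add: atkin_lehner_def)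
    ultimately have "slash 2 F a b c d \<tau> = f V / of_nat p"
      using p0 by (simp add: field_simps)
    then show ?thesis using k(1) by (simp add: g_def V_def)
  qed
  \<comment> \<open>The given matrix is an element of SL2(Z) times the diagonal matrix (p, 1); that
    element times the k-th power of T represents the class k < p.\<close>
  define ra rb rc rd where "ra = (\<lambda>k. if k = p then 1 else x)"
    and "rb = (\<lambda>k. if k = p then 0 else b0 + x * int k)"
    and "rc = (\<lambda>k. if k = p then 0 else int M * z)"
    and "rd = (\<lambda>k. if k = p then 1 else int p * w + int M * z * int k)"
  have rdet: "ra k * rd k - rb k * rc k = 1" for k
    using det0 by (simp add: ra_def rb_def rc_def rd_def algebra_simps)
  have rM: "int M dvd rc k" for k by (simp add: rc_def)
  have rclass: "row_class p (rc k) (rd k) k" if "k \<le> p" for k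
    using that pMz by (auto simp: row_class_def rc_def rd_def)
  have Fg: "slash 2 F (ra k) (rb k) (rc k) (rd k) \<tau> = g k \<tau>" if "k \<le> p" "Im \<tau> > 0" for k \<tau>
    by (rule F_row[OF rdet rM rclass[OF that(1)] that(2)])
  have sum: "nslash f a0 b0 c0 d0 \<tau> + (\<Sum>j<p. f ((\<tau> + of_nat j) / of_nat p) / of_nat p) = (\<Sum>k\<le>p. g k \<tau>)" for \<tau>
    by (simp add: g_def F_def lessThan_Suc_atMost[symmetric] add.commute)
  show ?thesis
    unfolding weight2_invariant_def sum
  proof (intro allI impI, elim conjE)
    fix a b c d :: int and \<tau> :: complex
    assume det: "a * d - b * c = 1" and "int M dvd c" and \<tau>: "Im \<tau> > 0"
    define c' d' where "c' = (\<lambda>k. rc k * a + rd k * c)" and "d' = (\<lambda>k. rc k * b + rd k * d)"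
    have det': "(ra k * a + rb k * c) * d' k - (ra k * b + rb k * d) * c' k = 1" for k
    proof -
      have "(ra k * a + rb k * c) * d' k - (ra k * b + rb k * d) * c' k
          = (ra k * rd k - rb k * rc k) * (a * d - b * c)"
        by (simp add: c'_def d'_def algebra_simps)
      then show ?thesis using rdet det by simp
    qed
    \<comment> \<open>Multiplication by an element of the group of level M permutes the cosets;
      \<open>\<pi>\<close> is this permutation.\<close>
    have "\<forall>k. \<exists>l\<le>p. row_class p (c' k) (d' k) l" using row_class_exists[OF p] by blast
    then obtain \<pi> where \<pi>: "\<And>k. \<pi> k \<le> p" "\<And>k. row_class p (c' k) (d' k) (\<pi> k)" by metis
    have ndvd: "\<not> (int p dvd c \<and> int p dvd d)" if "a * d - b * c = 1" for a b c d
    proof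
      assume "int p dvd c \<and> int p dvd d"
      then have "int p dvd a * d - b * c" by simp
      then show False using that punit by simp
    qed
    have inj: "inj_on \<pi> {..p}"
    proof (rule inj_onI)
      fix k l assume kl: "k \<in> {..p}" "l \<in> {..p}" "\<pi> k = \<pi> l"
      have "int p dvd c' k * d' l - d' k * c' l"
        using row_class_imp_cross[OF \<pi>(2)[of k]] \<pi>(2)[of l] kl(3) by simp
      also have "c' k * d' l - d' k * c' l = (rc k * rd l - rd k * rc l) * (a * d - b * c)"
        by (simp add: c'_def d'_def algebra_simps)
      finally have "int p dvd rc k * rd l - rd k * rc l" using det by simp
      then show "k = l"
        using row_class_unique[OF p rclass rclass] ndvd[OF rdet] kl by auto
    qed
    then have bij: "bij_betw \<pi> {..p} {..p}"
      using \<pi>(1) by (intro bij_betw_imageI endo_inj_surj) auto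
    have "slash 2 (\<lambda>\<tau>. \<Sum>k\<le>p. g k \<tau>) a b c d \<tau> = (\<Sum>k\<le>p. slash 2 (g k) a b c d \<tau>)"
      by (simp add: slash_def sum_divide_distrib)
    also have "\<dots> = (\<Sum>k\<le>p. slash 2 (slash 2 F (ra k) (rb k) (rc k) (rd k)) a b c d \<tau>)"
      by (intro sum.cong refl slash_cong \<tau>) (use det Fg in auto)
    also have "\<dots> = (\<Sum>k\<le>p. g (\<pi> k) \<tau>)"
    proof (intro sum.cong refl)
      fix k
      have "slash 2 (slash 2 F (ra k) (rb k) (rc k) (rd k)) a b c d \<tau>
          = slash 2 F (ra k * a + rb k * c) (ra k * b + rb k * d) (c' k) (d' k) \<tau>"
        unfolding c'_def d'_def by (rule slash_slash[OF \<tau>]) (use det in simp)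
      also have "\<dots> = g (\<pi> k) \<tau>"
        by (rule F_row[OF det' _ \<pi>(2) \<tau>]) (use rM \<open>int M dvd c\<close> in \<open>simp add: c'_def\<close>)
      finally show "slash 2 (slash 2 F (ra k) (rb k) (rc k) (rd k)) a b c d \<tau> = g (\<pi> k) \<tau>" .
    qed
    also have "\<dots> = (\<Sum>k\<le>p. g k \<tau>)" by (rule sum.reindex_bij_betw[OF bij])
    finally show "slash 2 (\<lambda>\<tau>. \<Sum>k\<le>p. g k \<tau>) a b c d \<tau> = (\<Sum>k\<le>p. g k \<tau>)" .
  qed
qed

section \<open>The Hecke operator U_p on q-expansions\<close>

lemma sum_nome_roots:
  fixes p n :: nat
  assumes "p > 0"
  shows "(\<Sum>j<p. nome (of_nat n * of_nat j / of_nat p)) = (if p dvd n then of_nat p else 0)"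
proof -
  define x where "x = nome (of_nat n / of_nat p)"
  have xj: "nome (of_nat n * of_nat j / of_nat p) = x ^ j" for j
    unfolding x_def nome_of_nat_mult[symmetric] by (simp add: mult.commute)
  have x1: "x = 1 \<longleftrightarrow> p dvd n"
  proof
    assume "x = 1"
    then obtain k :: int where "of_nat n / of_nat p = (of_int k :: complex)"
      unfolding x_def nome_eq_1_iff by blast
    then have "(of_nat n :: complex) = of_int (k * int p)" using assms by (simp add: field_simps)
    then have "int n = k * int p" by (metis of_int_eq_iff of_int_of_nat_eq)
    then have "int p dvd int n" by simp
    then show "p dvd n" by simp
  next
    assume "p dvd n"
    then obtain k where "n = p * k" by blast
    then show "x = 1" using assms nome_of_int[of "int k"] by (simp add: x_def)
  qed
  have xp: "x ^ p = 1"
    unfolding x_def nome_of_nat_mult[symmetric] using assms nome_of_int[of "int n"] by simp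
  show ?thesis
  proof (cases "p dvd n")
    case True
    then show ?thesis using x1 by (simp add: xj)
  next
    case False
    then have "x \<noteq> 1" using x1 by simp
    then show ?thesis using False xp by (simp add: xj sum_gp_strict)
  qed
qed

text \<open>Averaging over the shifts j kills the exponents not divisible by p and leaves the series
  with coefficients a(pn).\<close>

lemma Hecke_U_eigen:
  fixes p :: nat
  assumes p: "p > 0"
    and f: "\<And>\<tau>. Im \<tau> > 0 \<Longrightarrow> (\<lambda>n. a n * nome \<tau> ^ n) sums f \<tau>"
    and a: "\<And>n. a (p * n) = \<mu> * a n"
    and \<tau>: "Im \<tau> > 0"
  shows "(\<Sum>j<p. f ((\<tau> + of_nat j) / of_nat p) / of_nat p) = \<mu> * f \<tau>"
proof -
  have pow: "nome ((\<tau> + of_nat j) / of_nat p) ^ n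
      = nome (of_nat n * \<tau> / of_nat p) * nome (of_nat n * of_nat j / of_nat p)" for j n
    unfolding nome_of_nat_mult[symmetric] nome_add[symmetric] by (simp add: algebra_simps add_divide_distrib)
  have "(\<lambda>n. \<Sum>j<p. a n * nome ((\<tau> + of_nat j) / of_nat p) ^ n / of_nat p)
      sums (\<Sum>j<p. f ((\<tau> + of_nat j) / of_nat p) / of_nat p)"
    by (intro sums_sum sums_divide f) (use p \<tau> in simp)
  moreover have "(\<Sum>j<p. a n * nome ((\<tau> + of_nat j) / of_nat p) ^ n / of_nat p)
      = (if p dvd n then a n * nome (of_nat n * \<tau> / of_nat p) else 0)" for n
  proof -
    have "(\<Sum>j<p. a n * nome ((\<tau> + of_nat j) / of_nat p) ^ n / of_nat p)
        = a n * nome (of_nat n * \<tau> / of_nat p) / of_nat p * (\<Sum>j<p. nome (of_nat n * of_nat j / of_nat p))"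
      unfolding pow sum_distrib_left by (intro sum.cong) (auto simp: field_simps)
    then show ?thesis using p by (simp add: sum_nome_roots[OF p])
  qed
  ultimately have "(\<lambda>n. if p dvd n then a n * nome (of_nat n * \<tau> / of_nat p) else 0)
      sums (\<Sum>j<p. f ((\<tau> + of_nat j) / of_nat p) / of_nat p)" by simp
  moreover have "strict_mono (\<lambda>n. p * n)" using p by (simp add: strict_mono_def)
  ultimately have "(\<lambda>n. if p dvd p * n then a (p * n) * nome (of_nat (p * n) * \<tau> / of_nat p) else 0)
      sums (\<Sum>j<p. f ((\<tau> + of_nat j) / of_nat p) / of_nat p)"
    by (subst sums_mono_reindex[where g = "\<lambda>n. p * n" and f = "\<lambda>n. if p dvd n then a n * nome (of_nat n * \<tau> / of_nat p) else 0"]) auto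
  moreover have "a (p * n) * nome (of_nat (p * n) * \<tau> / of_nat p) = \<mu> * (a n * nome \<tau> ^ n)" for n
    using p by (simp add: a nome_of_nat_mult)
  ultimately have "(\<lambda>n. \<mu> * (a n * nome \<tau> ^ n)) sums (\<Sum>j<p. f ((\<tau> + of_nat j) / of_nat p) / of_nat p)"
    by simp
  then show ?thesis using sums_mult[OF f[OF \<tau>], of \<mu>] sums_unique2 by blast
qed

section \<open>Atkin-Lehner eigenvalues\<close>

lemma cusp_form_weight2_invariant: "f \<in> cusp_forms 2 N \<Longrightarrow> weight2_invariant (int N) f"
  unfolding cusp_forms_def weight2_invariant_def upper_half_plane_def by blast

text \<open>The matrix is an element of SL2(Z) times the diagonal matrix (Q, 1), so the limit is one
  at a cusp, approached along Q\<tau>.\<close>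

lemma cusp_form_nslash_tendsto_0:
  assumes f: "f \<in> cusp_forms 2 N" and V: "atkin_lehner (int N) Q a b c d" and Q: "Q dvd int N" "Q > 0"
  shows "(nslash f a b c d \<longlongrightarrow> 0) (filtercomap Im at_top)"
proof -
  have "Q dvd a" "Q dvd c" using V Q dvd_trans unfolding atkin_lehner_def by blast+
  then obtain x z where x: "a = Q * x" "c = Q * z" by blast
  have "Q * (x * d - b * z) = Q * 1" using V by (simp add: atkin_lehner_def x algebra_simps)
  then have det: "x * d - b * z = 1" using Q(2) by simp
  then have "(slash 2 f x b z d \<longlongrightarrow> 0) (filtercomap Im at_top)"
    using f unfolding cusp_forms_def by blast
  from filterlim_compose[OF this filterlim_Im_scale[OF Q(2)]]
  have "((\<lambda>\<tau>. of_int Q * slash 2 f x b z d (of_int Q * \<tau>)) \<longlongrightarrow> of_int Q * 0) (filtercomap Im at_top)"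
    by (intro tendsto_intros)
  moreover have "of_int Q * slash 2 f x b z d (of_int Q * \<tau>) = nslash f a b c d \<tau>" for \<tau>
    using V by (simp add: nslash_def atkin_lehner_def slash_def x mult_ac)
  ultimately show ?thesis by simp
qed

lemma atkin_lehner_mult:
  assumes V: "atkin_lehner N Q a b c d" and V': "atkin_lehner N Q' a' b' c' d'" and N: "Q * Q' dvd N"
  shows "atkin_lehner N (Q * Q') (a * a' + b * c') (a * b' + b * d') (c * a' + d * c') (c * b' + d * d')"
proof -
  have "Q * Q' dvd c" "Q * Q' dvd c'" using V V' N dvd_trans unfolding atkin_lehner_def by blast+
  moreover have "Q * Q' dvd a * a'" "Q * Q' dvd d * d'"
    using V V' unfolding atkin_lehner_def by (auto intro: mult_dvd_mono)
  moreover have "(a * a' + b * c') * (c * b' + d * d') - (a * b' + b * d') * (c * a' + d * c')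
      = (a * d - b * c) * (a' * d' - b' * c')" by (simp add: algebra_simps)
  ultimately show ?thesis using V V' unfolding atkin_lehner_def by auto
qed

text \<open>For an eigenform of U_p the trace becomes the image under the involution plus \<mu>
  times the form. It has the prime level M and vanishes at both of its cusps, hence is 0.\<close>

theorem cusp_form_atkin_lehner_eigen:
  fixes p M :: nat
  assumes p: "prime p" and M: "prime M" "M < 11"
    and f: "f \<in> cusp_forms 2 (p * M)"
    and W: "atkin_lehner (int (p * M)) (int p) a b c d"
    and W': "atkin_lehner (int (p * M)) (int M) a' b' c' d'"
    and U: "\<And>\<tau>. Im \<tau> > 0 \<Longrightarrow> (\<Sum>j<p. f ((\<tau> + of_nat j) / of_nat p) / of_nat p) = \<mu> * f \<tau>"
    and \<tau>: "Im \<tau> > 0"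
  shows "nslash f a b c d \<tau> = - \<mu> * f \<tau>"
proof -
  define F where "F = nslash f a b c d"
  define G where "G = (\<lambda>\<tau>. F \<tau> + \<mu> * f \<tau>)"
  have p0: "int p > 0" and M0: "int M > 0" using p M prime_gt_0_nat by auto
  have inv: "weight2_invariant (int (p * M)) f" by (rule cusp_form_weight2_invariant[OF f])
  have hol: "f holomorphic_on upper_half_plane" using f by (simp add: cusp_forms_def)
  have holF: "F holomorphic_on upper_half_plane"
    unfolding F_def by (rule holomorphic_nslash[OF hol]) (use W p0 in \<open>simp add: atkin_lehner_def\<close>)
  have invG: "weight2_invariant (int M) G"
  proof -
    have "weight2_invariant (int M) (\<lambda>\<tau>. F \<tau> + (\<Sum>j<p. f ((\<tau> + of_nat j) / of_nat p) / of_nat p))"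
      unfolding F_def by (rule trace_invariant[OF p inv W])
    then have *: "slash 2 (\<lambda>\<tau>. F \<tau> + (\<Sum>j<p. f ((\<tau> + of_nat j) / of_nat p) / of_nat p)) a b c d \<tau>
        = F \<tau> + (\<Sum>j<p. f ((\<tau> + of_nat j) / of_nat p) / of_nat p)"
      if "a * d - b * c = 1" "int M dvd c" "Im \<tau> > 0" for a b c d \<tau>
      using that weight2_invariantD by blast
    show ?thesis unfolding weight2_invariant_def
    proof (intro allI impI, elim conjE)
      fix a b c d :: int and \<tau> :: complex
      assume **: "a * d - b * c = 1" "int M dvd c" "Im \<tau> > 0"
      have "slash 2 G a b c d \<tau> = slash 2 (\<lambda>\<tau>. F \<tau> + (\<Sum>j<p. f ((\<tau> + of_nat j) / of_nat p) / of_nat p)) a b c d \<tau>"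
        by (rule slash_cong) (use ** U in \<open>auto simp: G_def\<close>)
      also have "\<dots> = G \<tau>" unfolding *[OF **] G_def U[OF **(3)] by simp
      finally show "slash 2 G a b c d \<tau> = G \<tau>" .
    qed
  qed
  have "(F \<longlongrightarrow> 0) (filtercomap Im at_top)"
    unfolding F_def by (rule cusp_form_nslash_tendsto_0[OF f W]) (use p0 in auto)
  moreover have "(f \<longlongrightarrow> 0) (filtercomap Im at_top)"
  proof -
    have "(slash 2 f 1 0 0 1 \<longlongrightarrow> 0) (filtercomap Im at_top)"
      using f unfolding cusp_forms_def by force
    then show ?thesis by (simp add: slash_def[abs_def])
  qed
  ultimately have "((\<lambda>\<tau>. F \<tau> + \<mu> * f \<tau>) \<longlongrightarrow> 0 + \<mu> * 0) (filtercomap Im at_top)"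
    by (intro tendsto_intros)
  then have limG: "(G \<longlongrightarrow> 0) (filtercomap Im at_top)" by (simp add: G_def)
  have "(nslash f (a * a' + b * c') (a * b' + b * d') (c * a' + d * c') (c * b' + d * d') \<longlongrightarrow> 0)
      (filtercomap Im at_top)"
    by (rule cusp_form_nslash_tendsto_0[OF f atkin_lehner_mult[OF W W']]) (use p0 M0 in auto)
  moreover have "(nslash f a' b' c' d' \<longlongrightarrow> 0) (filtercomap Im at_top)"
    by (rule cusp_form_nslash_tendsto_0[OF f W']) (use M0 in auto)
  ultimately have "((\<lambda>\<tau>. nslash f (a * a' + b * c') (a * b' + b * d') (c * a' + d * c') (c * b' + d * d') \<tau>
      + \<mu> * nslash f a' b' c' d' \<tau>) \<longlongrightarrow> 0 + \<mu> * 0) (filtercomap Im at_top)"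
    by (intro tendsto_intros)
  moreover have "eventually (\<lambda>\<tau>. nslash f (a * a' + b * c') (a * b' + b * d') (c * a' + d * c') (c * b' + d * d') \<tau>
      + \<mu> * nslash f a' b' c' d' \<tau> = nslash G a' b' c' d' \<tau>) (filtercomap Im at_top)"
    using eventually_Im_pos
  proof eventually_elim
    case (elim \<tau>)
    have "nslash G a' b' c' d' \<tau> = nslash F a' b' c' d' \<tau> + \<mu> * nslash f a' b' c' d' \<tau>"
      by (simp add: nslash_def G_def slash_def add_divide_distrib algebra_simps)
    moreover have "nslash F a' b' c' d' \<tau>
        = nslash f (a * a' + b * c') (a * b' + b * d') (c * a' + d * c') (c * b' + d * d') \<tau>"
      unfolding F_def by (rule nslash_nslash[OF elim]) (use W' M0 in \<open>simp add: atkin_lehner_def\<close>)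
    ultimately show ?case by simp
  qed
  ultimately have limG': "(nslash G a' b' c' d' \<longlongrightarrow> 0) (filtercomap Im at_top)"
    using Lim_transform_eventually by force
  \<comment> \<open>The involution for M in level pM also represents the one in level M, so the
    limit just found is the one at the second cusp.\<close>
  have "int M dvd c'" using W' unfolding atkin_lehner_def by (metis dvd_mult_right of_nat_mult)
  then have "atkin_lehner (int M) (int M) a' b' c' d'"
    using W' by (simp add: atkin_lehner_def)
  moreover have "G holomorphic_on upper_half_plane"
    unfolding G_def by (intro holomorphic_intros holF hol)
  ultimately have "G \<tau> = 0"
    using prime_level_vanishing[OF M _ invG _ limG limG' \<tau>] by blast
  then show ?thesis by (simp add: G_def F_def eq_neg_iff_add_eq_0)
qed

section \<open>Two eta products of level 35\<close>

definition eta_pair :: "int \<Rightarrow> int \<Rightarrow> complex \<Rightarrow> complex" where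
  "eta_pair r s \<tau> = dedekind_eta (of_int r * \<tau>) ^ 2 * dedekind_eta (of_int s * \<tau>) ^ 2"

lemma eta_pair_nonzero: "r > 0 \<Longrightarrow> s > 0 \<Longrightarrow> Im \<tau> > 0 \<Longrightarrow> eta_pair r s \<tau> \<noteq> 0"
  by (simp add: eta_pair_def dedekind_eta_nonzero)

lemma holomorphic_eta_pair: "r > 0 \<Longrightarrow> s > 0 \<Longrightarrow> eta_pair r s holomorphic_on upper_half_plane"
  unfolding eta_pair_def[abs_def]
  by (intro holomorphic_intros holomorphic_dedekind_eta open_upper_half_plane)
    (auto simp: upper_half_plane_def)

text \<open>Scaling the argument by r turns b into rb and divides the lower left entry by r. In the
  sum of the two exponents r + s factors out, up to 6(d - 1) for even c, where the determinant makes
  d odd.\<close>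

lemma eta_exponent_pair:
  fixes a b c d r s :: int
  assumes det: "a * d - b * (r * s * c) = 1" and "odd r" "odd s" "12 dvd r + s"
  shows "12 dvd eta_exponent a (r * b) (s * c) d + eta_exponent a (s * b) (r * c) d"
proof -
  have "eta_exponent a (r * b) (s * c) d + eta_exponent a (s * b) (r * c) d
      = (r + s) * ((a + d) * c - b * d * (r * s * c\<^sup>2 - 1)
          + (if even c then - 3 * c * d else - 3 * c)) + (if even c then 6 * (d - 1) else 0)"
    using assms(2,3) by (auto simp: eta_exponent_def algebra_simps power2_eq_square)
  moreover have "12 dvd (if even c then 6 * (d - 1) else 0)"
  proof (cases "even c")
    case True
    then have "odd d" using det by (metis dvd_diff dvd_mult even_mult_iff odd_one)
    then obtain k where "d = 2 * k + 1" by (blast elim: oddE)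
    then show ?thesis by simp
  qed simp
  ultimately show ?thesis using assms(4) by simp
qed

lemma weight2_invariant_eta_pair:
  fixes r s :: int
  assumes "r > 0" "s > 0" "odd r" "odd s" "12 dvd r + s"
  shows "weight2_invariant (r * s) (eta_pair r s)"
  unfolding weight2_invariant_def
proof (intro allI impI, elim conjE)
  fix a b c d :: int and \<tau> :: complex
  assume det: "a * d - b * c = 1" and "r * s dvd c" and \<tau>: "Im \<tau> > 0"
  then obtain z where z: "c = r * s * z" by blast
  have nz: "of_int c * \<tau> + of_int d \<noteq> 0" using moebius_denom_nonzero[OF \<tau>, of a d b c] det by simp
  have scale: "dedekind_eta (of_int r * moebius a b c d \<tau>) ^ 2
      = nome (of_int (eta_exponent a (r * b) (s * z) d) / 12) * (of_int c * \<tau> + of_int d)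
        * dedekind_eta (of_int r * \<tau>) ^ 2"
    if "r > 0" "c = r * s * z" for r s
  proof -
    have "of_int r * moebius a b c d \<tau> = moebius a (r * b) (s * z) d (of_int r * \<tau>)"
      by (simp add: moebius_def that algebra_simps)
    moreover have "a * d - (r * b) * (s * z) = 1" using det that by (simp add: algebra_simps)
    then have "dedekind_eta (moebius a (r * b) (s * z) d (of_int r * \<tau>)) ^ 2
        = nome (of_int (eta_exponent a (r * b) (s * z) d) / 12)
          * (of_int (s * z) * (of_int r * \<tau>) + of_int d) * dedekind_eta (of_int r * \<tau>) ^ 2"
      unfolding moebius_def using that \<tau> by (intro dedekind_eta_sq_SL2Z) auto
    moreover have "of_int (s * z) * (of_int r * \<tau>) + of_int d = of_int c * \<tau> + of_int d"
      by (simp add: that mult_ac)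
    ultimately show ?thesis by metis
  qed
  have "12 dvd (eta_exponent a (r * b) (s * z) d + eta_exponent a (s * b) (r * z) d) - 0"
    using eta_exponent_pair[of a d b r s z] det assms by (simp add: z)
  from nome_12_cong[OF this]
  have e: "nome (of_int (eta_exponent a (r * b) (s * z) d) / 12)
      * nome (of_int (eta_exponent a (s * b) (r * z) d) / 12) = 1"
    by (simp add: add_divide_distrib nome_add)
  have "eta_pair r s (moebius a b c d \<tau>) = (nome (of_int (eta_exponent a (r * b) (s * z) d) / 12)
      * nome (of_int (eta_exponent a (s * b) (r * z) d) / 12)) * (of_int c * \<tau> + of_int d) ^ 2 * eta_pair r s \<tau>"
    using scale[of r s] scale[of s r] assms by (simp add: eta_pair_def z mult_ac power2_eq_square)
  then show "slash 2 (eta_pair r s) a b c d \<tau> = eta_pair r s \<tau>"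
    unfolding e using nz by (simp add: slash_eq_moebius)
qed

section \<open>The two eta products of level 35 under the involutions\<close>

abbreviation "etaA \<equiv> eta_pair 1 35"
abbreviation "etaB \<equiv> eta_pair 5 7"

lemma weight2_invariant_etaA: "weight2_invariant 35 etaA"
  using weight2_invariant_eta_pair[of 1 35] by simp

lemma weight2_invariant_etaB: "weight2_invariant 35 etaB"
  using weight2_invariant_eta_pair[of 5 7] by simp

lemma atkin_lehner_W5: "atkin_lehner 35 5 15 2 35 5" and atkin_lehner_W7: "atkin_lehner 35 7 21 4 35 7"
  by (simp_all add: atkin_lehner_def)

text \<open>The involution for 5 toggles the factor 5 in the arguments: \<tau> becomes 5\<tau> and
  35\<tau> becomes 7\<tau>, up to a Moebius transformation in SL2(Z).\<close>

lemma etaA_W5: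
  assumes \<tau>: "Im \<tau> > 0"
  shows "nslash etaA 15 2 35 5 \<tau> = etaB \<tau>"
proof -
  have nz: "7 * \<tau> + 1 \<noteq> 0" using \<tau> by (auto simp: complex_eq_iff)
  have eq1: "moebius 15 2 35 5 \<tau> = moebius 3 2 7 5 (5 * \<tau>)" by (simp add: moebius_def)
  have eq2: "35 * moebius 15 2 35 5 \<tau> = moebius 15 14 1 1 (7 * \<tau>)"
  proof -
    have "35 * \<tau> + 5 \<noteq> 0" using \<tau> by (auto simp: complex_eq_iff)
    then show ?thesis using nz by (simp add: moebius_def divide_simps) (simp add: algebra_simps)
  qed
  have "etaA (moebius 15 2 35 5 \<tau>) = dedekind_eta (moebius 3 2 7 5 (5 * \<tau>)) ^ 2 * dedekind_eta (moebius 15 14 1 1 (7 * \<tau>)) ^ 2"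
    unfolding eta_pair_def by (simp add: eq1 eq2[unfolded eq1])
  also have "\<dots> = (nome (of_int (eta_exponent 3 2 7 5) / 12) * nome (of_int (eta_exponent 15 14 1 1) / 12))
      * ((35 * \<tau> + 5) * (7 * \<tau> + 1)) * etaB \<tau>"
    using dedekind_eta_sq_SL2Z[of 3 5 2 7 "5 * \<tau>"] dedekind_eta_sq_SL2Z[of 15 1 14 1 "7 * \<tau>"] \<tau>
    by (simp add: moebius_def eta_pair_def mult_ac)
  also have "nome (of_int (eta_exponent 3 2 7 5) / 12) * nome (of_int (eta_exponent 15 14 1 1) / 12) = 1"
    \<comment> \<open>The exponents are -445 and 13, with sum 12 times -36.\<close>
    using nome_of_int[of "-36"] by (simp add: eta_exponent_def flip: nome_add)
  also have "(35 * \<tau> + 5) * (7 * \<tau> + 1) = 5 * (7 * \<tau> + 1) ^ 2" by (simp add: algebra_simps power2_eq_square)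
  finally have "etaA (moebius 15 2 35 5 \<tau>) = 5 * (7 * \<tau> + 1) ^ 2 * etaB \<tau>" by simp
  moreover have "(35 * \<tau> + 5) ^ 2 = 25 * (7 * \<tau> + 1) ^ 2" by (simp add: algebra_simps power2_eq_square)
  ultimately show ?thesis using nz by (simp add: nslash_def slash_eq_moebius)
qed

lemma etaA_W7:
  assumes \<tau>: "Im \<tau> > 0"
  shows "nslash etaA 21 4 35 7 \<tau> = - etaB \<tau>"
proof -
  have nz: "5 * \<tau> + 1 \<noteq> 0" using \<tau> by (auto simp: complex_eq_iff)
  have eq1: "moebius 21 4 35 7 \<tau> = moebius 3 4 5 7 (7 * \<tau>)" by (simp add: moebius_def)
  have eq2: "35 * moebius 21 4 35 7 \<tau> = moebius 21 20 1 1 (5 * \<tau>)"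
  proof -
    have "35 * \<tau> + 7 \<noteq> 0" using \<tau> by (auto simp: complex_eq_iff)
    then show ?thesis using nz by (simp add: moebius_def divide_simps) (simp add: algebra_simps)
  qed
  have "etaA (moebius 21 4 35 7 \<tau>) = dedekind_eta (moebius 3 4 5 7 (7 * \<tau>)) ^ 2 * dedekind_eta (moebius 21 20 1 1 (5 * \<tau>)) ^ 2"
    unfolding eta_pair_def by (simp add: eq1 eq2[unfolded eq1])
  also have "\<dots> = (nome (of_int (eta_exponent 3 4 5 7) / 12) * nome (of_int (eta_exponent 21 20 1 1) / 12))
      * ((35 * \<tau> + 7) * (5 * \<tau> + 1)) * etaB \<tau>"
    using dedekind_eta_sq_SL2Z[of 3 7 4 5 "7 * \<tau>"] dedekind_eta_sq_SL2Z[of 21 1 20 1 "5 * \<tau>"] \<tau>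
    by (simp add: moebius_def eta_pair_def mult_ac)
  also have "nome (of_int (eta_exponent 3 4 5 7) / 12) * nome (of_int (eta_exponent 21 20 1 1) / 12) = - 1"
  proof -
    \<comment> \<open>The exponents -637 and 19 add up to -618, which is 6 modulo 12; hence the sign
      that the involution for 5 does not have.\<close>
    have "nome (of_int (eta_exponent 3 4 5 7) / 12) * nome (of_int (eta_exponent 21 20 1 1) / 12)
        = nome (1/2 + of_int (- 52))"
      by (simp add: eta_exponent_def flip: nome_add)
    then show ?thesis unfolding nome_add nome_half nome_of_int by simp
  qed
  also have "(35 * \<tau> + 7) * (5 * \<tau> + 1) = 7 * (5 * \<tau> + 1) ^ 2" by (simp add: algebra_simps power2_eq_square)
  finally have "etaA (moebius 21 4 35 7 \<tau>) = - 7 * (5 * \<tau> + 1) ^ 2 * etaB \<tau>" by simp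
  moreover have "(35 * \<tau> + 7) ^ 2 = 49 * (5 * \<tau> + 1) ^ 2" by (simp add: algebra_simps power2_eq_square)
  ultimately show ?thesis using nz by (simp add: nslash_def slash_eq_moebius)
qed

section \<open>Expansions at the cusp at infinity\<close>

text \<open>It shows that the tail of Euler's product is 1 + O(q^n), so that a removable singularity
  replaces differentiation of an infinite product. With t = 2|q|^n \<le> 1 the tail differs from 1
  by at most e^t - 1 \<le> t + t^2 \<le> 2t.\<close>

lemma qpoch_minus_1_bound:
  assumes "norm q \<le> 1 / 2" "n > 0"
  shows "norm (qpoch (q ^ n) q - 1) \<le> 4 * norm q ^ n"
proof -
  define x where "x = norm q"
  have x: "0 \<le> x" "x \<le> 1 / 2" using assms(1) by (auto simp: x_def)
  have xn: "x ^ n \<le> 1 / 2"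
  proof -
    have "x ^ n \<le> x ^ 1" using x assms(2) by (intro power_decreasing) auto
    then show ?thesis using x by simp
  qed
  have bound: "norm ((\<Prod>i<m. 1 - q ^ n * q ^ i) - 1) \<le> 4 * x ^ n" for m
  proof -
    have "norm ((\<Prod>i<m. 1 + (- (q ^ n * q ^ i))) - 1) \<le> (\<Prod>i<m. 1 + norm (- (q ^ n * q ^ i))) - 1"
      by (rule norm_prod_minus1_le_prod_minus1)
    also have "(\<Prod>i<m. 1 + norm (- (q ^ n * q ^ i))) \<le> exp (\<Sum>i<m. norm (- (q ^ n * q ^ i)))"
      by (rule prod_le_exp_sum) auto
    also have "(\<Sum>i<m. norm (- (q ^ n * q ^ i))) = x ^ n * (\<Sum>i<m. x ^ i)"
      by (simp add: norm_mult norm_power x_def sum_distrib_left)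
    also have "x ^ n * (\<Sum>i<m. x ^ i) \<le> x ^ n * 2"
    proof (rule mult_left_mono)
      have "(\<Sum>i<m. x ^ i) = (1 - x ^ m) / (1 - x)"
        using x by (subst sum_gp_strict) auto
      also have "\<dots> \<le> 1 / (1 / 2)"
        using x by (intro frac_le) auto
      finally show "(\<Sum>i<m. x ^ i) \<le> 2" by simp
    qed (use x in simp)
    also have "exp (x ^ n * 2) \<le> 1 + x ^ n * 2 + (x ^ n * 2)\<^sup>2"
      using x xn by (intro exp_bound) auto
    also have "(x ^ n * 2)\<^sup>2 \<le> x ^ n * 2"
      using mult_left_mono[of "x ^ n * 2" 1 "x ^ n * 2"] x xn by (simp add: power2_eq_square)
    finally show ?thesis using x by simp
  qed
  have "norm q < 1" using assms(1) by simp
  then have "(\<lambda>m. norm ((\<Prod>i<m. 1 - q ^ n * q ^ i) - 1)) \<longlonglongrightarrow> norm (qpoch (q ^ n) q - 1)"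
    by (intro tendsto_intros qpoch_LIMSEQ)
  then show ?thesis by (rule LIMSEQ_le_const2) (use bound in \<open>simp add: x_def\<close>)
qed

lemma norm_power_less_1:
  fixes q :: complex
  assumes "norm q < 1" "n > 0"
  shows "norm (q ^ n) < 1"
  using assms by (simp add: norm_power power_less_one_iff)

lemma holomorphic_compose_power:
  assumes "u holomorphic_on ball 0 1" "n > 0"
  shows "(\<lambda>q. u (q ^ n)) holomorphic_on ball 0 1"
proof -
  have "(u \<circ> (\<lambda>q. q ^ n)) holomorphic_on ball 0 1"
  proof (rule holomorphic_on_compose_gen[OF _ assms(1)])
    show "(\<lambda>q::complex. q ^ n) ` ball 0 1 \<subseteq> ball 0 1"
      using norm_power_less_1[OF _ assms(2)] by (auto simp: dist_norm)
  qed (intro holomorphic_intros)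
  then show ?thesis by (simp add: o_def)
qed

text \<open>The start of Euler's pentagonal series. Precision q^5 is enough: A begins with q^3 and B
  involves only powers of q^5 and q^7 next to its factor q, and both are wanted up to q^7.\<close>

lemma euler_fun_expansion:
  obtains u where "u holomorphic_on ball 0 1"
    "\<And>q. norm q < 1 \<Longrightarrow> euler_fun q = 1 - q - q\<^sup>2 + q ^ 5 * u q"
proof -
  define h where "h = (\<lambda>q. (qpoch (q ^ 5) q - 1) / q ^ 5)"
  have "(\<lambda>q. qpoch (q ^ 5) q) holomorphic_on ball 0 1"
    by (intro holomorphic_on_qpoch holomorphic_intros) auto
  then have "h holomorphic_on ball 0 1 - {0}"
    unfolding h_def by (intro holomorphic_intros) (auto intro: holomorphic_on_subset)
  moreover have "eventually (\<lambda>q. norm (h q) \<le> 4) (at 0)"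
  proof -
    have "eventually (\<lambda>q. q \<in> ball 0 (1/2) - {0}) (at (0::complex))"
      by (rule eventually_at_in_open) auto
    then show ?thesis
    proof eventually_elim
      case (elim q)
      then show ?case
        using qpoch_minus_1_bound[of q 5] by (simp add: h_def norm_divide norm_power divide_simps)
    qed
  qed
  ultimately obtain r where r: "r holomorphic_on ball 0 1" "\<forall>q\<in>ball 0 1 - {0}. r q = h q"
    using holomorphic_on_extend_bounded[of h "ball 0 1" 0] by auto
  have R: "qpoch (q ^ 5) q = 1 + q ^ 5 * r q" if "norm q < 1" for q
    using r(2) that by (cases "q = 0") (auto simp: h_def)
  \<comment> \<open>The first four factors multiply to 1 - q - q^2 + 2q^5 - q^8 - q^9 + q^10; the
    bracket is the part from q^5 on.\<close>
  define u where "u = (\<lambda>q. (2 - q ^ 3 - q ^ 4 + q ^ 5) + (1 - q) * (1 - q\<^sup>2) * (1 - q ^ 3) * (1 - q ^ 4) * r q)"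
  show ?thesis
  proof (rule that)
    show "u holomorphic_on ball 0 1" unfolding u_def by (intro holomorphic_intros r)
    fix q :: complex assume q: "norm q < 1"
    have "euler_fun q = (1 - q) * (1 - q\<^sup>2) * (1 - q ^ 3) * (1 - q ^ 4) * qpoch (q ^ 5) q"
      unfolding euler_fun_def
      using qpoch_rec[OF q, of q] qpoch_rec[OF q, of "q\<^sup>2"] qpoch_rec[OF q, of "q ^ 3"] qpoch_rec[OF q, of "q ^ 4"]
      by (simp add: power_Suc2[symmetric] flip: power2_eq_square power_Suc2)
    also have "\<dots> = 1 - q - q\<^sup>2 + q ^ 5 * u q"
      unfolding R[OF q] u_def by (simp add: algebra_simps eval_nat_numeral)
    finally show "euler_fun q = 1 - q - q\<^sup>2 + q ^ 5 * u q" .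
  qed
qed

lemma dedekind_eta_sq_nome:
  "dedekind_eta z ^ 2 = nome (z / 12) * euler_fun (nome z) ^ 2"
proof -
  have "exp (2 * of_real pi * \<i> * z / 24) ^ 2 = nome (z / 12)"
    unfolding nome_def exp_of_nat_mult[symmetric] by (simp add: field_simps)
  then show ?thesis unfolding dedekind_eta_eq euler_fun_def power_mult_distrib by simp
qed

definition etaA_q :: "complex \<Rightarrow> complex" where
  "etaA_q q = q ^ 3 * (euler_fun q * euler_fun (q ^ 35)) ^ 2"

definition etaB_q :: "complex \<Rightarrow> complex" where
  "etaB_q q = q * (euler_fun (q ^ 5) * euler_fun (q ^ 7)) ^ 2"

lemma etaA_nome: "etaA \<tau> = etaA_q (nome \<tau>)"
proof -
  have "nome (\<tau> / 12) * nome (35 * \<tau> / 12) = nome \<tau> ^ 3"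
    using nome_of_nat_mult[of 3 \<tau>] by (simp flip: nome_add)
  moreover have "nome (35 * \<tau>) = nome \<tau> ^ 35" using nome_of_nat_mult[of 35 \<tau>] by simp
  ultimately show ?thesis
    by (simp add: eta_pair_def etaA_q_def dedekind_eta_sq_nome power_mult_distrib)
qed

lemma etaB_nome: "etaB \<tau> = etaB_q (nome \<tau>)"
proof -
  have "nome (5 * \<tau> / 12) * nome (7 * \<tau> / 12) = nome \<tau>"
    by (simp flip: nome_add)
  moreover have "nome (5 * \<tau>) = nome \<tau> ^ 5" "nome (7 * \<tau>) = nome \<tau> ^ 7"
    using nome_of_nat_mult[of 5 \<tau>] nome_of_nat_mult[of 7 \<tau>] by simp_all
  ultimately show ?thesis
    by (simp add: eta_pair_def etaB_q_def dedekind_eta_sq_nome power_mult_distrib)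
qed

lemma holomorphic_etaA_q: "etaA_q holomorphic_on ball 0 1"
  and holomorphic_etaB_q: "etaB_q holomorphic_on ball 0 1"
  unfolding etaA_q_def[abs_def] etaB_q_def[abs_def]
  by (intro holomorphic_intros; simp add: norm_power_less_1)+

lemma etaA_q_expansion:
  obtains R where "etaA_q has_fps_expansion
    fps_X ^ 3 - 2 * fps_X ^ 4 - fps_X ^ 5 + 2 * fps_X ^ 6 + fps_X ^ 7 + fps_X ^ 8 * R"
proof -
  obtain u where u: "u holomorphic_on ball 0 1"
    "\<And>q. norm q < 1 \<Longrightarrow> euler_fun q = 1 - q - q\<^sup>2 + q ^ 5 * u q"
    by (rule euler_fun_expansion) blast
  define v where "v = (\<lambda>q. - (q ^ 30) - q ^ 65 + q ^ 170 * u (q ^ 35))"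
  \<comment> \<open>The square of 1 - q - q^2 supplies the terms of A up to q^7 exactly; w collects
    all the rest.\<close>
  define w where "w = (\<lambda>q. (2 * (1 - q - q\<^sup>2) * u q + q ^ 5 * u q ^ 2)
      + (1 - q - q\<^sup>2 + q ^ 5 * u q) ^ 2 * (2 * v q + q ^ 5 * v q ^ 2))"
  have "(\<lambda>q. u (q ^ 35)) holomorphic_on ball 0 1"
    by (rule holomorphic_compose_power[OF u(1)]) simp
  then have "v holomorphic_on ball 0 1" unfolding v_def by (intro holomorphic_intros)
  then have "w holomorphic_on ball 0 1" unfolding w_def by (intro holomorphic_intros u)
  then have w: "w has_fps_expansion fps_expansion w 0"
    by (intro has_fps_expansion_fps_expansion[of "ball 0 1"]) auto
  have "(\<lambda>q. q ^ 3 - 2 * q ^ 4 - q ^ 5 + 2 * q ^ 6 + q ^ 7 + q ^ 8 * w q) has_fps_expansion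
      fps_X ^ 3 - 2 * fps_X ^ 4 - fps_X ^ 5 + 2 * fps_X ^ 6 + fps_X ^ 7 + fps_X ^ 8 * fps_expansion w 0"
    by (intro fps_expansion_intros w)
  moreover have "eventually (\<lambda>q. q ^ 3 - 2 * q ^ 4 - q ^ 5 + 2 * q ^ 6 + q ^ 7 + q ^ 8 * w q = etaA_q q) (nhds 0)"
  proof -
    have "eventually (\<lambda>q. q \<in> ball 0 1) (nhds (0::complex))" by (intro eventually_nhds_in_open) auto
    then show ?thesis
    proof eventually_elim
      case (elim q)
      have "euler_fun (q ^ 35) = 1 + q ^ 5 * v q"
        using u(2)[of "q ^ 35"] elim by (simp add: norm_power_less_1 v_def algebra_simps flip: power_mult power_add)
      then have "etaA_q q = q ^ 3 * ((1 - q - q\<^sup>2 + q ^ 5 * u q) * (1 + q ^ 5 * v q)) ^ 2"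
        unfolding etaA_q_def using u(2)[of q] elim by simp
      also have "\<dots> = q ^ 3 - 2 * q ^ 4 - q ^ 5 + 2 * q ^ 6 + q ^ 7 + q ^ 8 * w q"
        unfolding w_def by (simp add: algebra_simps eval_nat_numeral)
      finally show ?case by simp
    qed
  qed
  ultimately have "etaA_q has_fps_expansion
    fps_X ^ 3 - 2 * fps_X ^ 4 - fps_X ^ 5 + 2 * fps_X ^ 6 + fps_X ^ 7 + fps_X ^ 8 * fps_expansion w 0"
    using iffD1[OF has_fps_expansion_cong[OF _ refl]] by fast
  then show ?thesis by (rule that)
qed

lemma etaB_q_expansion:
  obtains R where "etaB_q has_fps_expansion fps_X - 2 * fps_X ^ 6 + fps_X ^ 8 * R"
proof -
  obtain u where u: "u holomorphic_on ball 0 1"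
    "\<And>q. norm q < 1 \<Longrightarrow> euler_fun q = 1 - q - q\<^sup>2 + q ^ 5 * u q"
    by (rule euler_fun_expansion) blast
  define v5 v7 where "v5 = (\<lambda>q. - (q ^ 3) + q ^ 18 * u (q ^ 5))"
    and "v7 = (\<lambda>q. - 1 - q ^ 7 + q ^ 28 * u (q ^ 7))"
  define w where "w = (\<lambda>q. q ^ 3 + 2 * v5 q - 2 * q ^ 5 * v5 q + q ^ 7 * v5 q ^ 2
      + (1 - q ^ 5 + q ^ 7 * v5 q) ^ 2 * (2 * v7 q + q ^ 7 * v7 q ^ 2))"
  have comp: "(\<lambda>q. u (q ^ n)) holomorphic_on ball 0 1" if "n > 0" for n
    by (rule holomorphic_compose_power[OF u(1) that])
  have "v5 holomorphic_on ball 0 1" "v7 holomorphic_on ball 0 1"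
    unfolding v5_def v7_def by (intro holomorphic_intros comp; simp)+
  then have "w holomorphic_on ball 0 1" unfolding w_def by (intro holomorphic_intros)
  then have w: "w has_fps_expansion fps_expansion w 0"
    by (intro has_fps_expansion_fps_expansion[of "ball 0 1"]) auto
  have "(\<lambda>q. q - 2 * q ^ 6 + q ^ 8 * w q) has_fps_expansion
      fps_X - 2 * fps_X ^ 6 + fps_X ^ 8 * fps_expansion w 0"
    by (intro fps_expansion_intros w)
  moreover have "eventually (\<lambda>q. q - 2 * q ^ 6 + q ^ 8 * w q = etaB_q q) (nhds 0)"
  proof -
    have "eventually (\<lambda>q. q \<in> ball 0 1) (nhds (0::complex))" by (intro eventually_nhds_in_open) auto
    then show ?thesis
    proof eventually_elim
      case (elim q)
      have "euler_fun (q ^ 5) = 1 - q ^ 5 + q ^ 7 * v5 q" "euler_fun (q ^ 7) = 1 + q ^ 7 * v7 q"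
        using u(2)[of "q ^ 5"] u(2)[of "q ^ 7"] elim
        by (simp_all add: norm_power_less_1 v5_def v7_def algebra_simps flip: power_mult power_add)
      then have "etaB_q q = q * ((1 - q ^ 5 + q ^ 7 * v5 q) * (1 + q ^ 7 * v7 q)) ^ 2"
        unfolding etaB_q_def by simp
      also have "\<dots> = q - 2 * q ^ 6 + q ^ 8 * w q"
        unfolding w_def by (simp add: algebra_simps eval_nat_numeral)
      finally show ?case by simp
    qed
  qed
  ultimately have "etaB_q has_fps_expansion fps_X - 2 * fps_X ^ 6 + fps_X ^ 8 * fps_expansion w 0"
    using iffD1[OF has_fps_expansion_cong[OF _ refl]] by fast
  then show ?thesis by (rule that)
qed

section \<open>The coefficients of the L-series\<close>

definition euler_coeff :: "rat weierstrass \<Rightarrow> nat \<Rightarrow> nat \<Rightarrow> complex" where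
  "euler_coeff E p k = fps_nth (inverse (euler_factor p E)) k"

lemma euler_coeff_0 [simp]: "euler_coeff E p 0 = 1"
  by (simp add: euler_coeff_def euler_factor_def)

lemma euler_coeff_Suc:
  "euler_coeff E p (Suc k) = of_int (frob_trace p E) * euler_coeff E p k
     - (if good_reduction p E \<and> k > 0 then of_nat p * euler_coeff E p (k - 1) else 0)"
proof -
  define I where "I = inverse (euler_factor p E)"
  define a :: complex where "a = of_int (frob_trace p E)"
  define b :: complex where "b = (if good_reduction p E then of_nat p else 0)"
  have L: "euler_factor p E = 1 - fps_const a * fps_X + fps_const b * fps_X ^ 2"
    by (simp add: euler_factor_def a_def b_def)
  have "fps_nth (euler_factor p E) 0 \<noteq> 0" by (simp add: euler_factor_def)
  then have "I * euler_factor p E = 1" unfolding I_def by (rule inverse_mult_eq_1)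
  then have "I = 1 + fps_const a * (fps_X * I) - fps_const b * (fps_X * (fps_X * I))"
    unfolding L by (simp add: algebra_simps power2_eq_square)
  then have "fps_nth I (Suc k) = fps_nth (1 + fps_const a * (fps_X * I) - fps_const b * (fps_X * (fps_X * I))) (Suc k)"
    by simp
  also have "\<dots> = a * fps_nth I k - (if k = 0 then 0 else b * fps_nth I (k - 1))"
    by simp
  finally show ?thesis by (auto simp: euler_coeff_def I_def a_def b_def)
qed

lemma L_coeff_eq_prod:
  assumes "finite P" "prime_factors n \<subseteq> P" "\<And>p. p \<in> P \<Longrightarrow> prime p"
  shows "L_coeff E n = (\<Prod>p\<in>P. euler_coeff E p (multiplicity p n))"
proof -
  have "euler_coeff E p (multiplicity p n) = 1" if "p \<in> P - prime_factors n" for p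
  proof -
    have "multiplicity p n = 0"
      using that assms(3) by (cases "n = 0") (auto simp: prime_factors_multiplicity)
    then show ?thesis by simp
  qed
  then show ?thesis
    unfolding L_coeff_def euler_coeff_def[symmetric]
    by (intro prod.mono_neutral_left assms) auto
qed

lemma L_coeff_prime_power_mult:
  assumes p: "prime p" and n: "n > 0" "\<not> p dvd n"
  shows "L_coeff E (p ^ k * n) = euler_coeff E p k * L_coeff E n"
proof -
  define P where "P = prime_factors n"
  have P: "finite P" "p \<notin> P" "\<And>r. r \<in> P \<Longrightarrow> prime r"
    using n by (auto simp: P_def)
  have p0: "p > 0" using p prime_gt_0_nat by blast
  have "prime_factors (p ^ k * n) \<subseteq> insert p P"
    using p n p0 by (auto simp: P_def prime_factors_product prime_factorization_prime_power split: if_splits)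
  then have "L_coeff E (p ^ k * n) = (\<Prod>r\<in>insert p P. euler_coeff E r (multiplicity r (p ^ k * n)))"
    using P p by (intro L_coeff_eq_prod) auto
  also have "\<dots> = euler_coeff E p (multiplicity p (p ^ k * n)) * (\<Prod>r\<in>P. euler_coeff E r (multiplicity r (p ^ k * n)))"
    using P by simp
  also have "multiplicity p (p ^ k * n) = k"
    using p n p0 by (subst prime_elem_multiplicity_mult_distrib) (auto simp: not_dvd_imp_multiplicity_0 prime_elem_multiplicity_power_distrib)
  also have "(\<Prod>r\<in>P. euler_coeff E r (multiplicity r (p ^ k * n))) = (\<Prod>r\<in>P. euler_coeff E r (multiplicity r n))"
  proof (rule prod.cong[OF refl])
    fix r assume r: "r \<in> P"
    then have "prime r" "r \<noteq> p" using P by auto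
    then have "multiplicity r (p ^ k) = 0"
      using p by (metis not_dvd_imp_multiplicity_0 prime_dvd_power_nat primes_dvd_imp_eq)
    then have "multiplicity r (p ^ k * n) = multiplicity r n"
      using \<open>prime r\<close> n p0 by (subst prime_elem_multiplicity_mult_distrib) auto
    then show "euler_coeff E r (multiplicity r (p ^ k * n)) = euler_coeff E r (multiplicity r n)" by simp
  qed
  also have "\<dots> = L_coeff E n" using P by (intro L_coeff_eq_prod[symmetric]) (auto simp: P_def)
  finally show ?thesis .
qed

lemma L_coeff_1 [simp]: "L_coeff E (Suc 0) = 1"
  by (simp add: L_coeff_def)

text \<open>At a bad prime the Euler factor is linear, so its inverse is a geometric series. This
  makes the coefficients an eigenvector of U_p.\<close>

lemma L_coeff_bad_prime_mult:
  assumes p: "prime p" and bad: "\<not> good_reduction p E" and n: "n > 0"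
  shows "L_coeff E (p * n) = of_int (frob_trace p E) * L_coeff E n"
proof -
  obtain m where m: "n = p ^ multiplicity p n * m" "\<not> p dvd m"
    using n p by (metis multiplicity_decompose' not_prime_unit neq0_conv)
  define k where "k = multiplicity p n"
  have m0: "m > 0" using m n by (auto intro: Nat.gr0I)
  have "p * n = p ^ Suc k * m" using m by (simp add: k_def)
  then have "L_coeff E (p * n) = euler_coeff E p (Suc k) * L_coeff E m"
    using L_coeff_prime_power_mult[OF p m0 m(2)] by metis
  also have "\<dots> = of_int (frob_trace p E) * (euler_coeff E p k * L_coeff E m)"
    using bad by (simp add: euler_coeff_Suc)
  also have "euler_coeff E p k * L_coeff E m = L_coeff E n"
    using L_coeff_prime_power_mult[OF p m0 m(2), of E k] m(1) by (simp add: k_def)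
  finally show ?thesis .
qed

section \<open>Frobenius traces for conductor 35\<close>

lemma frob_trace_good_bound:
  assumes "good_reduction p E"
  shows "frob_trace p E \<in> {int p - int p ^ 2..int p}"
proof -
  have "res_points p (minimal_model p E) \<subseteq> {0..<int p} \<times> {0..<int p}"
    by (auto simp: res_points_def)
  then have "card (res_points p (minimal_model p E)) \<le> card ({0..<int p} \<times> {0..<int p})"
    by (intro card_mono) auto
  then have "card (res_points p (minimal_model p E)) \<le> p * p" by (simp add: card_cartesian_product)
  then have "int (card (res_points p (minimal_model p E))) \<le> int p ^ 2"
    by (simp add: power2_eq_square flip: of_nat_mult)
  then show ?thesis using assms by (simp add: frob_trace_def)
qed

lemma frob_trace_multiplicative:
  assumes "\<not> good_reduction p E" "multiplicative_reduction p E"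
  shows "frob_trace p E = 1 \<or> frob_trace p E = - 1"
  using assms by (auto simp: frob_trace_def)

text \<open>Every bad prime has exponent at least 1, and additive reduction would give at least 2.
  As 35 is squarefree, both bad primes are multiplicative and the wild part never has to be
  evaluated.\<close>

lemma conductor_35:
  assumes "conductor E = 35"
  shows "prime p \<Longrightarrow> good_reduction p E \<longleftrightarrow> p \<noteq> 5 \<and> p \<noteq> 7"
    and "multiplicative_reduction 5 E" "multiplicative_reduction 7 E"
proof -
  define S where "S = {p. prime p \<and> \<not> good_reduction p E}"
  define e where "e = (\<lambda>p. conductor_exponent p E)"
  have c: "(\<Prod>p\<in>S. p ^ e p) = 35" using assms by (simp add: conductor_def S_def e_def)
  \<comment> \<open>A product over an infinite set is 1 by convention, not 35.\<close>
  have fin: "finite S" using c by (rule_tac ccontr) simp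
  have e1: "e p \<ge> 1" if "p \<in> S" for p
    using that by (auto simp: e_def conductor_exponent_def S_def)
  have p35: "prime p \<Longrightarrow> p dvd 35 \<longleftrightarrow> p = 5 \<or> p = 7" for p :: nat
  proof -
    assume p: "prime p"
    have "p dvd 35 \<longleftrightarrow> p dvd 5 \<or> p dvd 7" using prime_dvd_mult_iff[OF p, of 5 7] by simp
    then show ?thesis using primes_dvd_imp_eq[OF p, of 5] primes_dvd_imp_eq[OF p, of 7] by auto
  qed
  have dvd: "p ^ e p dvd 35" if "p \<in> S" for p
    using dvd_prodI[OF fin that, of "\<lambda>p. p ^ e p"] c by simp
  have S: "p \<in> S \<longleftrightarrow> p = 5 \<or> p = 7" if p: "prime p" for p
  proof
    assume "p \<in> S"
    then have "p dvd 35" using dvd[of p] e1[of p] by (meson dvd_power dvd_trans le_neq_implies_less less_le_trans zero_less_one)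
    then show "p = 5 \<or> p = 7" using p35 p by blast
  next
    assume "p = 5 \<or> p = 7"
    then have "p dvd (\<Prod>p\<in>S. p ^ e p)" using p35 p c by simp
    then obtain r where r: "r \<in> S" "p dvd r ^ e r" using prime_dvd_prod_iff[OF fin, of p "\<lambda>p. p ^ e p"] p by auto
    then have "p dvd r" using p prime_dvd_power by blast
    then show "p \<in> S" using r(1) p primes_dvd_imp_eq by (metis (mono_tags, lifting) S_def mem_Collect_eq)
  qed
  show "prime p \<Longrightarrow> good_reduction p E \<longleftrightarrow> p \<noteq> 5 \<and> p \<noteq> 7" using S[of p] by (auto simp: S_def)
  have mult: "multiplicative_reduction p E" if "p = 5 \<or> p = 7" for p
  proof (rule ccontr)
    assume "\<not> multiplicative_reduction p E"
    moreover have "prime p" using that by auto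
    then have pS: "p \<in> S" using S that by blast
    ultimately have "e p \<ge> 2" by (simp add: e_def conductor_exponent_def S_def)
    then have "p ^ 2 dvd 35" using dvd[OF pS] le_imp_power_dvd dvd_trans by blast
    then show False using that by auto
  qed
  show "multiplicative_reduction 5 E" "multiplicative_reduction 7 E" using mult by auto
qed

lemma L_coeff_conductor_35:
  assumes "conductor E = 35"
  obtains t2 t3 t5 t7 :: int
    where "t2 \<in> {-2..2}" "t3 \<in> {-6..3}" "t5 = 1 \<or> t5 = - 1" "t7 = 1 \<or> t7 = - 1"
      "L_coeff E 1 = 1" "L_coeff E 2 = of_int t2" "L_coeff E 3 = of_int t3"
      "L_coeff E 4 = of_int (t2\<^sup>2 - 2)" "L_coeff E 6 = of_int (t2 * t3)"
      "\<And>n. n > 0 \<Longrightarrow> L_coeff E (5 * n) = of_int t5 * L_coeff E n"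
      "\<And>n. n > 0 \<Longrightarrow> L_coeff E (7 * n) = of_int t7 * L_coeff E n"
proof -
  have good: "good_reduction 2 E" "good_reduction 3 E" "\<not> good_reduction 5 E" "\<not> good_reduction 7 E"
    using conductor_35(1)[OF assms, of 2] conductor_35(1)[OF assms, of 3]
      conductor_35(1)[OF assms, of 5] conductor_35(1)[OF assms, of 7] by simp_all
  have e1: "euler_coeff E p 1 = of_int (frob_trace p E)" for p
    using euler_coeff_Suc[of E p 0] by simp
  have e2: "euler_coeff E 2 2 = of_int ((frob_trace 2 E)\<^sup>2 - 2)"
    using euler_coeff_Suc[of E 2 1] good e1[of 2] by (simp add: numeral_2_eq_2 power2_eq_square)
  have p3: "L_coeff E 3 = of_int (frob_trace 3 E)"
    using L_coeff_prime_power_mult[of 3 1 E 1] e1[of 3] by simp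
  show ?thesis
  proof (rule that)
    show "frob_trace 2 E \<in> {-2..2}" using frob_trace_good_bound[OF good(1)] by simp
    show "frob_trace 3 E \<in> {-6..3}" using frob_trace_good_bound[OF good(2)] by simp
    show "frob_trace 5 E = 1 \<or> frob_trace 5 E = - 1" "frob_trace 7 E = 1 \<or> frob_trace 7 E = - 1"
      using frob_trace_multiplicative good conductor_35(2,3)[OF assms] by auto
    show "L_coeff E 1 = 1" by simp
    show "L_coeff E 2 = of_int (frob_trace 2 E)"
      using L_coeff_prime_power_mult[of 2 1 E 1] e1[of 2] by simp
    show "L_coeff E 3 = of_int (frob_trace 3 E)" by (rule p3)
    show "L_coeff E 4 = of_int ((frob_trace 2 E)\<^sup>2 - 2)"
      using L_coeff_prime_power_mult[of 2 1 E 2] e2 by simp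
    show "L_coeff E 6 = of_int (frob_trace 2 E * frob_trace 3 E)"
      using L_coeff_prime_power_mult[of 2 3 E 1] e1[of 2] p3 by simp
    show "L_coeff E (5 * n) = of_int (frob_trace 5 E) * L_coeff E n" if "n > 0" for n
      by (rule L_coeff_bad_prime_mult) (use good that in auto)
    show "L_coeff E (7 * n) = of_int (frob_trace 7 E) * L_coeff E n" if "n > 0" for n
      by (rule L_coeff_bad_prime_mult) (use good that in auto)
  qed
qed

section \<open>The quartic relation\<close>

text \<open>Stated over an arbitrary commutative ring, since it is applied both to values of
  functions and to formal power series.\<close>

definition quartic :: "'a::comm_ring_1 \<Rightarrow> 'a \<Rightarrow> 'a \<Rightarrow> 'a \<Rightarrow> 'a \<Rightarrow> 'a" where
  "quartic c e f A B = (f * f - A * A - B * B - c * (A * B)) * (f * f - A * A - B * B - c * (A * B))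
     - e * ((A * B) * (A * A + B * B))"

lemma quartic_swap: "quartic c e f A B = quartic c e f B A"
  by (simp add: quartic_def algebra_simps)

text \<open>Here j is the automorphy factor, s the sign acquired by f and t the common sign of A and
  B. Only even powers of the signs survive.\<close>

lemma quartic_scale:
  assumes "s * s = 1" "t * t = 1"
  shows "quartic c e (j * (s * f)) (j * (t * A)) (j * (t * B)) = j ^ 4 * quartic c e f A B"
proof -
  have 1: "(j * (s * f)) * (j * (s * f)) = (j * j) * (f * f)"
    using assms(1) by (metis (no_types, lifting) mult.assoc mult.left_commute mult_1)
  have 2: "(j * (t * x)) * (j * (t * y)) = (j * j) * (x * y)" for x y
    using assms(2) by (metis (no_types, lifting) mult.assoc mult.left_commute mult_1)
  show ?thesis
    unfolding quartic_def 1 2 by (simp add: algebra_simps power4_eq_xxxx)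
qed

section \<open>Comparison of coefficients\<close>

lemma sum_0_to_numeral:
  fixes f :: "nat \<Rightarrow> 'a::comm_monoid_add"
  shows "(\<Sum>i=0..1. f i) = f 0 + f 1"
    and "(\<Sum>i=0..2. f i) = f 0 + f 1 + f 2"
    and "(\<Sum>i=0..3. f i) = f 0 + f 1 + f 2 + f 3"
    and "(\<Sum>i=0..4. f i) = f 0 + f 1 + f 2 + f 3 + f 4"
    and "(\<Sum>i=0..5. f i) = f 0 + f 1 + f 2 + f 3 + f 4 + f 5"
    and "(\<Sum>i=0..6. f i) = f 0 + f 1 + f 2 + f 3 + f 4 + f 5 + f 6"
    and "(\<Sum>i=0..7. f i) = f 0 + f 1 + f 2 + f 3 + f 4 + f 5 + f 6 + f 7"
    and "(\<Sum>i=0..8. f i) = f 0 + f 1 + f 2 + f 3 + f 4 + f 5 + f 6 + f 7 + f 8"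
    and "(\<Sum>i=0..9. f i) = f 0 + f 1 + f 2 + f 3 + f 4 + f 5 + f 6 + f 7 + f 8 + f 9"
    and "(\<Sum>i=0..10. f i) = f 0 + f 1 + f 2 + f 3 + f 4 + f 5 + f 6 + f 7 + f 8 + f 9 + f 10"
  by (simp_all add: eval_nat_numeral)

text \<open>The letters x, y, z stand for a_2, a_3, a_5. By the choice of c, X starts with 2x(q^3 -
  q^4), so its square and the term subtracted from it both start with 4x^2(q^6 - 2q^7). As X has
  order at least 3, its coefficients up to q^7 determine N up to q^10.\<close>

lemma quartic_fps_coeffs:
  fixes F A B :: "complex fps" and x y z :: complex
  defines "c \<equiv> x\<^sup>2 + 2 * y + 2 * x"
  defines "N \<equiv> quartic (fps_const c) (fps_const (4 * x\<^sup>2)) F A B"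
  defines "X5 \<equiv> 2 * (x\<^sup>2 - 2) + 2 * x * y + 2 * c"
    and "X6 \<equiv> 2 * z + 2 * x * (x\<^sup>2 - 2) + y\<^sup>2 - 1 + c"
    and "X7 \<equiv> 2 * (x * y + x * z + y * (x\<^sup>2 - 2)) + 8 - 2 * c"
  assumes F: "fps_nth F 0 = 0" "fps_nth F 1 = 1" "fps_nth F 2 = x" "fps_nth F 3 = y" "fps_nth F 4 = x\<^sup>2 - 2"
      "fps_nth F 5 = z" "fps_nth F 6 = x * y"
    and A: "fps_nth A 0 = 0" "fps_nth A 1 = 0" "fps_nth A 2 = 0" "fps_nth A 3 = 1" "fps_nth A 4 = -2"
      "fps_nth A 5 = -1" "fps_nth A 6 = 2" "fps_nth A 7 = 1"
    and B: "fps_nth B 0 = 0" "fps_nth B 1 = 1" "fps_nth B 2 = 0" "fps_nth B 3 = 0" "fps_nth B 4 = 0"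
      "fps_nth B 5 = 0" "fps_nth B 6 = -2" "fps_nth B 7 = 0"
  shows "\<And>j. j < 8 \<Longrightarrow> fps_nth N j = 0"
    and "fps_nth N 8 = 8 * x\<^sup>2 + 4 * x * X5"
    and "fps_nth N 9 = 4 * x * X6 - 4 * x * X5 - 8 * x\<^sup>2"
    and "fps_nth N 10 = X5\<^sup>2 + 4 * x * X7 - 4 * x * X6 - 8 * x\<^sup>2"
    and "fps_nth ((A * B) * (A * B)) 8 = 1" "fps_nth ((A * B) * (A * B)) 9 = - 4"
      "fps_nth ((A * B) * (A * B)) 10 = 2"
proof -
  note sums = fps_mult_nth sum_0_to_numeral
  note F' = F F(2)[unfolded One_nat_def] and A' = A A(2)[unfolded One_nat_def] and B' = B B(2)[unfolded One_nat_def]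
  define C where "C = A * B"
  have C: "fps_nth C 0 = 0" "fps_nth C 1 = 0" "fps_nth C 2 = 0" "fps_nth C 3 = 0" "fps_nth C 4 = 1"
    "fps_nth C 5 = -2" "fps_nth C 6 = -1" "fps_nth C 7 = 2" "fps_nth C 8 = 1"
    unfolding C_def by (simp_all add: sums A' B')
  define D where "D = A * A + B * B"
  have D: "fps_nth D 0 = 0" "fps_nth D 1 = 0" "fps_nth D 2 = 1" "fps_nth D 3 = 0" "fps_nth D 4 = 0"
    "fps_nth D 5 = 0" "fps_nth D 6 = 1" "fps_nth D 7 = - 8"
    unfolding D_def by (simp_all add: sums A' B')
  define G where "G = F * F"
  have G: "fps_nth G 0 = 0" "fps_nth G 1 = 0" "fps_nth G 2 = 1" "fps_nth G 3 = 2 * x" "fps_nth G 4 = x\<^sup>2 + 2 * y"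
    "fps_nth G 5 = 2 * (x\<^sup>2 - 2) + 2 * x * y" "fps_nth G 6 = 2 * z + 2 * x * (x\<^sup>2 - 2) + y\<^sup>2"
    "fps_nth G 7 = 2 * (x * y) + 2 * x * z + 2 * y * (x\<^sup>2 - 2)"
    unfolding G_def by (simp_all add: sums F' algebra_simps power2_eq_square)
  note C' = C C(2)[unfolded One_nat_def] and D' = D D(2)[unfolded One_nat_def]
  define X where "X = F * F - A * A - B * B - fps_const c * (A * B)"
  have X_eq: "X = G - D - fps_const c * C" by (simp add: X_def G_def D_def C_def)
  have X: "fps_nth X 0 = 0" "fps_nth X 1 = 0" "fps_nth X 2 = 0" "fps_nth X 3 = 2 * x" "fps_nth X 4 = - 2 * x"
    "fps_nth X 5 = X5" "fps_nth X 6 = X6" "fps_nth X 7 = X7"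
    unfolding X_eq X5_def X6_def X7_def by (simp_all add: G D' C' G(2)[unfolded One_nat_def] c_def algebra_simps)
  have N_eq: "N = X * X - fps_const (4 * x\<^sup>2) * (C * D)"
    by (simp add: N_def quartic_def X_def C_def D_def)
  note X' = X X(2)[unfolded One_nat_def]
  have "fps_nth N 0 = 0" "fps_nth N 1 = 0" "fps_nth N 2 = 0" "fps_nth N 3 = 0" "fps_nth N 4 = 0"
    "fps_nth N 5 = 0" "fps_nth N 6 = 0" "fps_nth N 7 = 0"
    unfolding N_eq by (simp_all add: sums X' C' D' power2_eq_square)
  then show "fps_nth N j = 0" if "j < 8" for j
    using that by (auto simp: less_Suc_eq numeral_eq_Suc)
  show "fps_nth N 8 = 8 * x\<^sup>2 + 4 * x * X5"
    "fps_nth N 9 = 4 * x * X6 - 4 * x * X5 - 8 * x\<^sup>2"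
    "fps_nth N 10 = X5\<^sup>2 + 4 * x * X7 - 4 * x * X6 - 8 * x\<^sup>2"
    unfolding N_eq by (simp_all add: sums X' C' D' power2_eq_square algebra_simps)
  show "fps_nth ((A * B) * (A * B)) 8 = 1" "fps_nth ((A * B) * (A * B)) 9 = - 4"
      "fps_nth ((A * B) * (A * B)) 10 = 2"
    unfolding C_def[symmetric] by (simp_all add: sums C')
qed

text \<open>N is a multiple of (AB)^2 = q^8 - 4q^9 + 2q^10 + ..., and the multiple is the
  coefficient N8. The ranges leave 100 cases.\<close>

lemma coefficient_equations:
  fixes x y z :: int
  defines "c \<equiv> x\<^sup>2 + 2 * y + 2 * x"
  defines "X5 \<equiv> 2 * (x\<^sup>2 - 2) + 2 * x * y + 2 * c"
    and "X6 \<equiv> 2 * z + 2 * x * (x\<^sup>2 - 2) + y\<^sup>2 - 1 + c"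
    and "X7 \<equiv> 2 * (x * y + x * z + y * (x\<^sup>2 - 2)) + 8 - 2 * c"
  defines "N8 \<equiv> 8 * x\<^sup>2 + 4 * x * X5"
  assumes "x \<in> {-2..2}" "y \<in> {-6..3}" "z = 1 \<or> z = - 1"
    and N9: "4 * x * X6 - 4 * x * X5 - 8 * x\<^sup>2 = - 4 * N8"
    and N10: "X5\<^sup>2 + 4 * x * X7 - 4 * x * X6 - 8 * x\<^sup>2 = 2 * N8"
  shows "x = 0 \<and> y = 1"
proof -
  have "x = - 2 \<or> x = - 1 \<or> x = 0 \<or> x = 1 \<or> x = 2" using assms(6) by auto
  moreover have "y = - 6 \<or> y = - 5 \<or> y = - 4 \<or> y = - 3 \<or> y = - 2 \<or> y = - 1 \<or> y = 0 \<or> y = 1 \<or> y = 2 \<or> y = 3"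
    using assms(7) unfolding atLeastAtMost_iff by presburger
  ultimately show ?thesis
    using assms(8) N9 N10 unfolding N8_def X5_def X6_def X7_def c_def
    by (elim disjE; simp)
qed

lemma fps_zero_coeffs_bound:
  fixes h :: "complex \<Rightarrow> complex"
  assumes h: "h has_fps_expansion H" and zero: "\<And>j. j < n \<Longrightarrow> fps_nth H j = 0"
  shows "\<exists>K. eventually (\<lambda>q. norm (h q) \<le> K * norm q ^ n) (nhds 0)"
proof -
  define H' where "H' = fps_shift n H"
  have "H = H' * fps_X ^ n"
    by (rule fps_ext) (simp add: H'_def fps_X_power_mult_right_nth zero)
  have rad: "fps_conv_radius H' > 0" using h by (simp add: H'_def has_fps_expansion_def)
  then have h': "eval_fps H' has_fps_expansion H'" by (rule eval_fps_has_fps_expansion)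
  then have "(\<lambda>q. eval_fps H' q * q ^ n) has_fps_expansion H"
    unfolding \<open>H = H' * fps_X ^ n\<close> by (intro fps_expansion_intros)
  then have ev: "eventually (\<lambda>q. h q = eval_fps H' q * q ^ n) (nhds 0)"
    using h unfolding has_fps_expansion_def by (auto elim: eventually_elim2)
  have "isCont (eval_fps H') 0" using has_fps_expansion_imp_continuous[OF h'] by simp
  then have "(eval_fps H' \<longlongrightarrow> eval_fps H' 0) (nhds 0)"
    by (simp add: isCont_def tendsto_at_iff_tendsto_nhds)
  then have "((\<lambda>q. norm (eval_fps H' q)) \<longlongrightarrow> norm (eval_fps H' 0)) (nhds 0)"
    by (rule tendsto_norm)
  then have "eventually (\<lambda>q. norm (eval_fps H' q) < norm (eval_fps H' 0) + 1) (nhds 0)"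
    by (rule order_tendstoD) simp
  with ev have "eventually (\<lambda>q. norm (h q) \<le> (norm (eval_fps H' 0) + 1) * norm q ^ n) (nhds 0)"
  proof eventually_elim
    case (elim q)
    then show ?case by (simp add: norm_mult norm_power mult_right_mono)
  qed
  then show ?thesis by blast
qed

lemma dvd_35_cases:
  fixes Q :: int
  assumes "Q > 0" "Q dvd 35"
  shows "Q = 1 \<or> Q = 5 \<or> Q = 7 \<or> Q = 35"
proof -
  obtain k where k: "35 = Q * k" using assms(2) by blast
  then have "k > 0" using assms(1) by (metis zero_less_mult_pos zero_less_numeral)
  have "Q \<le> 5 \<or> k \<le> 5"
  proof (rule ccontr)
    assume "\<not> (Q \<le> 5 \<or> k \<le> 5)"
    then have "6 * 6 \<le> Q * k" by (intro mult_mono) auto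
    then show False using k by simp
  qed
  then have "Q = 1 \<or> Q = 2 \<or> Q = 3 \<or> Q = 4 \<or> Q = 5 \<or> k = 1 \<or> k = 2 \<or> k = 3 \<or> k = 4 \<or> k = 5"
    using assms(1) \<open>k > 0\<close> by presburger
  then show ?thesis using k by (elim disjE; clarsimp; presburger)
qed

lemma moebius_of_nslash:
  assumes "Im \<tau> > 0" "a * d - b * c = Q" "Q > 0" "nslash g a b c d \<tau> = v"
  shows "g (moebius a b c d \<tau>) = (of_int c * \<tau> + of_int d) ^ 2 / of_int Q * v"
proof -
  have "of_int c * \<tau> + of_int d \<noteq> 0" using moebius_denom_nonzero[OF assms(1), of a d b c] assms by simp
  then show ?thesis
    using assms(3) unfolding assms(4)[symmetric] nslash_def assms(2) slash_eq_moebius by simp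
qed

theorem level_35_identity:
  fixes a :: "nat \<Rightarrow> complex" and t2 t3 t5 t7 :: int
  assumes f: "f \<in> cusp_forms 2 35"
    and sums: "\<And>\<tau>. Im \<tau> > 0 \<Longrightarrow> (\<lambda>n. a n * nome \<tau> ^ n) sums f \<tau>"
    and t: "t2 \<in> {-2..2}" "t3 \<in> {-6..3}" "t5 = 1 \<or> t5 = - 1" "t7 = 1 \<or> t7 = - 1"
    and a: "a 0 = 0" "a 1 = 1" "a 2 = of_int t2" "a 3 = of_int t3" "a 4 = of_int (t2\<^sup>2 - 2)"
      "a 6 = of_int (t2 * t3)"
    and a5: "\<And>n. a (5 * n) = of_int t5 * a n" and a7: "\<And>n. a (7 * n) = of_int t7 * a n"
    and \<tau>: "Im \<tau> > 0"
  shows "f \<tau> = etaA \<tau> + etaB \<tau>"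
proof -
  have hol: "f holomorphic_on upper_half_plane" using f by (simp add: cusp_forms_def)
  have inv: "weight2_invariant 35 f" using cusp_form_weight2_invariant[OF f] by simp

  have f5: "nslash f 15 2 35 5 \<tau> = - of_int t5 * f \<tau>" if "Im \<tau> > 0" for \<tau>
    by (rule cusp_form_atkin_lehner_eigen[where p = 5 and M = 7 and a' = 21 and b' = 4 and c' = 35 and d' = 7])
      (use f Hecke_U_eigen[of 5 a f, OF _ sums a5] that in \<open>simp_all add: atkin_lehner_def\<close>)
  have f7: "nslash f 21 4 35 7 \<tau> = - of_int t7 * f \<tau>" if "Im \<tau> > 0" for \<tau>
    by (rule cusp_form_atkin_lehner_eigen[where p = 7 and M = 5 and a' = 15 and b' = 2 and c' = 35 and d' = 5])
      (use f Hecke_U_eigen[of 7 a f, OF _ sums a7] that in \<open>simp_all add: atkin_lehner_def\<close>)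
  have twice: "nslash (nslash etaA x1 x2 x3 x4) x1 x2 x3 x4 \<tau> = etaA \<tau>"
    if "atkin_lehner 35 Q x1 x2 x3 x4" "Q dvd 35" "Q > 0" "Im \<tau> > 0" for Q x1 x2 x3 x4 \<tau>
    by (rule nslash_atkin_lehner_twice[OF weight2_invariant_etaA that(1,1) that(2-4)])
  have B5: "nslash etaB 15 2 35 5 \<tau> = etaA \<tau>" if "Im \<tau> > 0" for \<tau>
  proof -
    have "nslash etaB 15 2 35 5 \<tau> = nslash (nslash etaA 15 2 35 5) 15 2 35 5 \<tau>"
      by (rule nslash_cong) (use that etaA_W5 in auto)
    then show ?thesis using twice[OF atkin_lehner_W5 _ _ that] by simp
  qed
  have B7: "nslash etaB 21 4 35 7 \<tau> = - etaA \<tau>" if "Im \<tau> > 0" for \<tau>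
  proof -
    have "nslash etaB 21 4 35 7 \<tau> = - nslash (\<lambda>\<tau>. - etaB \<tau>) 21 4 35 7 \<tau>"
      by (simp add: nslash_def slash_def)
    also have "nslash (\<lambda>\<tau>. - etaB \<tau>) 21 4 35 7 \<tau> = nslash (nslash etaA 21 4 35 7) 21 4 35 7 \<tau>"
      by (rule nslash_cong) (use that etaA_W7 in auto)
    finally show ?thesis using twice[OF atkin_lehner_W7 _ _ that] by simp
  qed
  \<comment> \<open>The matrix is the product of those for 5 and 7.\<close>
  have W35: "nslash g 385 74 910 175 \<tau> = nslash (nslash g 15 2 35 5) 21 4 35 7 \<tau>" if "Im \<tau> > 0" for g \<tau>
    using nslash_nslash[OF that, of 21 7 4 35 g 15 2 35 5] by simp
  have f35: "nslash f 385 74 910 175 \<tau> = of_int (t5 * t7) * f \<tau>" if "Im \<tau> > 0" for \<tau>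
  proof -
    have "nslash f 385 74 910 175 \<tau> = nslash (\<lambda>\<tau>. - of_int t5 * f \<tau>) 21 4 35 7 \<tau>"
      unfolding W35[OF that] by (rule nslash_cong) (use that f5 in auto)
    also have "\<dots> = - of_int t5 * nslash f 21 4 35 7 \<tau>" by (simp add: nslash_def slash_def)
    finally show ?thesis using f7[OF that] by simp
  qed
  have A35: "nslash etaA 385 74 910 175 \<tau> = - etaA \<tau>" if "Im \<tau> > 0" for \<tau>
  proof -
    have "nslash etaA 385 74 910 175 \<tau> = nslash etaB 21 4 35 7 \<tau>"
      unfolding W35[OF that] by (rule nslash_cong) (use that etaA_W5 in auto)
    then show ?thesis using B7[OF that] by simp
  qed
  have B35: "nslash etaB 385 74 910 175 \<tau> = - etaB \<tau>" if "Im \<tau> > 0" for \<tau>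
  proof -
    have "nslash etaB 385 74 910 175 \<tau> = nslash etaA 21 4 35 7 \<tau>"
      unfolding W35[OF that] by (rule nslash_cong) (use that B5 in auto)
    then show ?thesis using etaA_W7[OF that] by simp
  qed

  \<comment> \<open>\<open>etaA\<close> and \<open>etaB\<close> always share the sign t, whether
    exchanged or not, whereas f has a sign s of its own.\<close>
  have sym: "\<exists>s t. s * s = 1 \<and> t * t = 1 \<and> nslash f x1 x2 x3 x4 \<tau> = s * f \<tau> \<and>
      (nslash etaA x1 x2 x3 x4 \<tau> = t * etaA \<tau> \<and> nslash etaB x1 x2 x3 x4 \<tau> = t * etaB \<tau> \<or>
       nslash etaA x1 x2 x3 x4 \<tau> = t * etaB \<tau> \<and> nslash etaB x1 x2 x3 x4 \<tau> = t * etaA \<tau>)"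
    if Q: "Q > 0" "Q dvd 35" and V: "atkin_lehner 35 Q x1 x2 x3 x4" and \<tau>: "Im \<tau> > 0" for Q x1 x2 x3 x4 \<tau>
  proof -
    have red: "nslash g x1 x2 x3 x4 \<tau> = nslash g y1 y2 y3 y4 \<tau>"
      if "atkin_lehner 35 Q y1 y2 y3 y4" "g = f \<or> g = etaA \<or> g = etaB" for g y1 y2 y3 y4
      using nslash_atkin_lehner[OF _ V that(1) Q(2,1) \<tau>, of g] that(2)
        inv weight2_invariant_etaA weight2_invariant_etaB by blast
    have s5: "of_int t5 * of_int t5 = (1::complex)" and s7: "of_int t7 * of_int t7 = (1::complex)"
      using t(3,4) by auto
    from dvd_35_cases[OF Q] consider "Q = 1" | "Q = 5" | "Q = 7" | "Q = 35" by blast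
    then show ?thesis
    proof cases
      case 1
      have al: "atkin_lehner 35 Q 1 0 0 1" by (simp add: 1 atkin_lehner_def)
      have "nslash g 1 0 0 1 \<tau> = g \<tau>" for g by (simp add: nslash_def slash_def)
      then show ?thesis using red[OF al] by (intro exI[of _ 1]) simp
    next
      case 2
      have al: "atkin_lehner 35 Q 15 2 35 5" by (simp add: 2 atkin_lehner_def)
      show ?thesis
        using red[OF al] f5[OF \<tau>] etaA_W5[OF \<tau>] B5[OF \<tau>] s5
        by (intro exI[of _ "- of_int t5"] exI[of _ 1]) simp
    next
      case 3
      have al: "atkin_lehner 35 Q 21 4 35 7" by (simp add: 3 atkin_lehner_def)
      show ?thesis
        using red[OF al] f7[OF \<tau>] etaA_W7[OF \<tau>] B7[OF \<tau>] s7
        by (intro exI[of _ "- of_int t7"] exI[of _ "-1"]) simp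
    next
      case 4
      have al: "atkin_lehner 35 Q 385 74 910 175" by (simp add: 4 atkin_lehner_def)
      have "of_int (t5 * t7) * of_int (t5 * t7) = (of_int t5 * of_int t5) * (of_int t7 * of_int t7 :: complex)"
        by simp
      then have "of_int (t5 * t7) * of_int (t5 * t7) = (1::complex)" unfolding s5 s7 by simp
      then show ?thesis
        using red[OF al] f35[OF \<tau>] A35[OF \<tau>] B35[OF \<tau>]
        by (intro exI[of _ "of_int (t5 * t7)"] exI[of _ "-1"]) simp
    qed
  qed

  define c e :: complex where "c = of_int t2 ^ 2 + 2 * of_int t3 + 2 * of_int t2" and "e = 4 * of_int t2 ^ 2"
  define \<phi> where "\<phi> = (\<lambda>\<tau>. quartic c e (f \<tau>) (etaA \<tau>) (etaB \<tau>) / ((etaA \<tau> * etaB \<tau>) * (etaA \<tau> * etaB \<tau>)))"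
  have \<phi>_inv: "\<phi> (moebius x1 x2 x3 x4 \<tau>) = \<phi> \<tau>"
    if Q: "Q > 0" "Q dvd 35" and V: "atkin_lehner 35 Q x1 x2 x3 x4" and \<tau>: "Im \<tau> > 0" for Q x1 x2 x3 x4 \<tau>
  proof -
    define j where "j = (of_int x3 * \<tau> + of_int x4) ^ 2 / of_int Q"
    have det: "x1 * x4 - x2 * x3 = Q" using V by (simp add: atkin_lehner_def)
    have "j \<noteq> 0"
      using moebius_denom_nonzero[OF \<tau>, of x1 x4 x2 x3] det Q(1) by (simp add: j_def)
    note m = moebius_of_nslash[OF \<tau> det Q(1), folded j_def]
    obtain s t where st: "s * s = 1" "t * t = 1" "nslash f x1 x2 x3 x4 \<tau> = s * f \<tau>"
      "nslash etaA x1 x2 x3 x4 \<tau> = t * etaA \<tau> \<and> nslash etaB x1 x2 x3 x4 \<tau> = t * etaB \<tau> \<or>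
       nslash etaA x1 x2 x3 x4 \<tau> = t * etaB \<tau> \<and> nslash etaB x1 x2 x3 x4 \<tau> = t * etaA \<tau>"
      using sym[OF Q V \<tau>] by blast
    have tt: "(j * (t * u)) * (j * (t * v)) = (j * j) * (u * v)" for u v
      using st(2) by (metis (no_types, lifting) mult.assoc mult.left_commute mult_1)
    have jj: "(j * j * w) * (j * j * w) = j ^ 4 * (w * w)" for w
      by (simp add: power4_eq_xxxx mult_ac)
    from st(4) show ?thesis
    proof
      assume *: "nslash etaA x1 x2 x3 x4 \<tau> = t * etaA \<tau> \<and> nslash etaB x1 x2 x3 x4 \<tau> = t * etaB \<tau>"
      show ?thesis
        unfolding \<phi>_def m[OF st(3)] m[OF *[THEN conjunct1]] m[OF *[THEN conjunct2]]
          quartic_scale[OF st(1,2)] tt jj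
        using \<open>j \<noteq> 0\<close> by simp
    next
      assume *: "nslash etaA x1 x2 x3 x4 \<tau> = t * etaB \<tau> \<and> nslash etaB x1 x2 x3 x4 \<tau> = t * etaA \<tau>"
      show ?thesis
        unfolding \<phi>_def m[OF st(3)] m[OF *[THEN conjunct1]] m[OF *[THEN conjunct2]]
          quartic_scale[OF st(1,2)] tt jj
        using \<open>j \<noteq> 0\<close> by (simp add: quartic_swap[of c e "f \<tau>" "etaB \<tau>"] mult.commute[of "etaB \<tau>"])
    qed
  qed

  have \<phi>_hol: "\<phi> holomorphic_on upper_half_plane"
    unfolding \<phi>_def quartic_def
    by (intro holomorphic_intros hol holomorphic_eta_pair)
      (auto simp: upper_half_plane_def eta_pair_nonzero)

  define F where "F = Abs_fps a"
  define fq where "fq = eval_fps F"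
  \<comment> \<open>Every r with 0 < r < 1 is a value of \<open>nome\<close>, so the expansion in
    the half plane yields convergence at r.\<close>
  have "fps_conv_radius F \<ge> 1"
    unfolding fps_conv_radius_def F_def
  proof (rule conv_radius_geI_ex')
    fix r :: real assume r: "0 < r" "ereal r < 1"
    then obtain \<sigma> where "Im \<sigma> > 0" "nome \<sigma> = of_real r" using nome_surj[of "of_real r"] by auto
    then show "summable (\<lambda>n. fps_nth (Abs_fps a) n * of_real r ^ n)"
      using sums[of \<sigma>] by (auto simp: sums_iff)
  qed
  then have "fq holomorphic_on ball 0 1"
    unfolding fq_def by (intro holomorphic_on_eval_fps ball_eball_mono) (simp add: one_ereal_def)
  note hol_fq = this
  have F: "fq has_fps_expansion F"
    unfolding fq_def
    by (intro eval_fps_has_fps_expansion less_le_trans[OF _ \<open>fps_conv_radius F \<ge> 1\<close>]) simp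
  have fq: "f \<tau> = fq (nome \<tau>)" if "Im \<tau> > 0" for \<tau>
    using sums[OF that] by (simp add: fq_def eval_fps_def F_def sums_iff)
  obtain RA where A: "etaA_q has_fps_expansion
      fps_X ^ 3 - 2 * fps_X ^ 4 - fps_X ^ 5 + 2 * fps_X ^ 6 + fps_X ^ 7 + fps_X ^ 8 * RA"
    by (rule etaA_q_expansion)
  obtain RB where B: "etaB_q has_fps_expansion fps_X - 2 * fps_X ^ 6 + fps_X ^ 8 * RB"
    by (rule etaB_q_expansion)
  define A B where "A = fps_X ^ 3 - 2 * fps_X ^ 4 - fps_X ^ 5 + 2 * fps_X ^ 6 + fps_X ^ 7 + fps_X ^ 8 * RA"
    and "B = fps_X - 2 * fps_X ^ 6 + fps_X ^ 8 * RB"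
  note A = A[folded A_def] and B = B[folded B_def]
  have F_nth: "fps_nth F 0 = 0" "fps_nth F 1 = 1" "fps_nth F 2 = of_int t2" "fps_nth F 3 = of_int t3"
    "fps_nth F 4 = (of_int t2)\<^sup>2 - 2" "fps_nth F 5 = of_int t5" "fps_nth F 6 = of_int t2 * of_int t3"
    using a a5[of 1] by (simp_all add: F_def)
  have A_nth: "fps_nth A 0 = 0" "fps_nth A 1 = 0" "fps_nth A 2 = 0" "fps_nth A 3 = 1" "fps_nth A 4 = -2"
      "fps_nth A 5 = -1" "fps_nth A 6 = 2" "fps_nth A 7 = 1"
    by (simp_all add: A_def fps_X_power_mult_nth)
  have B_nth: "fps_nth B 0 = 0" "fps_nth B 1 = 1" "fps_nth B 2 = 0" "fps_nth B 3 = 0" "fps_nth B 4 = 0"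
      "fps_nth B 5 = 0" "fps_nth B 6 = -2" "fps_nth B 7 = 0"
    by (simp_all add: B_def fps_X_power_mult_nth)
  define N where "N = quartic (fps_const c) (fps_const e) F A B"
  define Nq where "Nq = (\<lambda>q. quartic c e (fq q) (etaA_q q) (etaB_q q))"
  have N: "Nq has_fps_expansion N"
    unfolding Nq_def N_def quartic_def by (intro fps_expansion_intros F A B)
  note coeffs = quartic_fps_coeffs[OF F_nth A_nth B_nth, folded c_def e_def, folded N_def]

  \<comment> \<open>The product AB is q^4 g(q)^2 with g(0) = 1. So (AB)^2 has order exactly 8, the
    order to which the numerator is known to vanish; this bounds \<open>\<phi>\<close> at
    infinity.\<close>
  define g where "g = (\<lambda>q. euler_fun q * euler_fun (q ^ 35) * euler_fun (q ^ 5) * euler_fun (q ^ 7))"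
  have AB: "(etaA_q q * etaB_q q) * (etaA_q q * etaB_q q) = q ^ 8 * g q ^ 4" for q
    by (simp add: etaA_q_def etaB_q_def g_def power_mult_distrib) (simp add: eval_nat_numeral mult_ac)
  have "g holomorphic_on ball 0 1"
    unfolding g_def by (intro holomorphic_intros) (auto simp: norm_power power_less_one_iff)
  then have "isCont g 0"
    using continuous_on_interior[OF holomorphic_on_imp_continuous_on, of g "ball 0 1" 0] by simp
  then have "(g \<longlongrightarrow> g 0) (nhds 0)" by (simp add: isCont_def tendsto_at_iff_tendsto_nhds)
  moreover have "g 0 = 1" by (simp add: g_def)
  ultimately have "(g \<longlongrightarrow> 1) (nhds 0)" by simp
  then have "((\<lambda>q. norm (g q ^ 4)) \<longlongrightarrow> norm ((1::complex) ^ 4)) (nhds 0)"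
    by (intro tendsto_intros)
  then have g_ev: "eventually (\<lambda>q. norm (g q ^ 4) > 1 / 2) (nhds 0)"
    by (rule order_tendstoD) simp
  obtain K where K: "eventually (\<lambda>q. norm (Nq q) \<le> K * norm q ^ 8) (nhds 0)"
    using fps_zero_coeffs_bound[OF N coeffs(1)] by blast
  have "eventually (\<lambda>q. norm (Nq q / (q ^ 8 * g q ^ 4)) \<le> 2 * K) (at 0)"
  proof -
    have "eventually (\<lambda>q::complex. q \<noteq> 0) (at 0)" by (simp add: eventually_at_filter)
    moreover have "eventually (\<lambda>q. norm (g q ^ 4) > 1 / 2) (at 0)"
      "eventually (\<lambda>q. norm (Nq q) \<le> K * norm q ^ 8) (at 0)"
      using g_ev K by (auto simp: eventually_at_filter elim: eventually_mono)
    ultimately show ?thesis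
    proof eventually_elim
      case (elim q)
      have q8: "norm q ^ 8 > 0" using elim(1) by simp
      have K0: "K \<ge> 0" using elim(3) q8 by (meson norm_ge_zero order_trans zero_le_mult_iff not_le less_le_not_le)
      have "norm (Nq q) \<le> K * norm q ^ 8" by (rule elim(3))
      also have "\<dots> \<le> (2 * K) * (norm q ^ 8 * norm (g q ^ 4))"
      proof -
        have "K * norm q ^ 8 * 1 \<le> K * norm q ^ 8 * (2 * norm (g q ^ 4))"
          using elim(2) K0 q8 by (intro mult_left_mono) auto
        then show ?thesis by (simp add: mult_ac)
      qed
      finally have *: "norm (Nq q) \<le> (2 * K) * (norm q ^ 8 * norm (g q ^ 4))" .
      have "norm q ^ 8 * norm (g q ^ 4) > 0"
        using q8 elim(2) by (intro mult_pos_pos) linarith+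
      then show ?case using * by (simp add: norm_divide norm_mult norm_power divide_le_eq)
    qed
  qed
  from eventually_compose_filterlim[OF this filterlim_nome]
  have "eventually (\<lambda>\<tau>. norm (Nq (nome \<tau>) / (nome \<tau> ^ 8 * g (nome \<tau>) ^ 4)) \<le> 2 * K) (filtercomap Im at_top)" .
  with eventually_Im_pos have \<phi>_bdd: "eventually (\<lambda>\<tau>. norm (\<phi> \<tau>) \<le> 2 * K) (filtercomap Im at_top)"
  proof eventually_elim
    case (elim \<tau>)
    then show ?case by (simp add: \<phi>_def etaA_nome etaB_nome fq AB Nq_def)
  qed

  have sqf: "squarefree (35::int)"
  proof -
    have "coprime (5::int) 7" by (rule primes_coprime) auto
    then have "squarefree (5 * 7 :: int)"
      by (intro squarefree_mult_coprime squarefree_prime) auto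
    then show ?thesis by simp
  qed
  have "\<exists>k. \<forall>\<tau>. Im \<tau> > 0 \<longrightarrow> \<phi> \<tau> = k"
    by (rule atkin_lehner_invariant_constant[OF _ sqf \<phi>_hol \<phi>_inv \<phi>_bdd]) auto
  then obtain k where k: "\<And>\<tau>. Im \<tau> > 0 \<Longrightarrow> \<phi> \<tau> = k" by blast
  have Nq_k: "quartic c e (f \<tau>) (etaA \<tau>) (etaB \<tau>) = k * ((etaA \<tau> * etaB \<tau>) * (etaA \<tau> * etaB \<tau>))"
    if "Im \<tau> > 0" for \<tau>
    using k[OF that] eta_pair_nonzero[of 1 35 \<tau>] eta_pair_nonzero[of 5 7 \<tau>] that
    by (simp add: \<phi>_def field_simps)
  have Nq_k': "Nq q = k * ((etaA_q q * etaB_q q) * (etaA_q q * etaB_q q))" if q: "norm q < 1" for q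
  proof (cases "q = 0")
    case True
    have "fq 0 = 0" using F_nth(1) by (simp add: fq_def eval_fps_at_0)
    then show ?thesis using True by (simp add: Nq_def quartic_def etaA_q_def etaB_q_def)
  next
    case False
    obtain \<sigma> where \<sigma>: "Im \<sigma> > 0" "nome \<sigma> = q" by (rule nome_surj[OF False q])
    show ?thesis
      using Nq_k[OF \<sigma>(1)] unfolding Nq_def etaA_nome etaB_nome fq[OF \<sigma>(1)] \<sigma>(2) .
  qed
  have "(\<lambda>q. k * ((etaA_q q * etaB_q q) * (etaA_q q * etaB_q q))) has_fps_expansion fps_const k * ((A * B) * (A * B))"
    by (intro fps_expansion_intros A B)
  moreover have "eventually (\<lambda>q. q \<in> ball 0 1) (nhds (0::complex))" by (intro eventually_nhds_in_open) auto
  then have "eventually (\<lambda>q. Nq q = k * ((etaA_q q * etaB_q q) * (etaA_q q * etaB_q q))) (nhds 0)"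
    by eventually_elim (simp add: Nq_k')
  ultimately have "Nq has_fps_expansion fps_const k * ((A * B) * (A * B))"
    using has_fps_expansion_cong[OF _ refl] by fast
  then have N_eq: "N = fps_const k * ((A * B) * (A * B))"
    using N fps_expansion_unique_complex by blast
  have k8: "fps_nth N 8 = k" "fps_nth N 9 = - 4 * fps_nth N 8" "fps_nth N 10 = 2 * fps_nth N 8"
    unfolding N_eq using coeffs(5-7) by simp_all
  have t23: "t2 = 0 \<and> t3 = 1"
  proof (rule coefficient_equations[OF t(1-3)])
    show "4 * t2 * (2 * t5 + 2 * t2 * (t2\<^sup>2 - 2) + t3\<^sup>2 - 1 + (t2\<^sup>2 + 2 * t3 + 2 * t2)) -
      4 * t2 * (2 * (t2\<^sup>2 - 2) + 2 * t2 * t3 + 2 * (t2\<^sup>2 + 2 * t3 + 2 * t2)) - 8 * t2\<^sup>2 =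
      - 4 * (8 * t2\<^sup>2 + 4 * t2 * (2 * (t2\<^sup>2 - 2) + 2 * t2 * t3 + 2 * (t2\<^sup>2 + 2 * t3 + 2 * t2)))"
      using k8(2) unfolding coeffs(2,3) c_def by (simp only: of_int_eq_iff[symmetric, where 'a = complex]) simp
    show "(2 * (t2\<^sup>2 - 2) + 2 * t2 * t3 + 2 * (t2\<^sup>2 + 2 * t3 + 2 * t2))\<^sup>2 +
      4 * t2 * (2 * (t2 * t3 + t2 * t5 + t3 * (t2\<^sup>2 - 2)) + 8 - 2 * (t2\<^sup>2 + 2 * t3 + 2 * t2)) -
      4 * t2 * (2 * t5 + 2 * t2 * (t2\<^sup>2 - 2) + t3\<^sup>2 - 1 + (t2\<^sup>2 + 2 * t3 + 2 * t2)) - 8 * t2\<^sup>2 =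
      2 * (8 * t2\<^sup>2 + 4 * t2 * (2 * (t2\<^sup>2 - 2) + 2 * t2 * t3 + 2 * (t2\<^sup>2 + 2 * t3 + 2 * t2)))"
      using k8(3) unfolding coeffs(2,4) c_def by (simp only: of_int_eq_iff[symmetric, where 'a = complex]) simp
  qed
  then have ce: "c = 2" "e = 0" by (simp_all add: c_def e_def)
  \<comment> \<open>The coefficient of q^8 in the numerator has a factor a_2.\<close>
  have "k = 0" using k8(1) coeffs(2) t23 by simp
  then have "(F * F - A * A - B * B - 2 * (A * B)) * (F * F - A * A - B * B - 2 * (A * B)) = 0"
    using N_eq unfolding N_def quartic_def ce by (simp add: numeral_fps_const)
  then have "F * F - A * A - B * B - 2 * (A * B) = 0" by (simp only: mult_eq_0_iff disj_absorb)
  moreover have "(F - (A + B)) * (F + (A + B)) = F * F - A * A - B * B - 2 * (A * B)"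
    by (simp add: algebra_simps)
  ultimately have "(F - (A + B)) * (F + (A + B)) = 0" by simp
  \<comment> \<open>Both f and B start with q, so this coefficient is 2 and the sign of the square
    root is settled.\<close>
  moreover have "fps_nth (F + (A + B)) 1 \<noteq> 0" using F_nth A_nth B_nth by simp
  then have "F + (A + B) \<noteq> 0" by force
  ultimately have FAB: "F - (A + B) = 0" by simp
  have "(\<lambda>q. fq q - (etaA_q q + etaB_q q)) has_fps_expansion F - (A + B)"
    by (intro fps_expansion_intros F A B)
  then have zero: "(\<lambda>q. fq q - (etaA_q q + etaB_q q)) has_fps_expansion 0" unfolding FAB .
  have "(\<lambda>q. fq q - (etaA_q q + etaB_q q)) holomorphic_on ball 0 1"
    by (intro holomorphic_intros hol_fq holomorphic_etaA_q holomorphic_etaB_q)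
  from has_fps_expansion_0_analytic_continuation[OF zero this, of "nome \<tau>"]
  have "fq (nome \<tau>) - (etaA_q (nome \<tau>) + etaB_q (nome \<tau>)) = 0"
    using norm_nome_less_1[OF \<tau>] by simp
  then show ?thesis using fq[OF \<tau>] by (simp add: etaA_nome etaB_nome)
qed

theorem theorem1p11:
  fixes E :: "rat weierstrass" and f :: "complex \<Rightarrow> complex"
  assumes "elliptic_curve E"
    and "conductor E = 35"
    and "f \<in> cusp_forms 2 35"
    and "\<And>\<tau>. \<tau> \<in> upper_half_plane \<Longrightarrow> (\<lambda>n. L_coeff E (Suc n) * nome \<tau> ^ Suc n) sums f \<tau>"
    and "\<tau> \<in> upper_half_plane"
  shows "f \<tau> = dedekind_eta \<tau> ^ 2 * dedekind_eta (35 * \<tau>) ^ 2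
             + dedekind_eta (5 * \<tau>) ^ 2 * dedekind_eta (7 * \<tau>) ^ 2"
proof -
  obtain t2 t3 t5 t7 :: int
    where t: "t2 \<in> {-2..2}" "t3 \<in> {-6..3}" "t5 = 1 \<or> t5 = - 1" "t7 = 1 \<or> t7 = - 1"
      and L: "L_coeff E 1 = 1" "L_coeff E 2 = of_int t2" "L_coeff E 3 = of_int t3"
      "L_coeff E 4 = of_int (t2\<^sup>2 - 2)" "L_coeff E 6 = of_int (t2 * t3)"
      and L5: "\<And>n. n > 0 \<Longrightarrow> L_coeff E (5 * n) = of_int t5 * L_coeff E n"
      and L7: "\<And>n. n > 0 \<Longrightarrow> L_coeff E (7 * n) = of_int t7 * L_coeff E n"
    by (rule L_coeff_conductor_35[OF assms(2)], rule that)
  \<comment> \<open>The value 0 at n = 0 turns the series into a power series in the nome and keeps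
    the relations for 5n and 7n valid at n = 0.\<close>
  define a where "a = (\<lambda>n. if n = 0 then 0 else L_coeff E n)"
  have sums: "(\<lambda>n. a n * nome \<tau> ^ n) sums f \<tau>" if "Im \<tau> > 0" for \<tau>
  proof -
    have "(\<lambda>n. a (Suc n) * nome \<tau> ^ Suc n) sums f \<tau>"
      using assms(4)[of \<tau>] that by (simp add: upper_half_plane_def a_def)
    then show ?thesis by (subst (asm) sums_Suc_iff) (simp add: a_def)
  qed
  have "f \<tau> = etaA \<tau> + etaB \<tau>"
    by (rule level_35_identity[OF assms(3) sums t])
      (use L L5 L7 assms(5) in \<open>auto simp: a_def upper_half_plane_def\<close>)
  then show ?thesis by (simp add: eta_pair_def)
qed

end
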